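(* There is a randomized algorithm for \textsc{Shortest Self-Deleting $s$-$t$-path} which, given additionally $\varepsilon\in(0,1)$, runs in time $2^{O(k\log\mu)}(n+m)\ln\frac{1}{\varepsilon}$, always outputs ``no'' on no-instances, and on yes-instances outputs ``yes'' with probability at least $1-\varepsilon$.
   Context: All graphs are finite, simple and undirected; $n=|V(G)|$, $m=|E(G)|$. A self-deleting graph is a pair $(G,f)$ where $G=(V,E)$ is a graph and $f\colon V\to 2^{E}$ (the edges in $f(v)$ need not be incident to $v$). A path $(v_1,e_1,v_2,\dots,e_{k-1},v_k)$ in $G$ (with $e_i=\{v_i,v_{i+1}\}$) is $f$-conforming if $e_i\notin f(v_j)$ for all $j\le i$. Let $\mu=\max_{v\in V}|f(v)|$; when $\mu$ appears in a logarithm or the base of an exponential it stands for $\max\{\mu,2\}$. In \textsc{Shortest Self-Deleting $s$-$t$-path}, the input is $(G,f)$, vertices $s,t\in V(G)$ and a positive integer $k$, and the question is whether $G$ contains an $f$-conforming $s$-$t$ path on at most $k$ vertices.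
   Formalization: The factor ln(1/ε) is read as max{1, ln(1/ε)}, since for ε near 1 the stated time bound falls below one step; ε is given as a rational p/q in (0,1), and vertices are natural numbers (any finite graph up to isomorphism). *)

theory Defs
  imports "HOL-Probability.Probability"
begin

section \<open>Self-deleting graphs\<close>

definition simple_graph :: "'a set \<Rightarrow> 'a set set \<Rightarrow> bool" where
  "simple_graph V E \<longleftrightarrow>
     finite V \<and> (\<forall>e\<in>E. \<exists>u\<in>V. \<exists>v\<in>V. u \<noteq> v \<and> e = {u, v})"

definition self_deleting_graph :: "'a set \<Rightarrow> 'a set set \<Rightarrow> ('a \<Rightarrow> 'a set set) \<Rightarrow> bool" where
  "self_deleting_graph V E f \<longleftrightarrow> simple_graph V E \<and> (\<forall>v\<in>V. f v \<subseteq> E)"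

text \<open>Since the graphs are simple, a path is determined by its sequence of vertices.\<close>

definition graph_path :: "'a set \<Rightarrow> 'a set set \<Rightarrow> 'a list \<Rightarrow> bool" where
  "graph_path V E vs \<longleftrightarrow>
     vs \<noteq> [] \<and> distinct vs \<and> set vs \<subseteq> V \<and>
     (\<forall>i. Suc i < length vs \<longrightarrow> {vs ! i, vs ! Suc i} \<in> E)"

definition conforming :: "('a \<Rightarrow> 'a set set) \<Rightarrow> 'a list \<Rightarrow> bool" where
  "conforming f vs \<longleftrightarrow>
     (\<forall>i j. Suc i < length vs \<longrightarrow> j \<le> i \<longrightarrow> {vs ! i, vs ! Suc i} \<notin> f (vs ! j))"

definition short_conforming_path_exists ::
  "'a set \<Rightarrow> 'a set set \<Rightarrow> ('a \<Rightarrow> 'a set set) \<Rightarrow> 'a \<Rightarrow> 'a \<Rightarrow> nat \<Rightarrow> bool" where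
  "short_conforming_path_exists V E f s t k \<longleftrightarrow>
     (\<exists>vs. graph_path V E vs \<and> conforming f vs \<and> hd vs = s \<and> last vs = t \<and> length vs \<le> k)"

definition max_deletion :: "'a set \<Rightarrow> ('a \<Rightarrow> 'a set set) \<Rightarrow> nat" where
  "max_deletion V f = Max ((\<lambda>v. card (f v)) ` V)"

section \<open>Randomized random access machines\<close>

text \<open>
  Programs for a unit-cost random access machine whose words are natural numbers. The only
  arithmetic operations are addition and truncated subtraction, so words cannot grow by more than
  a constant number of bits per step. A program is a finite syntactic object. It mentions only
  finitely many registers; the memory is addressed indirectly through registers.
  The instruction \<open>Flip r\<close> stores a fresh fair random bit in register \<open>r\<close>.
  Tests have the form \<open>a < b\<close> for registers \<open>a\<close> and \<open>b\<close>.
\<close>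

datatype program =
    Skip
  | Const nat nat
  | Add nat nat nat
  | Sub nat nat nat
  | Load nat nat
  | Store nat nat
  | Flip nat
  | Seq program program
  | If_Less nat nat program program
  | While_Less nat nat program

record state =
  regs :: "nat \<Rightarrow> nat"
  mem :: "nat \<Rightarrow> nat"
  coins :: "bool stream"

text \<open>
  \<open>exec P \<sigma> T \<tau>\<close>: started in state \<open>\<sigma>\<close>, program \<open>P\<close> halts after exactly \<open>T\<close> steps in
  state \<open>\<tau>\<close>. Every elementary instruction and every evaluation of a test costs one step. The random
  bits not yet consumed are part of the state.
\<close>

inductive exec :: "program \<Rightarrow> state \<Rightarrow> nat \<Rightarrow> state \<Rightarrow> bool" where
  Skip: "exec Skip \<sigma> 1 \<sigma>"
| Const: "exec (Const r c) \<sigma> 1 (\<sigma>\<lparr>regs := (regs \<sigma>)(r := c)\<rparr>)"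
| Add: "exec (Add r a b) \<sigma> 1 (\<sigma>\<lparr>regs := (regs \<sigma>)(r := regs \<sigma> a + regs \<sigma> b)\<rparr>)"
| Sub: "exec (Sub r a b) \<sigma> 1 (\<sigma>\<lparr>regs := (regs \<sigma>)(r := regs \<sigma> a - regs \<sigma> b)\<rparr>)"
| Load: "exec (Load r a) \<sigma> 1 (\<sigma>\<lparr>regs := (regs \<sigma>)(r := mem \<sigma> (regs \<sigma> a))\<rparr>)"
| Store: "exec (Store a r) \<sigma> 1 (\<sigma>\<lparr>mem := (mem \<sigma>)(regs \<sigma> a := regs \<sigma> r)\<rparr>)"
| Flip: "exec (Flip r) \<sigma> 1
           (\<sigma>\<lparr>regs := (regs \<sigma>)(r := of_bool (shd (coins \<sigma>))), coins := stl (coins \<sigma>)\<rparr>)"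
| Seq: "exec P \<sigma> T1 \<sigma>' \<Longrightarrow> exec Q \<sigma>' T2 \<tau> \<Longrightarrow> exec (Seq P Q) \<sigma> (T1 + T2) \<tau>"
| If_True: "regs \<sigma> a < regs \<sigma> b \<Longrightarrow> exec P \<sigma> T \<tau> \<Longrightarrow> exec (If_Less a b P Q) \<sigma> (Suc T) \<tau>"
| If_False: "\<not> regs \<sigma> a < regs \<sigma> b \<Longrightarrow> exec Q \<sigma> T \<tau> \<Longrightarrow> exec (If_Less a b P Q) \<sigma> (Suc T) \<tau>"
| While_False: "\<not> regs \<sigma> a < regs \<sigma> b \<Longrightarrow> exec (While_Less a b P) \<sigma> 1 \<sigma>"
| While_True: "regs \<sigma> a < regs \<sigma> b \<Longrightarrow> exec P \<sigma> T1 \<sigma>' \<Longrightarrow> exec (While_Less a b P) \<sigma>' T2 \<tau> \<Longrightarrow>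
    exec (While_Less a b P) \<sigma> (Suc (T1 + T2)) \<tau>"

inductive_cases exec_elims:
  "exec Skip \<sigma> T \<tau>" "exec (Const r c) \<sigma> T \<tau>" "exec (Add r a b) \<sigma> T \<tau>" "exec (Sub r a b) \<sigma> T \<tau>"
  "exec (Load r a) \<sigma> T \<tau>" "exec (Store a r) \<sigma> T \<tau>" "exec (Flip r) \<sigma> T \<tau>"
  "exec (Seq P Q) \<sigma> T \<tau>" "exec (If_Less a b P Q) \<sigma> T \<tau>"
  "exec (While_Less a b P) \<sigma> T \<tau>"

lemma exec_deterministic:
  "exec P \<sigma> T \<tau> \<Longrightarrow> exec P \<sigma> T' \<tau>' \<Longrightarrow> T' = T \<and> \<tau>' = \<tau>"
proof (induction arbitrary: T' \<tau>' rule: exec.induct)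
  case (Seq P \<sigma> T1 \<sigma>' Q T2 \<tau>)
  from Seq.prems show ?case
    by (rule exec_elims) (use Seq.IH in blast)
next
  case (If_True \<sigma> a b P T \<tau> Q)
  from If_True.prems show ?case
    by (rule exec_elims) (use If_True.hyps If_True.IH in blast)+
next
  case (If_False \<sigma> a b Q T \<tau> P)
  from If_False.prems show ?case
    by (rule exec_elims) (use If_False.hyps If_False.IH in blast)+
next
  case (While_False \<sigma> a b P)
  from While_False.prems show ?case
    by (rule exec_elims) (use While_False.hyps in simp_all)
next
  case (While_True \<sigma> a b P T1 \<sigma>' T2 \<tau>)
  from While_True.prems show ?case
    by (rule exec_elims) (use While_True.hyps While_True.IH in blast)+
qed (erule exec_elims, simp)+

definition initial_state :: "nat list \<Rightarrow> bool stream \<Rightarrow> state" where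
  "initial_state ws \<omega> =
     \<lparr>regs = (\<lambda>_. 0), mem = (\<lambda>i. if i < length ws then ws ! i else 0), coins = \<omega>\<rparr>"

text \<open>The answer is read off register 0 when the program has halted; \<open>True\<close> means ``yes''.\<close>

definition halts_with :: "program \<Rightarrow> nat list \<Rightarrow> bool stream \<Rightarrow> nat \<Rightarrow> bool \<Rightarrow> bool" where
  "halts_with P ws \<omega> T ans \<longleftrightarrow>
     (\<exists>\<tau>. exec P (initial_state ws \<omega>) T \<tau> \<and> ans = (regs \<tau> 0 \<noteq> 0))"

definition outputs :: "program \<Rightarrow> nat list \<Rightarrow> bool stream \<Rightarrow> bool \<Rightarrow> bool" where
  "outputs P ws \<omega> ans \<longleftrightarrow> (\<exists>T. halts_with P ws \<omega> T ans)"

definition coin_space :: "bool stream measure" where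
  "coin_space = stream_space (measure_pmf (bernoulli_pmf (1/2)))"

section \<open>Encoding of instances\<close>

text \<open>
  \<open>encodes V E f s t k p q ws\<close>: the word list \<open>ws\<close> represents the instance \<open>(V, E, f, s, t, k)\<close>
  together with the error bound \<open>p / q\<close>. The vertices and the edges are numbered in an arbitrary
  way by positions in lists. After a header, \<open>ws\<close> lists the two ends of each edge and then, for
  each vertex \<open>v\<close>, the size of \<open>f v\<close> followed by the numbers of the edges in \<open>f v\<close> in some order.
\<close>

definition encodes ::
  "'a set \<Rightarrow> 'a set set \<Rightarrow> ('a \<Rightarrow> 'a set set) \<Rightarrow> 'a \<Rightarrow> 'a \<Rightarrow> nat \<Rightarrow> nat \<Rightarrow> nat \<Rightarrow> nat list \<Rightarrow> bool"
where
  "encodes V E f s t k p q ws \<longleftrightarrow>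
     (\<exists>(vs :: 'a list) (es :: 'a set list) (ends :: (nat \<times> nat) list) (fs :: nat list list) i j.
        distinct vs \<and> set vs = V \<and>
        distinct es \<and> set es = E \<and>
        (\<forall>(a, b)\<in>set ends. a < length vs \<and> b < length vs) \<and>
        es = map (\<lambda>(a, b). {vs ! a, vs ! b}) ends \<and>
        length fs = length vs \<and>
        (\<forall>l<length vs. distinct (fs ! l) \<and> set (fs ! l) \<subseteq> {..<length es} \<and>
                        (\<lambda>e. es ! e) ` set (fs ! l) = f (vs ! l)) \<and>
        i < length vs \<and> vs ! i = s \<and> j < length vs \<and> vs ! j = t \<and>
        ws = [length vs, length es, i, j, k, p, q] @
             concat (map (\<lambda>(a, b). [a, b]) ends) @
             concat (map (\<lambda>ls. length ls # ls) fs))"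

text \<open>Every instance has an encoding.\<close>

lemma encodes_exists:
  assumes "self_deleting_graph V E f" "s \<in> V" "t \<in> V"
  shows "\<exists>ws. encodes V E f s t k p q ws"
proof -
  have finV: "finite V" and E: "\<forall>e\<in>E. \<exists>u\<in>V. \<exists>v\<in>V. u \<noteq> v \<and> e = {u, v}"
    and f: "\<forall>v\<in>V. f v \<subseteq> E"
    using assms(1) by (auto simp: self_deleting_graph_def simple_graph_def)
  have "E \<subseteq> Pow V"
  proof
    fix e assume "e \<in> E"
    with E obtain u v where "u \<in> V" "v \<in> V" "e = {u, v}" by meson
    then show "e \<in> Pow V" by simp
  qed
  then have finE: "finite E" using finV by (simp add: finite_subset)
  obtain vs where vs: "distinct vs" "set vs = V" using finite_distinct_list[OF finV] by blast
  obtain es where es: "distinct es" "set es = E" using finite_distinct_list[OF finE] by blast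
  have "\<forall>e\<in>E. \<exists>ab. fst ab < length vs \<and> snd ab < length vs \<and> e = {vs ! fst ab, vs ! snd ab}"
  proof
    fix e assume "e \<in> E"
    then obtain u v where uv: "u \<in> set vs" "v \<in> set vs" "e = {u, v}" using E vs by meson
    then obtain a b where "a < length vs" "vs ! a = u" "b < length vs" "vs ! b = v"
      by (meson in_set_conv_nth)
    then show "\<exists>ab. fst ab < length vs \<and> snd ab < length vs \<and> e = {vs ! fst ab, vs ! snd ab}"
      using uv by (intro exI[of _ "(a, b)"]) auto
  qed
  then obtain g where g: "\<forall>e\<in>E. fst (g e) < length vs \<and> snd (g e) < length vs \<and>
      e = {vs ! fst (g e), vs ! snd (g e)}" by metis
  define fs where "fs = map (\<lambda>v. filter (\<lambda>l. es ! l \<in> f v) [0..<length es]) vs"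
  obtain i where i: "i < length vs" "vs ! i = s" using assms(2) vs by (metis in_set_conv_nth)
  obtain j where j: "j < length vs" "vs ! j = t" using assms(3) vs by (metis in_set_conv_nth)
  have "(\<lambda>e. es ! e) ` set (fs ! l) = f (vs ! l)" if "l < length vs" for l
  proof -
    have "f (vs ! l) \<subseteq> set es" using f vs es that nth_mem by blast
    moreover have "set (fs ! l) = {e. e < length es \<and> es ! e \<in> f (vs ! l)}"
      using that by (auto simp: fs_def)
    ultimately show ?thesis by (auto simp: set_conv_nth)
  qed
  moreover have "\<forall>(a, b)\<in>set (map g es). a < length vs \<and> b < length vs"
    using g es by (auto simp: case_prod_beta)
  moreover have "es = map (\<lambda>(a, b). {vs ! a, vs ! b}) (map g es)"
    unfolding map_map by (rule map_idI[symmetric]) (use g es in \<open>simp add: case_prod_beta\<close>)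
  moreover have "length fs = length vs" by (simp add: fs_def)
  moreover have "\<forall>l<length vs. distinct (fs ! l) \<and> set (fs ! l) \<subseteq> {..<length es}"
    by (auto simp: fs_def)
  ultimately show ?thesis
    unfolding encodes_def using vs es i j
    by (intro exI[of _ vs] exI[of _ es] exI[of _ "map g es"] exI[of _ fs] exI[of _ i] exI[of _ j] exI
        conjI) (assumption | simp)+
qed

end

theory Submission
  imports Defs "HOL-Library.Nat_Bijection"
begin

text \<open>
  Give every edge an independent random colour. Colours below \<open>k - 1\<close> are red, and every edge receives
  each red colour with probability \<open>\<Theta>(1 / (k \<mu>))\<close>. For a fixed conforming path on at most \<open>k\<close> vertices,
  with probability \<open>\<mu>\<^bsup>-O(k)\<^esup>\<close> its edges get pairwise distinct red colours and the at most \<open>k \<mu>\<close> other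
  edges forbidden by its vertices are not red. In this case, the path is found by dynamic programming
  over the sets of used colours: a vertex may be entered with the set \<open>S\<close> if all red edges it forbids
  have a colour in \<open>S\<close>. Conversely, every walk found in this way conforms, because each of its edges
  has a fresh colour when it is used, and a repeated vertex only means that a prefix suffices.
  Independent trials amplify the success probability; their number is computed by doubling, as the
  machine cannot multiply.
\<close>

section \<open>Reasoning about running programs\<close>

text \<open>Colours are blocks of fair coins, so their number \<open>2 ^ B\<close> is a power of
  two; it lies between \<open>2 * k * mu\<close> and \<open>8 * k * mu\<close>. The lower bound
  makes an edge red with probability at most \<open>1 / (2 * mu)\<close>, which keeps all of
  \<open>k * mu\<close> forbidden edges non-red with probability at least \<open>1 / 2 ^ k\<close>.
  The upper bound limits the price of a red colour, but over the edges of a path a prescribed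
  assignment of colours would still lose about \<open>k ^ k\<close>, too much for
  \<open>2 ^ O(k * log mu)\<close>. The rescue is that every injective assignment is good: their
  number is essentially a factorial, which cancels \<open>k ^ k\<close> up to \<open>4 ^ k\<close>.
  The table is indexed by subsets of the \<open>k - 1\<close> red colours only, not of all colours.
  Its rows have length \<open>n\<close>, so codes of sets are carried around multiplied by
  \<open>n\<close>: addresses of rows then need one addition, and deleting a colour from a set is
  the subtraction of a tabulated number \<open>n * 2 ^ c\<close>.\<close>

notation Seq (infixr ";;" 60)

text \<open>Total correctness with a time budget: \<open>exec\<close> is deterministic, so one
  halting execution describes the only one. The budget \<open>T\<close> is an upper bound, whereas
  \<open>exec\<close> counts exactly; this allows costs to be rounded up.\<close>

definition run :: "state \<Rightarrow> program \<Rightarrow> nat \<Rightarrow> (state \<Rightarrow> bool) \<Rightarrow> bool" where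
  "run \<sigma> P T Q \<longleftrightarrow> (\<exists>T' \<tau>. exec P \<sigma> T' \<tau> \<and> T' \<le> T \<and> Q \<tau>)"

lemma exec_Seq_assoc: "exec ((P ;; Q) ;; R) \<sigma> T \<tau> \<longleftrightarrow> exec (P ;; Q ;; R) \<sigma> T \<tau>"
proof
  assume "exec ((P ;; Q) ;; R) \<sigma> T \<tau>"
  then obtain T1 T2 T3 \<sigma>1 \<sigma>2 where "exec P \<sigma> T1 \<sigma>1" "exec Q \<sigma>1 T2 \<sigma>2" "exec R \<sigma>2 T3 \<tau>"
    "T = (T1 + T2) + T3"
    by (blast elim: exec_elims)
  then show "exec (P ;; Q ;; R) \<sigma> T \<tau>"
    by (metis exec.Seq add.assoc)
next
  assume "exec (P ;; Q ;; R) \<sigma> T \<tau>"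
  then obtain T1 T2 T3 \<sigma>1 \<sigma>2 where "exec P \<sigma> T1 \<sigma>1" "exec Q \<sigma>1 T2 \<sigma>2" "exec R \<sigma>2 T3 \<tau>"
    "T = T1 + (T2 + T3)"
    by (blast elim: exec_elims)
  then show "exec ((P ;; Q) ;; R) \<sigma> T \<tau>"
    by (metis exec.Seq add.assoc)
qed

text \<open>The catch-all clause is right for \<open>Skip\<close>. On compound programs it is a
  dummy value, kept away by \<open>elementary\<close>.\<close>

fun step :: "program \<Rightarrow> state \<Rightarrow> state" where
  "step (Const r c) \<sigma> = \<sigma>\<lparr>regs := (regs \<sigma>)(r := c)\<rparr>"
| "step (Add r a b) \<sigma> = \<sigma>\<lparr>regs := (regs \<sigma>)(r := regs \<sigma> a + regs \<sigma> b)\<rparr>"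
| "step (Sub r a b) \<sigma> = \<sigma>\<lparr>regs := (regs \<sigma>)(r := regs \<sigma> a - regs \<sigma> b)\<rparr>"
| "step (Load r a) \<sigma> = \<sigma>\<lparr>regs := (regs \<sigma>)(r := mem \<sigma> (regs \<sigma> a))\<rparr>"
| "step (Store a r) \<sigma> = \<sigma>\<lparr>mem := (mem \<sigma>)(regs \<sigma> a := regs \<sigma> r)\<rparr>"
| "step (Flip r) \<sigma> =
    \<sigma>\<lparr>regs := (regs \<sigma>)(r := of_bool (shd (coins \<sigma>))), coins := stl (coins \<sigma>)\<rparr>"
| "step _ \<sigma> = \<sigma>"

fun elementary :: "program \<Rightarrow> bool" where
  "elementary (P ;; Q) = False"
| "elementary (If_Less a b P Q) = False"
| "elementary (While_Less a b P) = False"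
| "elementary _ = True"

lemma exec_elementary: "elementary P \<Longrightarrow> exec P \<sigma> T \<tau> \<longleftrightarrow> T = 1 \<and> \<tau> = step P \<sigma>"
proof
  assume "elementary P" "exec P \<sigma> T \<tau>"
  then show "T = 1 \<and> \<tau> = step P \<sigma>" by (cases P) (auto elim: exec_elims)
next
  assume *: "elementary P" and "T = 1 \<and> \<tau> = step P \<sigma>"
  then have "T = 1" "\<tau> = step P \<sigma>" by simp_all
  with * show "exec P \<sigma> T \<tau>" by (cases P) (simp_all only: step.simps exec.intros elementary.simps)
qed

lemma run_elementary: "elementary P \<Longrightarrow> run \<sigma> P T Q \<longleftrightarrow> 1 \<le> T \<and> Q (step P \<sigma>)"
  by (auto simp: run_def exec_elementary)

lemma run_Seq_elementary:
  "elementary P \<Longrightarrow> run \<sigma> (P ;; Q) T R \<longleftrightarrow> 1 \<le> T \<and> run (step P \<sigma>) Q (T - 1) R"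
proof
  assume "elementary P" "run \<sigma> (P ;; Q) T R"
  then show "1 \<le> T \<and> run (step P \<sigma>) Q (T - 1) R"
    by (fastforce simp: run_def exec_elementary elim: exec_elims)
next
  assume P: "elementary P" and "1 \<le> T \<and> run (step P \<sigma>) Q (T - 1) R"
  then obtain T' \<tau> where "exec Q (step P \<sigma>) T' \<tau>" "1 + T' \<le> T" "R \<tau>"
    by (auto simp: run_def)
  with P show "run \<sigma> (P ;; Q) T R"
    unfolding run_def by (meson exec_elementary exec.Seq)
qed

lemma run_Seq_assoc: "run \<sigma> ((P ;; Q) ;; R) T S \<longleftrightarrow> run \<sigma> (P ;; Q ;; R) T S"
  by (simp add: run_def exec_Seq_assoc)

lemma run_If:
  "run \<sigma> (If_Less a b P Q) T R \<longleftrightarrow>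
     1 \<le> T \<and> run \<sigma> (if regs \<sigma> a < regs \<sigma> b then P else Q) (T - 1) R"
proof
  assume "run \<sigma> (If_Less a b P Q) T R"
  then obtain T' \<tau> where "exec (If_Less a b P Q) \<sigma> T' \<tau>" "T' \<le> T" "R \<tau>"
    by (auto simp: run_def)
  then show "1 \<le> T \<and> run \<sigma> (if regs \<sigma> a < regs \<sigma> b then P else Q) (T - 1) R"
    by (fastforce simp: run_def elim: exec_elims)
next
  assume A: "1 \<le> T \<and> run \<sigma> (if regs \<sigma> a < regs \<sigma> b then P else Q) (T - 1) R"
  then obtain T' \<tau> where "exec (if regs \<sigma> a < regs \<sigma> b then P else Q) \<sigma> T' \<tau>" "T' \<le> T - 1" "R \<tau>"
    by (auto simp: run_def)
  with A have "exec (If_Less a b P Q) \<sigma> (Suc T') \<tau>" "Suc T' \<le> T"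
    by (auto split: if_splits intro: exec.intros)
  with \<open>R \<tau>\<close> show "run \<sigma> (If_Less a b P Q) T R"
    unfolding run_def by blast
qed

text \<open>The continuation is copied into both branches. Thus no common postcondition of the
  branches has to be stated, and rewriting can go on behind the test.\<close>

lemma run_Seq_If:
  "run \<sigma> (If_Less a b P Q ;; S) T R \<longleftrightarrow>
     1 \<le> T \<and> run \<sigma> (if regs \<sigma> a < regs \<sigma> b then P ;; S else Q ;; S) (T - 1) R"
proof -
  have *: "exec (If_Less a b P Q ;; S) \<sigma> T \<tau> \<longleftrightarrow> exec (If_Less a b (P ;; S) (Q ;; S)) \<sigma> T \<tau>" for T \<tau>
  proof
    assume "exec (If_Less a b P Q ;; S) \<sigma> T \<tau>"
    then obtain T1 T2 \<sigma>1 where *: "exec (If_Less a b P Q) \<sigma> T1 \<sigma>1" "exec S \<sigma>1 T2 \<tau>" "T = T1 + T2"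
      by (auto elim: exec_elims)
    from *(1) show "exec (If_Less a b (P ;; S) (Q ;; S)) \<sigma> T \<tau>"
      using *(2,3) by (auto elim!: exec_elims(9) simp flip: add_Suc intro!: exec.If_True exec.If_False exec.Seq simp del: add_Suc)
        (simp_all add: exec.If_True exec.If_False exec.Seq)
  next
    assume "exec (If_Less a b (P ;; S) (Q ;; S)) \<sigma> T \<tau>"
    then show "exec (If_Less a b P Q ;; S) \<sigma> T \<tau>"
      by (auto elim!: exec_elims(8,9))
        (metis add_Suc exec.If_True exec.If_False exec.Seq)+
  qed
  have "run \<sigma> (If_Less a b P Q ;; S) T R \<longleftrightarrow> run \<sigma> (If_Less a b (P ;; S) (Q ;; S)) T R"
    by (simp add: run_def *)
  then show ?thesis by (simp add: run_If)
qed

text \<open>Read from left to right, these equivalences execute loop-free code symbolically: a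
  \<open>run\<close> statement becomes arithmetic on the budget and a claim about an explicit final
  state.\<close>

lemmas run_simps = run_elementary run_Seq_elementary run_Seq_assoc run_If run_Seq_If

section \<open>Syntactic footprints, and rules for sequences and loops\<close>

fun writes :: "program \<Rightarrow> nat set" where
  "writes (Const r c) = {r}"
| "writes (Add r a b) = {r}"
| "writes (Sub r a b) = {r}"
| "writes (Load r a) = {r}"
| "writes (Flip r) = {r}"
| "writes (P ;; Q) = writes P \<union> writes Q"
| "writes (If_Less a b P Q) = writes P \<union> writes Q"
| "writes (While_Less a b P) = writes P"
| "writes _ = {}"

fun storeless :: "program \<Rightarrow> bool" where
  "storeless (Store a r) = False"
| "storeless (P ;; Q) = (storeless P \<and> storeless Q)"
| "storeless (If_Less a b P Q) = (storeless P \<and> storeless Q)"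
| "storeless (While_Less a b P) = storeless P"
| "storeless _ = True"

fun flipless :: "program \<Rightarrow> bool" where
  "flipless (Flip r) = False"
| "flipless (P ;; Q) = (flipless P \<and> flipless Q)"
| "flipless (If_Less a b P Q) = (flipless P \<and> flipless Q)"
| "flipless (While_Less a b P) = flipless P"
| "flipless _ = True"

text \<open>Registers are tracked one by one, memory and coins only as wholes. Addresses are
  computed at run time, so finer claims about the memory belong to the invariants.\<close>

definition frame :: "program \<Rightarrow> state \<Rightarrow> state \<Rightarrow> bool" where
  "frame P \<sigma> \<tau> \<longleftrightarrow> (\<forall>r. r \<notin> writes P \<longrightarrow> regs \<tau> r = regs \<sigma> r) \<and>
     (storeless P \<longrightarrow> mem \<tau> = mem \<sigma>) \<and> (flipless P \<longrightarrow> coins \<tau> = coins \<sigma>)"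

lemma frame_refl: "frame P \<sigma> \<sigma>"
  by (simp add: frame_def)

lemma frame_trans: "frame P \<sigma> \<sigma>' \<Longrightarrow> frame P \<sigma>' \<tau> \<Longrightarrow> frame P \<sigma> \<tau>"
  by (simp add: frame_def)

lemma exec_frame: "exec P \<sigma> T \<tau> \<Longrightarrow> frame P \<sigma> \<tau>"
  by (induction rule: exec.induct) (auto simp: frame_def)

lemma frame_regs: "frame P \<sigma> \<tau> \<Longrightarrow> r \<notin> writes P \<Longrightarrow> regs \<tau> r = regs \<sigma> r"
  by (simp add: frame_def)

lemma frame_mem: "frame P \<sigma> \<tau> \<Longrightarrow> storeless P \<Longrightarrow> mem \<tau> = mem \<sigma>"
  by (simp add: frame_def)

lemma frame_coins: "frame P \<sigma> \<tau> \<Longrightarrow> flipless P \<Longrightarrow> coins \<tau> = coins \<sigma>"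
  by (simp add: frame_def)

text \<open>The frame condition holds for every execution, so the rule supplies it for free. The
  same is done in \<open>run_Seq\<close> and \<open>run_While\<close>; specifications then need to
  mention only what changes.\<close>

lemma run_mono:
  "run \<sigma> P T Q \<Longrightarrow> T \<le> T' \<Longrightarrow> (\<And>\<tau>. frame P \<sigma> \<tau> \<Longrightarrow> Q \<tau> \<Longrightarrow> Q' \<tau>) \<Longrightarrow> run \<sigma> P T' Q'"
  unfolding run_def by (meson exec_frame order.trans)

lemma run_Seq:
  assumes "run \<sigma> P T1 R" "\<And>\<sigma>'. frame P \<sigma> \<sigma>' \<Longrightarrow> R \<sigma>' \<Longrightarrow> run \<sigma>' Q T2 S" "T1 + T2 \<le> T"
  shows "run \<sigma> (P ;; Q) T S"
proof -
  obtain T1' \<sigma>' where 1: "exec P \<sigma> T1' \<sigma>'" "T1' \<le> T1" "R \<sigma>'"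
    using assms(1) by (auto simp: run_def)
  obtain T2' \<tau> where 2: "exec Q \<sigma>' T2' \<tau>" "T2' \<le> T2" "S \<tau>"
    using assms(2)[OF exec_frame[OF 1(1)] 1(3)] by (auto simp: run_def)
  have "exec (P ;; Q) \<sigma> (T1' + T2') \<tau>" using 1 2 by (simp add: exec.Seq)
  then show ?thesis
    unfolding run_def using 1(2) 2(2,3) assms(3)
    by (intro exI[of _ "T1' + T2'"] exI[of _ \<tau>]) simp
qed

text \<open>The number \<open>N\<close> of passes is fixed and the invariant is indexed by the
  passes done. Each pass costs one test and at most \<open>t\<close> steps, and a failing test ends
  the loop, hence \<open>N * (t + 1) + 1\<close>. The frame compares with the state at loop entry,
  not with the previous pass.\<close>

lemma run_While:
  assumes "Inv 0 \<sigma>"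
    and body: "\<And>i \<sigma>'. i < N \<Longrightarrow> frame P \<sigma> \<sigma>' \<Longrightarrow> Inv i \<sigma>' \<Longrightarrow>
      regs \<sigma>' a < regs \<sigma>' b \<and> run \<sigma>' P t (Inv (Suc i))"
    and exit: "\<And>\<sigma>'. frame P \<sigma> \<sigma>' \<Longrightarrow> Inv N \<sigma>' \<Longrightarrow> \<not> regs \<sigma>' a < regs \<sigma>' b \<and> Q \<sigma>'"
    and "N * (t + 1) + 1 \<le> T"
  shows "run \<sigma> (While_Less a b P) T Q"
proof -
  \<comment> \<open>Downward induction from the exit at \<open>i = N\<close>, because the bound
    counts the passes still to come.\<close>
  have "run \<sigma>' (While_Less a b P) ((N - i) * (t + 1) + 1) Q"
    if "i \<le> N" "frame P \<sigma> \<sigma>'" "Inv i \<sigma>'" for i \<sigma>'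
    using that
  proof (induction i arbitrary: \<sigma>' rule: inc_induct)
    case base
    then have "exec (While_Less a b P) \<sigma>' 1 \<sigma>'" "Q \<sigma>'"
      using exit[OF base] by (simp_all only: exec.While_False not_False_eq_True)
    then show ?case by (auto simp: run_def intro!: exI)
  next
    case (step i)
    obtain T1 \<sigma>1 where 1: "exec P \<sigma>' T1 \<sigma>1" "T1 \<le> t" "Inv (Suc i) \<sigma>1" and lt: "regs \<sigma>' a < regs \<sigma>' b"
      using body[OF step.hyps(2) step.prems] by (auto simp: run_def)
    have "frame P \<sigma> \<sigma>1" using step.prems(1) exec_frame[OF 1(1)] by (rule frame_trans)
    from step.IH[OF this 1(3)] obtain T2 \<tau> where 2: "exec (While_Less a b P) \<sigma>1 T2 \<tau>"
      "T2 \<le> (N - Suc i) * (t + 1) + 1" "Q \<tau>" by (auto simp: run_def)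
    have eq: "(N - i) * (t + 1) = (N - Suc i) * (t + 1) + (t + 1)"
      using step.hyps(2) by (metis Suc_diff_Suc add.commute mult_Suc)
    have "exec (While_Less a b P) \<sigma>' (Suc (T1 + T2)) \<tau>"
      using lt 1(1) 2(1) by (rule exec.While_True)
    moreover have "Suc (T1 + T2) \<le> (N - i) * (t + 1) + 1"
      using 1(2) 2(2) eq by linarith
    ultimately show ?case using 2(3) unfolding run_def by blast
  qed
  from this[of 0 \<sigma>] assms(1,4) show ?thesis
    by (auto simp: frame_refl intro: run_mono)
qed

lemma sdrop_Suc_stl: "stl (sdrop i \<omega>) = sdrop (Suc i) \<omega>"
  by (simp flip: sdrop_stl)

section \<open>Fair coins\<close>

lemma prob_space_coin_space: "prob_space coin_space"
  unfolding coin_space_def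
  by (rule prob_space.prob_space_stream_space) (rule prob_space_measure_pmf)

interpretation coin: prob_space coin_space
  by (rule prob_space_coin_space)

lemma space_coin_space [simp]: "space coin_space = UNIV"
  by (simp add: coin_space_def space_stream_space)

text \<open>No condition on \<open>P\<close> is needed, as \<open>stake N\<close> is measurable into
  the discrete space of bit lists.\<close>

lemma coin_prefix_event: "{\<omega>. P (stake N \<omega>)} \<in> sets coin_space"
proof -
  have "sets coin_space = sets (stream_space (count_space (UNIV :: bool set)))"
    unfolding coin_space_def by (rule sets_stream_space_cong) simp
  then have "stake N \<in> coin_space \<rightarrow>\<^sub>M count_space UNIV"
    using measurable_stake[of N, where 'a = bool] measurable_cong_sets by blast
  from measurable_sets[OF this, of "Collect P"] show ?thesis
    by (simp add: vimage_def)
qed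

lemma coin_shift_event:
  assumes "A \<in> sets coin_space"
  shows "{\<omega>. sdrop N \<omega> \<in> A} \<in> sets coin_space"
proof -
  have "sdrop N \<in> coin_space \<rightarrow>\<^sub>M coin_space" unfolding coin_space_def by measurable
  from measurable_sets[OF this assms] show ?thesis by (simp add: vimage_def)
qed

text \<open>Conditioning on the first coin. This is where fairness enters; the later probabilities
  follow by taking coins off the front of the stream.\<close>

lemma measure_coin_space_step:
  assumes "X \<in> sets coin_space"
  shows "measure coin_space X =
    (measure coin_space {\<omega>. True ## \<omega> \<in> X} + measure coin_space {\<omega>. False ## \<omega> \<in> X}) / 2"
proof -
  let ?m = "measure coin_space"
  have "ennreal (?m X) =
      (\<integral>\<^sup>+b. ennreal (?m {\<omega>. b ## \<omega> \<in> X}) \<partial>measure_pmf (bernoulli_pmf (1/2)))"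
    using prob_space.prob_stream_space[where P = "\<lambda>\<omega>. \<omega> \<in> X",
        OF prob_space_measure_pmf[of "bernoulli_pmf (1/2)"]] assms
    by (simp add: coin_space_def space_stream_space)
  also have "\<dots> = ennreal (?m {\<omega>. True ## \<omega> \<in> X}) * ennreal (1/2) +
      ennreal (?m {\<omega>. False ## \<omega> \<in> X}) * ennreal (1/2)"
    by (subst nn_integral_bernoulli_pmf) auto
  also have "\<dots> = ennreal ((?m {\<omega>. True ## \<omega> \<in> X} + ?m {\<omega>. False ## \<omega> \<in> X}) / 2)"
    by (simp only: ennreal_mult[symmetric] ennreal_plus[symmetric] measure_nonneg mult_nonneg_nonneg
        zero_le_divide_1_iff zero_le_numeral) (simp add: add_divide_distrib)
  finally show ?thesis by (subst (asm) ennreal_inj) auto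
qed

text \<open>Removing the first coin \<open>b\<close> replaces \<open>G\<close> by the lists that
  \<open>b\<close> extends to members of \<open>G\<close>, so \<open>G\<close> has to be arbitrary
  in the induction. The set \<open>A\<close> stays the same, since it only sees the stream behind
  the block.\<close>

lemma coin_prefix_indep:
  assumes A: "A \<in> sets coin_space"
  shows "measure coin_space {\<omega>. stake N \<omega> \<in> G \<and> sdrop N \<omega> \<in> A} =
    measure coin_space {\<omega>. stake N \<omega> \<in> G} * measure coin_space A"
proof (induction N arbitrary: G)
  case 0
  then show ?case using coin.prob_space by (cases "[] \<in> G") auto
next
  case (Suc N)
  have m1: "{\<omega>. stake (Suc N) \<omega> \<in> G \<and> sdrop (Suc N) \<omega> \<in> A} \<in> sets coin_space"
    using sets.Int[OF coin_prefix_event[of "\<lambda>xs. xs \<in> G" "Suc N"] coin_shift_event[OF A, of "Suc N"]]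
    by (simp add: Int_def del: stake.simps sdrop.simps)
  have m2: "{\<omega>. stake (Suc N) \<omega> \<in> G} \<in> sets coin_space"
    by (rule coin_prefix_event)
  have "measure coin_space {\<omega>. stake N \<omega> \<in> {xs. b # xs \<in> G} \<and> sdrop N \<omega> \<in> A} =
      measure coin_space {\<omega>. stake N \<omega> \<in> {xs. b # xs \<in> G}} * measure coin_space A" for b
    by (rule Suc)
  then show ?case
    unfolding measure_coin_space_step[OF m1] measure_coin_space_step[OF m2] by (simp add: field_simps)
qed

section \<open>Binary numbers read from the coins\<close>

definition bits_val :: "bool list \<Rightarrow> nat" where
  "bits_val bs = foldl (\<lambda>x b. x + x + of_bool b) 0 bs"

lemma bits_val_snoc: "bits_val (bs @ [b]) = bits_val bs + bits_val bs + of_bool b"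
  by (simp add: bits_val_def)

text \<open>The machine shifts new bits in from the right, while probabilities are computed from the
  first coin on. This form exposes the first coin as the most significant bit.\<close>

lemma bits_val_Cons: "bits_val (b # bs) = of_bool b * 2 ^ length bs + bits_val bs"
proof (induction bs rule: rev_induct)
  case Nil
  then show ?case by (simp add: bits_val_def)
next
  case (snoc c bs)
  have "bits_val (b # bs @ [c]) = bits_val ((b # bs) @ [c])" by simp
  then show ?case using snoc by (simp only: bits_val_snoc) simp
qed

lemma bits_val_less: "bits_val bs < 2 ^ length bs"
  by (induction bs) (auto simp: bits_val_Cons bits_val_def[of "[]"] of_bool_def)

text \<open>The first coin decides whether the value lies in the lower or the upper half of the
  range. Exactly one of its outcomes is compatible with \<open>a\<close>, so each further coin
  halves the probability.\<close>

lemma measure_bits_val: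
  assumes "a < 2 ^ B"
  shows "measure coin_space {\<omega>. bits_val (stake B \<omega>) = a} = 1 / 2 ^ B"
  using assms
proof (induction B arbitrary: a)
  case 0
  then show ?case using coin.prob_space by (simp add: bits_val_def)
next
  case (Suc B)
  have m: "{\<omega>. bits_val (stake (Suc B) \<omega>) = a} \<in> sets coin_space" by (rule coin_prefix_event)
  have lt: "bits_val (stake B \<omega>) < 2 ^ B" for \<omega>
    using bits_val_less[of "stake B \<omega>"] by simp
  show ?case
  proof (cases "a < 2 ^ B")
    case True
    then have e: "{\<omega>. 2 ^ B + bits_val (stake B \<omega>) = a} = {}" by auto
    show ?thesis unfolding measure_coin_space_step[OF m]
      using Suc.IH[OF True] by (simp add: bits_val_Cons e)
  next
    case False
    then have e: "{\<omega>. bits_val (stake B \<omega>) = a} = {}" using lt by auto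
    have "measure coin_space {\<omega>. 2 ^ B + bits_val (stake B \<omega>) = a} =
        measure coin_space {\<omega>. bits_val (stake B \<omega>) = a - 2 ^ B}"
      by (rule arg_cong[where f = "measure coin_space"]) (use False in auto)
    also have "\<dots> = 1 / 2 ^ B" using Suc.prems False by (intro Suc.IH) auto
    finally show ?thesis unfolding measure_coin_space_step[OF m]
      by (simp add: bits_val_Cons e)
  qed
qed

lemma measure_bits_val_in:
  assumes "A \<subseteq> {..<2 ^ B}"
  shows "measure coin_space {\<omega>. bits_val (stake B \<omega>) \<in> A} = card A / 2 ^ B"
proof -
  have "finite A" using assms finite_subset by blast
  have "{\<omega>. bits_val (stake B \<omega>) \<in> A} = (\<Union>a\<in>A. {\<omega>. bits_val (stake B \<omega>) = a})" by auto
  then have "measure coin_space {\<omega>. bits_val (stake B \<omega>) \<in> A} =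
      (\<Sum>a\<in>A. measure coin_space {\<omega>. bits_val (stake B \<omega>) = a})"
    using \<open>finite A\<close>
    by (simp only:, intro coin.finite_measure_finite_Union)
      (auto simp: disjoint_family_on_def coin_prefix_event[of "\<lambda>bs. bits_val bs = _"])
  also have "\<dots> = (\<Sum>a\<in>A. 1 / 2 ^ B)"
    using assms by (intro sum.cong refl measure_bits_val) auto
  finally show ?thesis by simp
qed

section \<open>Edge colours as independent uniform numbers\<close>

definition colour :: "nat \<Rightarrow> bool stream \<Rightarrow> nat \<Rightarrow> nat" where
  "colour B \<omega> e = bits_val (stake B (sdrop (e * B) \<omega>))"

lemma colour_less: "colour B \<omega> e < 2 ^ B"
  using bits_val_less[of "stake B (sdrop (e * B) \<omega>)"] by (simp add: colour_def)

lemma colour_event: "{\<omega>. P (colour B \<omega> e)} \<in> sets coin_space"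
  using coin_shift_event[OF coin_prefix_event] by (simp add: colour_def)

lemma colours_event: "{\<omega>. \<forall>e<m. P e (colour B \<omega> e)} \<in> sets coin_space"
proof (induction m)
  case 0
  then show ?case using sets.top[of coin_space] by simp
next
  case (Suc m)
  then show ?case using sets.Int[OF Suc colour_event[of "P m" B m]]
    by (simp add: Int_def All_less_Suc conj_commute)
qed

text \<open>Edge \<open>0\<close> uses the first \<open>B\<close> coins, and the other colours are
  those of the shifted stream; independence of prefix and remainder splits off one factor at a
  time.\<close>

lemma measure_colours:
  assumes "\<And>e. e < m \<Longrightarrow> A e \<subseteq> {..<2 ^ B}"
  shows "measure coin_space {\<omega>. \<forall>e<m. colour B \<omega> e \<in> A e} = (\<Prod>e<m. card (A e) / 2 ^ B)"
  using assms
proof (induction m arbitrary: A)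
  case 0
  then show ?case using coin.prob_space by simp
next
  case (Suc m)
  have shift: "colour B \<omega> (Suc e) = colour B (sdrop B \<omega>) e" for \<omega> e
    by (simp add: colour_def sdrop_add)
  have "{\<omega>. \<forall>e<Suc m. colour B \<omega> e \<in> A e} = {\<omega>. stake B \<omega> \<in> {bs. bits_val bs \<in> A 0} \<and>
      sdrop B \<omega> \<in> {\<omega>. \<forall>e<m. colour B \<omega> e \<in> A (Suc e)}}"
    by (auto simp: All_less_Suc2 less_Suc_eq_0_disj shift) (simp_all add: colour_def)
  also have "measure coin_space \<dots> = measure coin_space {\<omega>. stake B \<omega> \<in> {bs. bits_val bs \<in> A 0}} *
      measure coin_space {\<omega>. \<forall>e<m. colour B \<omega> e \<in> A (Suc e)}"
    by (rule coin_prefix_indep) (rule colours_event)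
  also have "\<dots> = card (A 0) / 2 ^ B * (\<Prod>e<m. card (A (Suc e)) / 2 ^ B)"
    using Suc.prems measure_bits_val_in[of "A 0" B] Suc.IH[of "\<lambda>e. A (Suc e)"] by simp
  finally show ?case by (simp add: prod.lessThan_Suc_shift del: prod.lessThan_Suc)
qed

text \<open>A trial looks at \<open>m * B\<close> coins only, so consecutive trials can be given
  disjoint blocks of coins.\<close>

lemma stake_colour_cong:
  assumes "stake (m * B) \<omega> = stake (m * B) \<omega>'" "e < m"
  shows "colour B \<omega> e = colour B \<omega>' e"
proof -
  have "stake B (sdrop (e * B) \<omega>) = take B (drop (e * B) (stake (m * B) \<omega>))" for \<omega> :: "bool stream"
  proof -
    have "Suc e * B \<le> m * B" using assms(2) by (intro mult_right_mono) auto
    then have "B \<le> m * B - e * B" by simp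
    then show ?thesis by (simp add: drop_stake take_stake min_def)
  qed
  with assms(1) show ?thesis by (simp add: colour_def)
qed

text \<open>The rounds are independent, since round \<open>r\<close> uses the \<open>r\<close>-th block of \<open>N\<close> coins.\<close>

lemma measure_rounds:
  assumes G: "\<And>\<omega> \<omega>'. stake N \<omega> = stake N \<omega>' \<Longrightarrow> G \<omega> \<longleftrightarrow> G \<omega>'"
  shows "{\<omega>. \<exists>r<R. G (sdrop (r * N) \<omega>)} \<in> sets coin_space"
    and "measure coin_space {\<omega>. \<exists>r<R. G (sdrop (r * N) \<omega>)} =
      1 - (1 - measure coin_space {\<omega>. G \<omega>}) ^ R"
proof -
  \<comment> \<open>\<open>G\<close> depends on the first \<open>N\<close> coins only, so it is the
    preimage of a set of prefixes, the form that \<open>coin_prefix_indep\<close> requires.\<close>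
  define H where "H = {bs. \<exists>\<omega>. stake N \<omega> = bs \<and> G \<omega>}"
  have GH: "G \<omega> \<longleftrightarrow> stake N \<omega> \<in> H" for \<omega>
    using G unfolding H_def by blast
  show m: "{\<omega>. \<exists>r<R. G (sdrop (r * N) \<omega>)} \<in> sets coin_space" for R
  proof -
    have "{\<omega>. \<exists>r<R. G (sdrop (r * N) \<omega>)} =
        (\<Union>r\<in>{..<R}. {\<omega>. sdrop (r * N) \<omega> \<in> {\<omega>. stake N \<omega> \<in> H}})"
      by (auto simp: GH)
    also have "\<dots> \<in> sets coin_space"
      by (intro sets.finite_UN coin_shift_event coin_prefix_event) auto
    finally show ?thesis .
  qed
  have c: "measure coin_space {\<omega>. \<not> P \<omega>} = 1 - measure coin_space {\<omega>. P \<omega>}"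
    if "{\<omega>. P \<omega>} \<in> sets coin_space" for P
    using coin.prob_compl[OF that] by (simp add: Collect_neg_eq Compl_eq_Diff_UNIV)
  have "measure coin_space {\<omega>. \<forall>r<R. \<not> G (sdrop (r * N) \<omega>)} =
      (1 - measure coin_space {\<omega>. G \<omega>}) ^ R"
  proof (induction R)
    case 0
    then show ?case using coin.prob_space by simp
  next
    case (Suc R)
    have "{\<omega>. \<forall>r<Suc R. \<not> G (sdrop (r * N) \<omega>)} = {\<omega>. stake N \<omega> \<in> - H \<and>
        sdrop N \<omega> \<in> {\<omega>. \<forall>r<R. \<not> G (sdrop (r * N) \<omega>)}}"
      by (auto simp: All_less_Suc2 less_Suc_eq_0_disj sdrop_add GH)
    also have "measure coin_space \<dots> = measure coin_space {\<omega>. stake N \<omega> \<in> - H} *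
        measure coin_space {\<omega>. \<forall>r<R. \<not> G (sdrop (r * N) \<omega>)}"
      using sets.compl_sets[OF m[of R]]
      by (intro coin_prefix_indep) (simp add: Collect_neg_eq[symmetric] Compl_eq_Diff_UNIV[symmetric])
    also have "measure coin_space {\<omega>. stake N \<omega> \<in> - H} = 1 - measure coin_space {\<omega>. G \<omega>}"
      using c[of G] m[of 1] by (simp add: GH)
    finally show ?case using Suc by simp
  qed
  then show "measure coin_space {\<omega>. \<exists>r<R. G (sdrop (r * N) \<omega>)} =
      1 - (1 - measure coin_space {\<omega>. G \<omega>}) ^ R"
    using c[OF m[of R]] by simp
qed

text \<open>The event is split according to the injection \<open>g\<close> of \<open>P\<close> into
  the red colours that the colouring induces. For fixed \<open>g\<close> each edge has its own set
  of admissible colours, so the probability is a product, and it is the same for all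
  \<open>g\<close>. The falling factorial counts the injections.\<close>

lemma measure_good_colouring:
  assumes "P \<subseteq> {..<m}" "F \<subseteq> {..<m}" "P \<inter> F = {}" "K \<le> 2 ^ B"
  shows "measure coin_space {\<omega>. inj_on (colour B \<omega>) P \<and> colour B \<omega> ` P \<subseteq> {..<K} \<and>
           (\<forall>e\<in>F. K \<le> colour B \<omega> e)} =
         (\<Prod>i<card P. real (K - i)) / (2 ^ B) ^ card P * (1 - K / 2 ^ B) ^ card F"
proof -
  have fin: "finite P" "finite F" using assms(1,2) finite_subset by blast+
  \<comment> \<open>These functions are extensional: two of them that agree on \<open>P\<close> are
    equal, which makes the pieces disjoint.\<close>
  define I where "I = {g \<in> P \<rightarrow>\<^sub>E {..<K}. inj_on g P}"
  define A where "A g e = (if e \<in> P then {g e} else if e \<in> F then {K..<2 ^ B} else {..<2 ^ B})"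
    for g e
  have finI: "finite I" unfolding I_def using finite_PiE[OF fin(1), of "\<lambda>_. {..<K}"] by simp
  have sub: "A g e \<subseteq> {..<2 ^ B}" if "g \<in> I" for g e
  proof
    fix c assume "c \<in> A g e"
    moreover have "g e < K" if "e \<in> P" using \<open>g \<in> I\<close> that by (auto simp: I_def)
    ultimately show "c \<in> {..<2 ^ B}" using assms(4) by (auto simp: A_def split: if_splits)
  qed
  have eq: "{\<omega>. inj_on (colour B \<omega>) P \<and> colour B \<omega> ` P \<subseteq> {..<K} \<and> (\<forall>e\<in>F. K \<le> colour B \<omega> e)} =
      (\<Union>g\<in>I. {\<omega>. \<forall>e<m. colour B \<omega> e \<in> A g e})" (is "?L = ?R")
  proof (intro subset_antisym subsetI)
    fix \<omega> assume "\<omega> \<in> ?L"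
    then have "restrict (colour B \<omega>) P \<in> I" "\<forall>e<m. colour B \<omega> e \<in> A (restrict (colour B \<omega>) P) e"
      by (auto simp: I_def A_def colour_less inj_on_def)
    then show "\<omega> \<in> ?R" by blast
  next
    fix \<omega> assume "\<omega> \<in> ?R"
    then obtain g where g: "g \<in> I" "\<forall>e<m. colour B \<omega> e \<in> A g e" by blast
    have p: "colour B \<omega> e = g e" if "e \<in> P" for e
      using g(2) that assms(1) by (auto simp: A_def)
    have "K \<le> colour B \<omega> e" if "e \<in> F" for e
    proof -
      have "e < m" "e \<notin> P" using that assms(2,3) by auto
      then show ?thesis using g(2) that by (auto simp: A_def)
    qed
    moreover have "inj_on (colour B \<omega>) P" using g(1) p by (simp add: I_def inj_on_def)
    moreover have "colour B \<omega> ` P \<subseteq> {..<K}" using g(1) p by (auto simp: I_def)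
    ultimately show "\<omega> \<in> ?L" by simp
  qed
  have disj: "disjoint_family_on (\<lambda>g. {\<omega>. \<forall>e<m. colour B \<omega> e \<in> A g e}) I"
    unfolding disjoint_family_on_def
  proof (intro ballI impI equals0I)
    fix g h \<omega> assume gh: "g \<in> I" "h \<in> I" "g \<noteq> h"
      "\<omega> \<in> {\<omega>. \<forall>e<m. colour B \<omega> e \<in> A g e} \<inter> {\<omega>. \<forall>e<m. colour B \<omega> e \<in> A h e}"
    have "g e = h e" if "e \<in> P" for e
    proof -
      have "e < m" using that assms(1) by auto
      then have "colour B \<omega> e \<in> A g e" "colour B \<omega> e \<in> A h e" using gh(4) by auto
      then show ?thesis using that by (simp add: A_def)
    qed
    then have "g = h" using gh(1,2) by (auto simp: I_def intro: PiE_ext)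
    with gh(3) show False by simp
  qed
  have prod: "(\<Prod>e<m. card (A g e) / 2 ^ B) = (1 / 2 ^ B) ^ card P * (1 - K / 2 ^ B) ^ card F" for g
  proof -
    have "(\<Prod>e<m. card (A g e) / 2 ^ B) = (\<Prod>e\<in>P \<union> F. card (A g e) / 2 ^ B)"
      using assms(1,2) by (intro prod.mono_neutral_right) (auto simp: A_def)
    also have "\<dots> = (\<Prod>e\<in>P. card (A g e) / 2 ^ B) * (\<Prod>e\<in>F. card (A g e) / 2 ^ B)"
      using fin assms(3) by (rule prod.union_disjoint)
    also have "(\<Prod>e\<in>P. card (A g e) / 2 ^ B) = (\<Prod>e\<in>P. 1 / 2 ^ B)"
      by (rule prod.cong) (auto simp: A_def)
    also have "(\<Prod>e\<in>F. card (A g e) / 2 ^ B) = (\<Prod>e\<in>F. 1 - K / 2 ^ B)"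
      using assms(3,4) by (intro prod.cong refl) (auto simp: A_def of_nat_diff field_simps)
    finally show ?thesis by simp
  qed
  have "measure coin_space ?L = (\<Sum>g\<in>I. measure coin_space {\<omega>. \<forall>e<m. colour B \<omega> e \<in> A g e})"
    unfolding eq using finI disj
    by (intro coin.finite_measure_finite_Union) (auto simp: colours_event[where P = "\<lambda>e c. c \<in> A _ e"])
  also have "\<dots> = card I * ((1 / 2 ^ B) ^ card P * (1 - K / 2 ^ B) ^ card F)"
    using sub by (simp add: measure_colours prod)
  also have "card I = (\<Prod>i<card P. K - i)"
    unfolding I_def using card_inj_on_subset_funcset[of P "{..<K}" P] fin
    by (simp add: lessThan_atLeast0)
  finally show ?thesis by (simp add: power_divide)
qed

section \<open>Estimates for the success probability\<close>

lemma power_self_le_fact: "K ^ K \<le> 4 ^ K * (fact K :: nat)"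
proof -
  \<comment> \<open>The left side is a single term of the exponential series at \<open>K\<close>.
    The constant \<open>4\<close> of the lemma only has to be at least \<open>exp 1\<close>.\<close>
  have "real K ^ K / fact K \<le> exp (real K)"
  proof -
    have "(\<lambda>n. real K ^ n / fact n) sums exp (real K)"
      using exp_converges[of "real K"] by (simp add: field_simps)
    then show ?thesis
      using sum_le_suminf[of "\<lambda>n. real K ^ n / fact n" "{K}"] by (simp add: sums_iff)
  qed
  also have "exp (real K) \<le> 4 ^ K"
    using exp_le power_mono[of "exp 1" "4 :: real" K] by (simp add: exp_of_nat_mult[symmetric])
  finally have "real (K ^ K) \<le> real (4 ^ K * fact K)" by (simp add: field_simps)
  then show ?thesis by (simp only: of_nat_le_iff)
qed

text \<open>Besides the listed factors, \<open>fact K\<close> has \<open>K - l\<close> further ones,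
  each at most \<open>K \<le> M\<close>. This compares a path with \<open>l\<close> edges to the
  worst case of \<open>K\<close> edges.\<close>

lemma fact_le_falling:
  assumes "l \<le> K" "K \<le> M"
  shows "fact K \<le> (\<Prod>i<l. K - i) * (M :: nat) ^ (K - l)"
  using assms
proof (induction "K - l" arbitrary: l)
  case 0
  then have "l = K" by simp
  moreover have "(\<Prod>i<K. K - i) = fact K"
    by (simp add: fact_prod_rev lessThan_atLeast0)
  ultimately show ?case by simp
next
  case (Suc d)
  then have "fact K \<le> (\<Prod>i<Suc l. K - i) * M ^ (K - Suc l)" by (intro Suc.hyps(1)) auto
  also have "\<dots> = (\<Prod>i<l. K - i) * ((K - l) * M ^ (K - Suc l))" by simp
  also have "\<dots> \<le> (\<Prod>i<l. K - i) * (M * M ^ (K - Suc l))"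
    using Suc.prems by (intro mult_left_mono mult_right_mono) auto
  also have "M * M ^ (K - Suc l) = M ^ (K - l)" using Suc.hyps(2) by (metis Suc_diff_Suc Suc.prems(1)
    diff_is_0_eq le_neq_implies_less less_numeral_extra(3) power_Suc zero_less_Suc zero_less_diff)
  finally show ?case .
qed

text \<open>In use, \<open>M = 2 ^ B\<close> is the number of colours,
  \<open>y = 2 ^ clog mu\<close>, and \<open>c\<close> and \<open>d\<close> count the edges of the
  path and the other forbidden edges. The constant is \<open>64 = 8 * 4 * 2\<close>:
  \<open>8\<close> from \<open>M \<le> 4 * k * y \<le> 8 * K * y\<close>, \<open>4\<close> from
  comparing \<open>K ^ K\<close> with a factorial, \<open>2\<close> from the forbidden
  edges.\<close>

lemma good_colouring_bound:
  fixes k \<mu> y M K :: nat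
  assumes "0 < k" "K = k - 1" "c \<le> K" "d \<le> k * \<mu>" "0 < \<mu>" "2 * k * \<mu> \<le> M" "M \<le> 4 * k * y"
  shows "1 / (64 * real y) ^ k \<le> (\<Prod>i<c. real (K - i)) / real M ^ c * (1 - K / M) ^ d"
proof -
  have M: "0 < M" using assms(1,5,6) by (metis mult_pos_pos not_less pos2 le_zero_eq gr0I)
  then have y: "0 < y" using assms(7) by (cases y) auto
  have KM: "K \<le> M"
  proof -
    have "K \<le> k * 1" using assms(2) by simp
    also have "\<dots> \<le> k * (2 * \<mu>)" using assms(5) by (intro mult_left_mono) auto
    finally show ?thesis using assms(6) by simp
  qed
  have A: "1 / (32 * real y) ^ K \<le> (\<Prod>i<c. real (K - i)) / real M ^ c"
  proof (cases "K = 0")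
    \<comment> \<open>Here \<open>k = 1\<close> and the path has no edge; the estimate
      \<open>k \<le> 2 * K\<close> of the other case fails.\<close>
    case True
    then show ?thesis using assms(3) by simp
  next
    case False
    have "4 * k * y \<le> 8 * K * y" using False assms(2) by (intro mult_right_mono) linarith+
    then have "M ^ K \<le> (8 * K * y) ^ K" using assms(7) by (intro power_mono) linarith+
    also have "\<dots> = K ^ K * (8 * y) ^ K" by (simp add: power_mult_distrib)
    also have "\<dots> \<le> 4 ^ K * fact K * (8 * y) ^ K"
      by (intro mult_right_mono power_self_le_fact) simp
    also have "\<dots> = (32 * y) ^ K * fact K" by (simp add: power_mult_distrib flip: power_mult_distrib[of 4 8])
    also have "\<dots> \<le> (32 * y) ^ K * ((\<Prod>i<c. K - i) * M ^ (K - c))"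
      by (intro mult_left_mono fact_le_falling assms(3) KM) simp
    finally have "M ^ c * M ^ (K - c) \<le> (32 * y) ^ K * (\<Prod>i<c. K - i) * M ^ (K - c)"
      using assms(3) by (simp flip: power_add add: mult.assoc)
    then have "M ^ c \<le> (32 * y) ^ K * (\<Prod>i<c. K - i)" using M by simp
    then have "real (M ^ c) \<le> real ((32 * y) ^ K * (\<Prod>i<c. K - i))" by (simp only: of_nat_le_iff)
    then have "real M ^ c \<le> (32 * real y) ^ K * (\<Prod>i<c. real (K - i))" by simp
    then show ?thesis using M y by (simp add: field_simps)
  qed
  have B: "(1/2) ^ k \<le> (1 - real K / M) ^ d"
  proof -
    have 1: "real K / M \<le> 1 / (2 * \<mu>)"
    proof -
      have "K * (2 * \<mu>) \<le> k * (2 * \<mu>)" using assms(2) by (intro mult_right_mono) auto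
      also have "\<dots> \<le> M" using assms(6) by (simp add: mult_ac)
      finally have "real (K * (2 * \<mu>)) \<le> real M" by (simp only: of_nat_le_iff)
      then show ?thesis using M assms(5) by (simp add: field_simps)
    qed
    \<comment> \<open>Bernoulli's inequality: a group of \<open>\<mu>\<close> forbidden edges costs
      at most a factor \<open>2\<close>, and there are at most \<open>k\<close> such groups, one per
      vertex of the path.\<close>
    have "(1/2 :: real) = 1 + real \<mu> * (- (1 / (2 * real \<mu>)))" using assms(5) by simp
    also have "\<dots> \<le> (1 + (- (1 / (2 * real \<mu>)))) ^ \<mu>"
      using assms(5) by (intro Bernoulli_inequality) (simp add: field_simps)
    also have "\<dots> \<le> (1 - real K / M) ^ \<mu>"
      using 1 assms(5) by (intro power_mono) (auto simp: field_simps)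
    finally have "(1/2) ^ k \<le> ((1 - real K / M) ^ \<mu>) ^ k" by (intro power_mono) auto
    also have "\<dots> = (1 - real K / M) ^ (k * \<mu>)" by (simp add: power_mult mult.commute flip: power_mult)
    also have "\<dots> \<le> (1 - real K / M) ^ d"
      using KM M assms(4) by (intro power_decreasing) (auto simp: field_simps)
    finally show ?thesis .
  qed
  have "1 / (64 * real y) ^ k = 1 / (32 * real y) ^ k * (1/2) ^ k"
  proof -
    have "64 * real y = 32 * real y * 2" by simp
    then show ?thesis by (simp only: power_mult_distrib power_one_over) simp
  qed
  also have "\<dots> \<le> 1 / (32 * real y) ^ K * (1/2) ^ k"
    using y assms(1,2) by (intro mult_right_mono divide_left_mono power_increasing) auto
  also have "\<dots> \<le> (\<Prod>i<c. real (K - i)) / real M ^ c * (1 - K / M) ^ d"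
    using A B by (intro mult_mono) (auto intro!: divide_nonneg_nonneg prod_nonneg)
  finally show ?thesis .
qed

text \<open>\<open>(1 - \<delta>) ^ R \<le> exp (- (R * \<delta>)) \<le> exp (- L) \<le> 1 / 2 ^
  L\<close>. The machine finds \<open>L\<close> by doubling, so it is a binary logarithm; using
  \<open>2\<close> in place of \<open>exp 1\<close> changes the number of rounds by a constant
  factor only.\<close>

lemma rounds_suffice:
  fixes \<delta> \<epsilon> :: real
  assumes "0 < D" "1 / D \<le> \<delta>" "\<delta> \<le> 1" "0 < p" "p \<le> q" "q \<le> p * 2 ^ L" "real R = L * D"
  shows "1 - real p / real q \<le> 1 - (1 - \<delta>) ^ R"
proof -
  have "(1 - \<delta>) ^ R \<le> exp (- \<delta>) ^ R"
    using assms(3) exp_ge_add_one_self[of "- \<delta>"] by (intro power_mono) auto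
  also have "\<dots> = exp (- (real R * \<delta>))" by (simp flip: exp_of_nat_mult)
  also have "\<dots> \<le> exp (- real L)"
  proof -
    have "real L * 1 \<le> real L * (D * \<delta>)"
      using assms(1,2) by (intro mult_left_mono) (auto simp: field_simps)
    then show ?thesis using assms(7) by (simp add: mult_ac)
  qed
  also have "\<dots> \<le> p / q"
  proof -
    have "real q \<le> real (p * 2 ^ L)" using assms(6) by (simp only: of_nat_le_iff)
    then have "real q \<le> real p * 2 ^ L" by simp
    also have "(2 :: real) ^ L \<le> exp 1 ^ L" using exp_ge_add_one_self[of 1] by (intro power_mono) auto
    finally have "real q \<le> real p * exp (real L)" using assms(4) by (simp flip: exp_of_nat_mult)
    then show ?thesis using assms(4,5) by (simp add: exp_minus field_simps)
  qed
  finally show ?thesis by simp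
qed

section \<open>Searching a coloured graph\<close>

text \<open>
  Here \<open>K\<close> is the number of red colours. In \<open>reach S v\<close>, the set \<open>S\<close> consists of the colours of the edges
  of a walk to \<open>v\<close>.
\<close>

locale coloured_search =
  fixes ends :: "(nat \<times> nat) list" and fs :: "nat list list" and src K :: nat
    and col :: "nat \<Rightarrow> nat"
begin

text \<open>An edge that is not red is never traversed, so forbidding it does no harm. A forbidden
  red edge does no harm once its colour is spent, because no later edge of the walk can carry that
  colour.\<close>

definition allowed :: "nat set \<Rightarrow> nat \<Rightarrow> bool" where
  "allowed S v \<longleftrightarrow> (\<forall>e\<in>set (fs ! v). col e < K \<longrightarrow> col e \<in> S)"

inductive reach :: "nat set \<Rightarrow> nat \<Rightarrow> bool" where
  start: "allowed {} src \<Longrightarrow> reach {} src"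
| extend: "reach S x \<Longrightarrow> e < length ends \<Longrightarrow> ends ! e = (x, y) \<or> ends ! e = (y, x) \<Longrightarrow>
    col e < K \<Longrightarrow> col e \<notin> S \<Longrightarrow> allowed (insert (col e) S) y \<Longrightarrow> reach (insert (col e) S) y"

lemma allowed_mono: "allowed S v \<Longrightarrow> S \<subseteq> S' \<Longrightarrow> allowed S' v"
  by (auto simp: allowed_def)

lemma reach_bounded: "reach S v \<Longrightarrow> finite S \<and> S \<subseteq> {..<K}"
  by (induction rule: reach.induct) auto

text \<open>The recurrence of the dynamic programming, read off the last edge of a walk. The
  predecessor set lacks exactly the colour of that edge. The conjunct \<open>allowed\<close> is
  factored out because the machine first marks candidates and afterwards removes those that violate
  it.\<close>

lemma reach_iff:
  "reach S v \<longleftrightarrow> allowed S v \<and> (S = {} \<and> v = src \<or>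
     (\<exists>e<length ends. \<exists>x. (ends ! e = (x, v) \<or> ends ! e = (v, x)) \<and> col e < K \<and> col e \<in> S \<and>
        reach (S - {col e}) x))" (is "_ \<longleftrightarrow> ?R")
proof
  assume "reach S v"
  then show ?R
  proof (cases rule: reach.cases)
    case start
    then show ?thesis by simp
  next
    case (extend S' x e)
    then have "S - {col e} = S'" by simp
    with extend have "ends ! e = (x, v) \<or> ends ! e = (v, x)" "col e \<in> S" "reach (S - {col e}) x"
      by simp_all
    with extend have "\<exists>x. (ends ! e = (x, v) \<or> ends ! e = (v, x)) \<and> col e < K \<and> col e \<in> S \<and>
        reach (S - {col e}) x"
      by (intro exI[of _ x]) simp
    with extend show ?thesis by blast
  qed
next
  assume R: ?R
  show "reach S v"
  proof (cases "S = {} \<and> v = src")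
    case True
    then show ?thesis using R start by simp
  next
    case False
    with R obtain e x where e: "e < length ends" "ends ! e = (x, v) \<or> ends ! e = (v, x)" "col e < K"
      "col e \<in> S" "reach (S - {col e}) x" by fast
    then have "insert (col e) (S - {col e}) = S" by blast
    with e R extend[of "S - {col e}" x e v] show ?thesis by simp
  qed
qed

end

section \<open>Walks with fresh colours and conforming paths\<close>

locale encoded_instance =
  fixes V :: "'a set" and E :: "'a set set" and f :: "'a \<Rightarrow> 'a set set"
    and s t :: 'a and vs :: "'a list" and es :: "'a set list" and ends :: "(nat \<times> nat) list"
    and fs :: "nat list list" and src dst :: nat
  assumes vs: "distinct vs" "set vs = V"
    and es: "distinct es" "set es = E"
    and ends: "\<And>a b. (a, b) \<in> set ends \<Longrightarrow> a < length vs \<and> b < length vs"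
    and es_eq: "es = map (\<lambda>(a, b). {vs ! a, vs ! b}) ends"
    and length_fs: "length fs = length vs"
    and fs: "\<And>l. l < length vs \<Longrightarrow> distinct (fs ! l) \<and> set (fs ! l) \<subseteq> {..<length es} \<and>
      (\<lambda>e. es ! e) ` set (fs ! l) = f (vs ! l)"
    and src: "src < length vs" "vs ! src = s"
    and dst: "dst < length vs" "vs ! dst = t"
begin

lemma length_ends: "length ends = length es"
  by (simp add: es_eq)

lemma es_nth: "e < length es \<Longrightarrow> ends ! e = (x, y) \<or> ends ! e = (y, x) \<Longrightarrow> es ! e = {vs ! x, vs ! y}"
  by (auto simp: es_eq)

lemma es_inj: "e < length es \<Longrightarrow> e' < length es \<Longrightarrow> es ! e = es ! e' \<Longrightarrow> e = e'"
  using es(1) nth_eq_iff_index_eq by blast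

text \<open>The invariant is that all vertices of \<open>w\<close> are allowed with respect to the
  final set \<open>S\<close>. A new edge has a red colour outside \<open>S\<close>, so none of these
  vertices forbids it and appending it preserves conformity. The length is only bounded by
  \<open>card S + 1\<close>, since cutting at a repeated vertex leaves colours in \<open>S\<close>
  that \<open>w\<close> no longer uses.\<close>

lemma reach_path:
  assumes "coloured_search.reach ends fs src K col S v"
  shows "\<exists>w. w \<noteq> [] \<and> distinct w \<and> hd w = src \<and> last w = v \<and> set w \<subseteq> {..<length vs} \<and>
    length w \<le> card S + 1 \<and> (\<forall>x\<in>set w. coloured_search.allowed fs K col S x) \<and>
    (\<forall>i. Suc i < length w \<longrightarrow> {vs ! (w ! i), vs ! (w ! Suc i)} \<in> E) \<and>
    conforming f (map ((!) vs) w)"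
proof -
  interpret coloured_search ends fs src K col .
  from assms show ?thesis
  proof (induction rule: reach.induct)
    case start
    show ?case using start src(1) by (rule_tac exI[where x = "[src]"]) (simp add: conforming_def)
  next
    case (extend S x e y)
    from extend.IH obtain w where "w \<noteq> [] \<and> distinct w \<and> hd w = src \<and> last w = x \<and>
      set w \<subseteq> {..<length vs} \<and> length w \<le> card S + 1 \<and> (\<forall>z\<in>set w. allowed S z) \<and>
      (\<forall>i. Suc i < length w \<longrightarrow> {vs ! (w ! i), vs ! (w ! Suc i)} \<in> E) \<and>
      conforming f (map ((!) vs) w)" by (rule exE)
    then have w: "w \<noteq> []" "distinct w" "hd w = src" "last w = x"
      "set w \<subseteq> {..<length vs}" "length w \<le> card S + 1" "\<forall>z\<in>set w. allowed S z"
      "\<forall>i. Suc i < length w \<longrightarrow> {vs ! (w ! i), vs ! (w ! Suc i)} \<in> E"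
      "conforming f (map ((!) vs) w)" by simp_all
    have finS: "finite S" using extend.hyps(1) reach_bounded by blast
    let ?S = "insert (col e) S"
    show ?case
    proof (cases "y \<in> set w")
      case True
      then obtain l where l: "l < length w" "w ! l = y" by (meson in_set_conv_nth)
      let ?w = "take (Suc l) w"
      have "last ?w = y" using l by (simp add: take_Suc_conv_app_nth)
      moreover have "length ?w \<le> card ?S + 1"
        using w(6) finS by (auto simp: card_insert_if)
      moreover have "\<forall>z\<in>set ?w. allowed ?S z"
      proof
        fix z assume "z \<in> set ?w"
        then have "allowed S z" using w(7) in_set_takeD by fast
        then show "allowed ?S z" by (rule allowed_mono) (rule subset_insertI)
      qed
      moreover have "\<forall>i. Suc i < length ?w \<longrightarrow> {vs ! (?w ! i), vs ! (?w ! Suc i)} \<in> E"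
        using w(8) by auto
      moreover have "conforming f (map ((!) vs) ?w)"
        using w(9) by (simp add: conforming_def)
      ultimately show ?thesis
        using w(1,2,3) subset_trans[OF set_take_subset w(5), of "Suc l"]
        by (rule_tac exI[where x = ?w]) (intro conjI; simp)
    next
      case False
      let ?w = "w @ [y]"
      have e: "e < length es" "es ! e = {vs ! x, vs ! y}"
        using extend.hyps(2,3) es_nth by (simp_all add: length_ends)
      have y: "y < length vs"
        using extend.hyps(3) ends[of x y] ends[of y x] nth_mem[OF extend.hyps(2)] by auto
      \<comment> \<open>The lists contain numbers of edges, so it matters that equal edges have
        equal numbers (\<open>es_inj\<close>): the number found in the list is \<open>e\<close>
        itself, and its red colour would have to lie in \<open>S\<close>.\<close>
      have fresh: "es ! e \<notin> f (vs ! z)" if "z \<in> set w" for z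
      proof
        assume "es ! e \<in> f (vs ! z)"
        moreover have "z < length vs" using that w(5) by auto
        ultimately obtain e' where "e' \<in> set (fs ! z)" "es ! e = es ! e'" "e' < length es"
          using fs[of z] by blast
        then have "e \<in> set (fs ! z)" using es_inj e(1) by blast
        then show False using w(7) that extend.hyps(4,5) by (auto simp: allowed_def)
      qed
      have lastw: "w ! (length w - 1) = x" using w(1,4) by (simp add: last_conv_nth)
      have "\<forall>i. Suc i < length ?w \<longrightarrow> {vs ! (?w ! i), vs ! (?w ! Suc i)} \<in> E"
      proof (intro allI impI)
        fix i assume i: "Suc i < length ?w"
        show "{vs ! (?w ! i), vs ! (?w ! Suc i)} \<in> E"
        proof (cases "Suc i < length w")
          case True
          then show ?thesis using w(8) by (simp add: nth_append)
        next
          case False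
          with i have "i = length w - 1" "Suc i = length w" using w(1) by (auto simp: neq_Nil_conv)
          then show ?thesis using e lastw es(2) nth_mem[OF e(1)] by (simp add: nth_append)
        qed
      qed
      moreover have "conforming f (map ((!) vs) ?w)"
        unfolding conforming_def
      proof (intro allI impI)
        fix i l assume i: "Suc i < length (map ((!) vs) ?w)" "l \<le> i"
        show "{map ((!) vs) ?w ! i, map ((!) vs) ?w ! Suc i} \<notin> f (map ((!) vs) ?w ! l)"
        proof (cases "Suc i < length w")
          case True
          then show ?thesis using w(9) i(2) by (simp add: conforming_def nth_append)
        next
          case False
          with i(1) have *: "i = length w - 1" "Suc i = length w" using w(1) by (auto simp: neq_Nil_conv)
          then have "w ! l \<in> set w" using i(2) by simp
          then show ?thesis using fresh e lastw * i(2) by (simp add: nth_append)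
        qed
      qed
      moreover have "\<forall>z\<in>set ?w. allowed ?S z"
      proof
        fix z assume "z \<in> set ?w"
        then consider "allowed S z" | "z = y" using w(7) by auto
        then show "allowed ?S z"
          by cases (use extend.hyps(6) allowed_mono[OF _ subset_insertI] in simp_all)
      qed
      ultimately show ?thesis
        using w(1-6) y False finS extend.hyps(5) by (rule_tac exI[where x = ?w]) (intro conjI; simp)
    qed
  qed
qed

text \<open>There are \<open>k - 1\<close> red colours and every edge spends one of them, hence at
  most \<open>k\<close> vertices.\<close>

lemma reach_sound:
  assumes "coloured_search.reach ends fs src (k - 1) col S dst" "0 < k"
  shows "short_conforming_path_exists V E f s t k"
proof -
  interpret coloured_search ends fs src "k - 1" col .
  obtain w where "w \<noteq> [] \<and> distinct w \<and> hd w = src \<and> last w = dst \<and>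
      set w \<subseteq> {..<length vs} \<and> length w \<le> card S + 1 \<and> (\<forall>z\<in>set w. allowed S z) \<and>
      (\<forall>i. Suc i < length w \<longrightarrow> {vs ! (w ! i), vs ! (w ! Suc i)} \<in> E) \<and>
      conforming f (map ((!) vs) w)" using reach_path[OF assms(1)] by (rule exE)
  then have w: "w \<noteq> []" "distinct w" "hd w = src" "last w = dst"
      "set w \<subseteq> {..<length vs}" "length w \<le> card S + 1"
      "\<forall>i. Suc i < length w \<longrightarrow> {vs ! (w ! i), vs ! (w ! Suc i)} \<in> E"
      "conforming f (map ((!) vs) w)" by simp_all
  have "card S \<le> k - 1"
    using reach_bounded[OF assms(1)] card_mono[of "{..<k - 1}" S] by simp
  moreover have "distinct (map ((!) vs) w)"
    using w(2,5) vs(1) by (auto simp: distinct_map intro: inj_on_subset[OF inj_on_nth])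
  moreover have "set (map ((!) vs) w) \<subseteq> V" using w(5) vs(2) by auto
  ultimately show ?thesis
    unfolding short_conforming_path_exists_def graph_path_def
    using w assms(2) src dst
    by (intro exI[of _ "map ((!) vs) w"] conjI allI impI) (simp_all add: hd_map last_map)
qed

text \<open>\<open>P\<close> consists of the edges of the path, \<open>F\<close> of the other edges forbidden on the path.\<close>

lemma reach_complete:
  assumes "short_conforming_path_exists V E f s t k" "0 < k"
    and \<mu>: "\<And>l. l < length vs \<Longrightarrow> length (fs ! l) \<le> \<mu>"
  obtains P F where "P \<subseteq> {..<length es}" "F \<subseteq> {..<length es}" "P \<inter> F = {}"
    "card P \<le> k - 1" "card F \<le> k * \<mu>"
    "\<And>col K. inj_on col P \<Longrightarrow> col ` P \<subseteq> {..<K} \<Longrightarrow> (\<forall>e\<in>F. K \<le> col e) \<Longrightarrow>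
      \<exists>S. coloured_search.reach ends fs src K col S dst"
proof -
  obtain p where p: "p \<noteq> []" "distinct p" "set p \<subseteq> V"
    "\<And>i. Suc i < length p \<Longrightarrow> {p ! i, p ! Suc i} \<in> E" "conforming f p" "hd p = s" "last p = t"
    "length p \<le> k"
    using assms(1) unfolding short_conforming_path_exists_def graph_path_def by blast
  define L where "L = length p - 1"
  have L: "length p = Suc L" using p(1) by (simp add: L_def)
  have "\<forall>i. \<exists>e. i < L \<longrightarrow> e < length es \<and> es ! e = {p ! i, p ! Suc i}"
    using p(4) es(2) L by (metis Suc_less_eq in_set_conv_nth)
  then obtain pe where "\<forall>i. i < L \<longrightarrow> pe i < length es \<and> es ! pe i = {p ! i, p ! Suc i}"
    by (rule choice[THEN exE])
  then have pe: "pe i < length es \<and> es ! pe i = {p ! i, p ! Suc i}" if "i < L" for i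
    using that by blast
  have "\<forall>i. \<exists>a. i \<le> L \<longrightarrow> a < length vs \<and> vs ! a = p ! i"
  proof
    fix i
    show "\<exists>a. i \<le> L \<longrightarrow> a < length vs \<and> vs ! a = p ! i"
    proof (cases "i \<le> L")
      case True
      then have "p ! i \<in> set vs" using p(3) vs(2) L by (auto intro: nth_mem)
      then show ?thesis by (auto simp: in_set_conv_nth)
    qed simp
  qed
  then obtain a where "\<forall>i. i \<le> L \<longrightarrow> a i < length vs \<and> vs ! a i = p ! i"
    by (rule choice[THEN exE])
  then have a: "a i < length vs \<and> vs ! a i = p ! i" if "i \<le> L" for i
    using that by blast
  define P where "P = pe ` {..<L}"
  \<comment> \<open>A conforming path may traverse an edge before it meets a vertex that forbids it.
    Such edges have to be red, so \<open>P\<close> is taken out. Both sets are fixed before any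
    colouring is chosen, which gives the required event a computable probability.\<close>
  define F where "F = (\<Union>l\<le>L. set (fs ! a l)) - P"
  have "card P \<le> L" unfolding P_def using card_image_le[of "{..<L}" pe] by simp
  then have cP: "card P \<le> k - 1" using p(8) L by simp
  have "card F \<le> card (\<Union>l\<le>L. set (fs ! a l))"
    unfolding F_def by (rule card_mono) auto
  also have "\<dots> \<le> (\<Sum>l\<le>L. card (set (fs ! a l)))" by (rule card_UN_le) simp
  also have "\<dots> \<le> (\<Sum>l\<le>L. \<mu>)"
    by (intro sum_mono order.trans[OF card_length] \<mu>) (use a in auto)
  also have "\<dots> \<le> k * \<mu>" using mult_right_mono[of "Suc L" k \<mu>] p(8) L by simp
  finally have cF: "card F \<le> k * \<mu>" .
  have pe_inj: "i = l" if "i < L" "l < L" "pe i = pe l" for i l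
  proof -
    have "{p ! i, p ! Suc i} = {p ! l, p ! Suc l}" using pe[of i] pe[of l] that by simp
    moreover have "p ! x = p ! y \<longleftrightarrow> x = y" if "x \<le> L" "y \<le> L" for x y
      using p(2) that L by (simp add: nth_eq_iff_index_eq)
    ultimately show ?thesis using that(1,2) by (auto simp: doubleton_eq_iff)
  qed
  have "\<exists>S. coloured_search.reach ends fs src K col S dst"
    if inj: "inj_on col P" and red: "col ` P \<subseteq> {..<K}" and blue: "\<forall>e\<in>F. K \<le> col e" for col K
  proof -
    interpret coloured_search ends fs src K col .
    \<comment> \<open>A red edge forbidden by vertex \<open>l\<close> of the path is not in
      \<open>F\<close>, so it belongs to the path, and conformity places it before vertex
      \<open>l\<close>. Its colour is therefore already spent.\<close>
    have ok: "allowed (col ` pe ` {..<l}) (a l)" if "l \<le> L" for l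
      unfolding allowed_def
    proof (intro ballI impI)
      fix e assume e: "e \<in> set (fs ! a l)" "col e < K"
      then have "e \<notin> F" using blue by (meson leD)
      then have "e \<in> P" using e that by (auto simp: F_def)
      then obtain i where i: "i < L" "e = pe i" by (auto simp: P_def)
      have "es ! e \<in> f (p ! l)" using e(1) fs[of "a l"] a[OF that] by auto
      moreover have "{p ! i, p ! Suc i} \<notin> f (p ! l)" if "l \<le> i"
        using p(5) that i L by (auto simp: conforming_def)
      ultimately have "i < l" using pe[OF i(1)] i(2) by (metis not_le)
      then show "col e \<in> col ` pe ` {..<l}" using i by blast
    qed
    have "reach (col ` pe ` {..<l}) (a l)" if "l \<le> L" for l
      using that
    proof (induction l)
      case 0
      have "vs ! a 0 = vs ! src" using a[of 0] p(1,6) src by (simp add: hd_conv_nth)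
      then have "a 0 = src" using a[of 0] src(1) nth_eq_iff_index_eq[OF vs(1)] by blast
      then show ?case using start ok[of 0] by simp
    next
      case (Suc l)
      let ?e = "pe l"
      have e: "?e < length ends" "?e < length es" using pe[of l] Suc.prems by (simp_all add: length_ends)
      obtain x y where xy: "ends ! ?e = (x, y)" by fastforce
      then have b: "x < length vs" "y < length vs" using ends nth_mem[OF e(1)] by metis+
      have "{vs ! x, vs ! y} = {vs ! a l, vs ! a (Suc l)}"
        using pe[of l] a[of l] a[of "Suc l"] Suc.prems es_nth[OF e(2)] xy by auto
      then have "x = a l \<and> y = a (Suc l) \<or> x = a (Suc l) \<and> y = a l"
        using b a[of l] a[of "Suc l"] Suc.prems nth_eq_iff_index_eq[OF vs(1)]
        unfolding doubleton_eq_iff by (metis Suc_leD)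
      then have j: "ends ! ?e = (a l, a (Suc l)) \<or> ends ! ?e = (a (Suc l), a l)" using xy by auto
      have eP: "?e \<in> P" using Suc.prems by (simp add: P_def)
      have "col ?e \<notin> col ` pe ` {..<l}"
      proof
        assume "col ?e \<in> col ` pe ` {..<l}"
        then obtain i where "i < l" "col (pe l) = col (pe i)" by auto
        moreover from this have "pe i \<in> P" using Suc.prems by (simp add: P_def)
        ultimately have "pe l = pe i" using inj eP by (simp add: inj_on_def)
        then show False using pe_inj[of l i] \<open>i < l\<close> Suc.prems by simp
      qed
      moreover have "col ` pe ` {..<Suc l} = insert (col ?e) (col ` pe ` {..<l})"
        by (simp add: lessThan_Suc)
      ultimately show ?case
        using extend[OF Suc.IH e(1) j] red eP ok[OF Suc.prems] Suc.prems by auto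
    qed
    moreover have "vs ! a L = vs ! dst" using a[of L] p(1,7) dst L by (simp add: last_conv_nth)
    then have "a L = dst" using a[of L] dst(1) nth_eq_iff_index_eq[OF vs(1)] by blast
    ultimately show ?thesis by blast
  qed
  moreover have "P \<subseteq> {..<length es}" using pe by (auto simp: P_def)
  moreover have "F \<subseteq> {..<length es}"
  proof
    fix e assume "e \<in> F"
    then obtain l where "l \<le> L" "e \<in> set (fs ! a l)" by (auto simp: F_def)
    then show "e \<in> {..<length es}" using fs[of "a l"] a[of l] by blast
  qed
  moreover have "P \<inter> F = {}" by (auto simp: F_def)
  ultimately show thesis using that cP cF by blast
qed

end

section \<open>The program\<close>

text \<open>Register \<open>0\<close> holds the answer, registers \<open>2\<close> to
  \<open>19\<close> have a fixed role, those from \<open>20\<close> on are scratch. As the names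
  abbreviate numerals, the simplifier decides by itself whether two registers differ.\<close>

abbreviation (input) "rN \<equiv> 2 :: nat"
abbreviation (input) "rM \<equiv> 3 :: nat"
abbreviation (input) "rSrc \<equiv> 4 :: nat"
abbreviation (input) "rDst \<equiv> 5 :: nat"
abbreviation (input) "rK \<equiv> 6 :: nat"
abbreviation (input) "rP \<equiv> 7 :: nat"
abbreviation (input) "rQ \<equiv> 8 :: nat"
abbreviation (input) "zero \<equiv> 9 :: nat"
abbreviation (input) "one \<equiv> 10 :: nat"
abbreviation (input) "rCol \<equiv> 11 :: nat"
abbreviation (input) "rMu \<equiv> 12 :: nat"
abbreviation (input) "rB \<equiv> 13 :: nat"
abbreviation (input) "rTrials \<equiv> 14 :: nat"
abbreviation (input) "rRed \<equiv> 15 :: nat"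
abbreviation (input) "rOff \<equiv> 16 :: nat"
abbreviation (input) "rBit \<equiv> 17 :: nat"
abbreviation (input) "rTab \<equiv> 18 :: nat"
abbreviation (input) "rSize \<equiv> 19 :: nat"
abbreviation (input) "x0 \<equiv> 20 :: nat"
abbreviation (input) "x1 \<equiv> 21 :: nat"
abbreviation (input) "x2 \<equiv> 22 :: nat"
abbreviation (input) "x3 \<equiv> 23 :: nat"
abbreviation (input) "x4 \<equiv> 24 :: nat"
abbreviation (input) "x5 \<equiv> 25 :: nat"
abbreviation (input) "x6 \<equiv> 26 :: nat"
abbreviation (input) "x7 \<equiv> 27 :: nat"
abbreviation (input) "x8 \<equiv> 28 :: nat"

definition draw :: program where
  "draw = Const x1 0 ;; Const x2 0 ;;
     While_Less x2 rB (Flip x3 ;; Add x1 x1 x1 ;; Add x1 x1 x3 ;; Add x2 x2 one)"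

definition colour_edges :: program where
  "colour_edges = Add x0 rCol zero ;;
     While_Less x0 rOff (draw ;; Store x0 x1 ;; Add x0 x0 one)"

text \<open>
  The register \<open>x0\<close> holds \<open>n * S\<close>, where \<open>S\<close> encodes the current set of colours. In the absence of
  division, the elements of this set are recovered from the top by subtracting the numbers \<open>n * 2 ^ c\<close>.
\<close>

definition unpack :: program where
  "unpack = Add x2 rRed zero ;; Add x3 x0 zero ;;
     While_Less zero x2
       (Sub x2 x2 one ;; Add x4 rOff x2 ;; Load x4 x4 ;; Add x5 rBit x2 ;;
        If_Less x3 x4 (Store x5 zero) (Store x5 one ;; Sub x3 x3 x4))"

text \<open>From the second trial on, the row still contains the entries of the previous
  colouring.\<close>

definition clear_row :: program where
  "clear_row = Add x2 x1 zero ;; Add x3 x1 rN ;;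
     While_Less x2 x3 (Store x2 zero ;; Add x2 x2 one)"

text \<open>\<open>x0\<close> holds \<open>n * S\<close>, so the test asks whether the colour set is
  nonempty; only the empty set starts at the source.\<close>

definition seed :: program where
  "seed = If_Less zero x0 Skip (Add x2 x1 rSrc ;; Store x2 one)"

text \<open>\<open>x1\<close> is the start of the current row and \<open>x8\<close> becomes the
  start of the row of the set without the colour \<open>x4\<close>. The edge is tried in both
  directions. \<open>x2\<close> and \<open>x3\<close> walk in parallel through the colours and the
  ends of the edges.\<close>

definition relax_edge :: program where
  "relax_edge =
     Load x4 x2 ;; Load x5 x3 ;; Add x3 x3 one ;; Load x6 x3 ;; Add x3 x3 one ;; Add x2 x2 one ;;
     If_Less x4 rRed
       (Add x7 rBit x4 ;; Load x7 x7 ;;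
        If_Less zero x7
          (Add x8 rOff x4 ;; Load x8 x8 ;; Sub x8 x1 x8 ;;
           Add x7 x8 x5 ;; Load x7 x7 ;; If_Less zero x7 (Add x7 x1 x6 ;; Store x7 one) Skip ;;
           Add x7 x8 x6 ;; Load x7 x7 ;; If_Less zero x7 (Add x7 x1 x5 ;; Store x7 one) Skip)
          Skip)
       Skip"

definition relax :: program where
  "relax = Add x2 rCol zero ;; Const x3 7 ;; While_Less x2 rOff relax_edge"

text \<open>\<open>x2\<close> moves from the size word of the vertex through its list to the size
  word of the next vertex, while \<open>x3\<close> points to the cell of the current vertex in the
  row.\<close>

definition prune_vertex :: program where
  "prune_vertex =
     Load x5 x2 ;; Add x2 x2 one ;; Add x5 x2 x5 ;;
     While_Less x2 x5
       (Load x6 x2 ;; Add x2 x2 one ;; Add x6 x6 rCol ;; Load x6 x6 ;;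
        If_Less x6 rRed
          (Add x7 rBit x6 ;; Load x7 x7 ;; If_Less zero x7 Skip (Store x3 zero))
          Skip) ;;
     Add x3 x3 one"

text \<open>The address \<open>2 * m + 7\<close> is that of the first size word, behind the header
  and the ends of the edges.\<close>

definition prune :: program where
  "prune = Add x2 rM rM ;; Const x3 7 ;; Add x2 x2 x3 ;; Add x3 x1 zero ;; Add x4 x1 rN ;;
     While_Less x3 x4 prune_vertex"

text \<open>Register \<open>0\<close> is set but never reset, so it collects the results of all sets
  and all trials. Adding \<open>n\<close> to \<open>x0\<close> passes to the next code.\<close>

definition test_row :: program where
  "test_row = Add x2 x1 rDst ;; Load x2 x2 ;; If_Less zero x2 (Const 0 1) Skip ;; Add x0 x0 rN"

definition explore_set :: program where
  "explore_set = Add x1 rTab x0 ;; unpack ;; clear_row ;; seed ;; relax ;; prune ;; test_row"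

definition search :: program where
  "search = Const x0 0 ;; While_Less x0 rSize explore_set"

definition trial :: program where
  "trial = colour_edges ;; search ;; Sub rTrials rTrials one"

lemmas program_defs = draw_def colour_edges_def unpack_def clear_row_def seed_def relax_edge_def
  relax_def prune_vertex_def prune_def test_row_def explore_set_def search_def trial_def

section \<open>Memory layout and correctness of the single procedures\<close>

locale search_layout =
  fixes n k B mu src dst :: nat and ends :: "(nat \<times> nat) list" and fs :: "nat list list"
  assumes n_pos: "0 < n" and k_pos: "0 < k" and length_fs: "length fs = n"
    and ends_less: "\<And>a b. (a, b) \<in> set ends \<Longrightarrow> a < n \<and> b < n"
    and fs_less: "\<And>v. v < n \<Longrightarrow> set (fs ! v) \<subseteq> {..<length ends}"
    and fs_length: "\<And>v. v < n \<Longrightarrow> length (fs ! v) \<le> mu"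
    and src_less: "src < n" and dst_less: "dst < n"
begin

text \<open>
  Behind the input, which ends at \<open>cols\<close>, the memory holds the colours of the edges, then the numbers
  \<open>n * 2 ^ c\<close> from \<open>offs\<close>, the characteristic vector of the current set of colours from \<open>bits\<close>, and from
  \<open>tab\<close> the dynamic programming table, where the row of the set with code \<open>S\<close> starts at \<open>tab + n * S\<close>.
\<close>

definition "m = length ends"
text \<open>The address of the size word of vertex \<open>v\<close>; the header, the ends of the
  edges, and the earlier lists with their size words come before it.\<close>

definition "fpos v = 7 + 2 * m + (\<Sum>u<v. Suc (length (fs ! u)))"
definition "cols = fpos n"
definition "offs = cols + m"
text \<open>The offsets occupy \<open>k\<close> cells although red colours end at
  \<open>k - 2\<close>: the last one, \<open>n * 2 ^ (k - 1)\<close>, is the size of the dynamic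
  programming table and bounds the loop over the sets.\<close>

definition "bits = offs + k"
definition "tab = bits + k"

definition layout_regs :: "state \<Rightarrow> bool" where
  "layout_regs \<sigma> \<longleftrightarrow> regs \<sigma> rN = n \<and> regs \<sigma> rM = m \<and> regs \<sigma> rSrc = src \<and> regs \<sigma> rDst = dst \<and>
     regs \<sigma> zero = 0 \<and> regs \<sigma> one = 1 \<and> regs \<sigma> rCol = cols \<and> regs \<sigma> rB = B \<and>
     regs \<sigma> rRed = k - 1 \<and> regs \<sigma> rOff = offs \<and> regs \<sigma> rBit = bits \<and> regs \<sigma> rTab = tab \<and>
     regs \<sigma> rSize = n * 2 ^ (k - 1)"

text \<open>The numbers listed are exactly the registers that \<open>layout_regs\<close> speaks
  of.\<close>

lemma layout_regs_frame:
  "layout_regs \<sigma> \<Longrightarrow> frame P \<sigma> \<tau> \<Longrightarrow> writes P \<inter> {2, 3, 4, 5, 9, 10, 11, 13, 15, 16, 17, 18, 19} = {} \<Longrightarrow>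
   layout_regs \<tau>"
  unfolding layout_regs_def frame_def by auto

definition input_ok :: "(nat \<Rightarrow> nat) \<Rightarrow> bool" where
  "input_ok M \<longleftrightarrow>
     (\<forall>e<m. M (7 + 2 * e) = fst (ends ! e) \<and> M (Suc (7 + 2 * e)) = snd (ends ! e)) \<and>
     (\<forall>v<n. M (fpos v) = length (fs ! v) \<and>
        (\<forall>i<length (fs ! v). M (Suc (fpos v + i)) = fs ! v ! i))"

lemma fpos_Suc: "fpos (Suc v) = Suc (fpos v + length (fs ! v))"
  by (simp add: fpos_def)

lemma fpos_mono: "v \<le> w \<Longrightarrow> fpos v \<le> fpos w"
  unfolding fpos_def by (intro add_left_mono sum_mono2) auto

lemma fpos_less: "v < n \<Longrightarrow> i \<le> length (fs ! v) \<Longrightarrow> fpos v + i < cols"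
  using fpos_mono[of "Suc v" n] by (simp add: fpos_Suc cols_def)

lemma ends_addr: "e < m \<Longrightarrow> Suc (7 + 2 * e) < cols"
  using fpos_mono[of 0 n] by (simp add: fpos_def cols_def)

lemma input_ok_cong:
  assumes "\<And>a. a < cols \<Longrightarrow> M' a = M a" "input_ok M"
  shows "input_ok M'"
  unfolding input_ok_def
proof (intro conjI allI impI)
  fix e assume "e < m"
  with assms show "M' (7 + 2 * e) = fst (ends ! e)" "M' (Suc (7 + 2 * e)) = snd (ends ! e)"
    using ends_addr[of e] by (simp_all add: input_ok_def)
next
  fix v assume "v < n"
  with assms show "M' (fpos v) = length (fs ! v)"
    using fpos_less[of v 0] by (simp add: input_ok_def)
  fix i assume "i < length (fs ! v)"
  with assms \<open>v < n\<close> show "M' (Suc (fpos v + i)) = fs ! v ! i"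
    using fpos_less[of v "Suc i"] by (simp add: input_ok_def)
qed

lemma run_draw:
  assumes "layout_regs \<sigma>"
  shows "run \<sigma> draw (5 * B + 3)
    (\<lambda>\<tau>. regs \<tau> x1 = bits_val (stake B (coins \<sigma>)) \<and> coins \<tau> = sdrop B (coins \<sigma>))"
proof -
  note c = assms[unfolded layout_regs_def]
  let ?\<sigma> = "\<sigma>\<lparr>regs := (regs \<sigma>)(x1 := 0, x2 := 0)\<rparr>"
  let ?body = "Flip x3 ;; Add x1 x1 x1 ;; Add x1 x1 x3 ;; Add x2 x2 one"
  have "run ?\<sigma> (While_Less x2 rB ?body) (5 * B + 1)
    (\<lambda>\<tau>. regs \<tau> x1 = bits_val (stake B (coins \<sigma>)) \<and> coins \<tau> = sdrop B (coins \<sigma>))"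
  proof (rule run_While[where N = B and t = 4 and Inv = "\<lambda>i \<tau>. regs \<tau> x2 = i \<and>
      regs \<tau> x1 = bits_val (stake i (coins \<sigma>)) \<and> coins \<tau> = sdrop i (coins \<sigma>)"], goal_cases)
    case 1
    then show ?case by (simp add: bits_val_def)
  next
    case (2 i \<sigma>')
    note fr = frame_regs[OF 2(2)]
    have "stake (Suc i) (coins \<sigma>) = stake i (coins \<sigma>) @ [shd (sdrop i (coins \<sigma>))]"
      by (simp add: stake_Suc del: stake.simps)
    with 2 show ?case
      by (simp add: run_simps fr c bits_val_snoc sdrop_Suc_stl del: stake.simps sdrop.simps)
  next
    case (3 \<sigma>')
    note fr = frame_regs[OF 3(1)]
    from 3 show ?case by (simp add: fr c)
  qed simp
  then show ?thesis by (simp add: draw_def run_simps fun_upd_def[symmetric])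
qed

lemma run_colour_edges:
  assumes "layout_regs \<sigma>"
  shows "run \<sigma> colour_edges (m * (5 * B + 6) + 2)
    (\<lambda>\<tau>. (\<forall>e<m. mem \<tau> (cols + e) = colour B (coins \<sigma>) e) \<and>
      (\<forall>a. a < cols \<or> offs \<le> a \<longrightarrow> mem \<tau> a = mem \<sigma> a) \<and> coins \<tau> = sdrop (m * B) (coins \<sigma>))"
proof -
  note c = assms[unfolded layout_regs_def]
  let ?\<sigma> = "\<sigma>\<lparr>regs := (regs \<sigma>)(x0 := cols)\<rparr>"
  have "run ?\<sigma> (While_Less x0 rOff (draw ;; Store x0 x1 ;; Add x0 x0 one)) (m * (5 * B + 6) + 1)
    (\<lambda>\<tau>. (\<forall>e<m. mem \<tau> (cols + e) = colour B (coins \<sigma>) e) \<and>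
      (\<forall>a. a < cols \<or> offs \<le> a \<longrightarrow> mem \<tau> a = mem \<sigma> a) \<and> coins \<tau> = sdrop (m * B) (coins \<sigma>))"
  proof (rule run_While[where N = m and t = "5 * B + 5" and Inv = "\<lambda>i \<tau>. regs \<tau> x0 = cols + i \<and>
      (\<forall>e<i. mem \<tau> (cols + e) = colour B (coins \<sigma>) e) \<and>
      (\<forall>a. a < cols \<or> offs \<le> a \<longrightarrow> mem \<tau> a = mem \<sigma> a) \<and> coins \<tau> = sdrop (i * B) (coins \<sigma>)"],
      goal_cases)
    case 1
    then show ?case by simp
  next
    case (2 i \<sigma>')
    note fr = frame_regs[OF 2(2)]
    have lt: "regs \<sigma>' x0 < regs \<sigma>' rOff" using 2 by (simp add: fr c offs_def draw_def)
    have "layout_regs \<sigma>'"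
      by (rule layout_regs_frame[OF _ 2(2)]) (use assms in \<open>simp_all add: layout_regs_def draw_def\<close>)
    then have run: "run \<sigma>' (draw ;; Store x0 x1 ;; Add x0 x0 one) (5 * B + 5)
      (\<lambda>\<tau>. regs \<tau> x0 = cols + Suc i \<and>
      (\<forall>e<Suc i. mem \<tau> (cols + e) = colour B (coins \<sigma>) e) \<and>
      (\<forall>a. a < cols \<or> offs \<le> a \<longrightarrow> mem \<tau> a = mem \<sigma> a) \<and> coins \<tau> = sdrop (Suc i * B) (coins \<sigma>))"
    proof (rule run_Seq[OF run_draw])
      fix \<sigma>1 assume f1: "frame draw \<sigma>' \<sigma>1" and "regs \<sigma>1 x1 = bits_val (stake B (coins \<sigma>')) \<and>
        coins \<sigma>1 = sdrop B (coins \<sigma>')"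
      then have d: "regs \<sigma>1 x1 = colour B (coins \<sigma>) i" "coins \<sigma>1 = sdrop (Suc i * B) (coins \<sigma>)"
        using 2(3) by (simp_all add: colour_def sdrop_add add.commute)
      note fr1 = frame_regs[OF f1] frame_mem[OF f1]
      have "mem \<sigma>1 = mem \<sigma>'" "regs \<sigma>1 x0 = cols + i" "regs \<sigma>1 one = 1"
        using 2(3) fr1 fr c by (simp_all add: draw_def)
      then show "run \<sigma>1 (Store x0 x1 ;; Add x0 x0 one) 2 (\<lambda>\<tau>. regs \<tau> x0 = cols + Suc i \<and>
      (\<forall>e<Suc i. mem \<tau> (cols + e) = colour B (coins \<sigma>) e) \<and>
      (\<forall>a. a < cols \<or> offs \<le> a \<longrightarrow> mem \<tau> a = mem \<sigma> a) \<and> coins \<tau> = sdrop (Suc i * B) (coins \<sigma>))"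
        using 2(1,3) d by (auto simp: run_simps less_Suc_eq offs_def)
    qed simp
    show ?case using lt run by simp
  next
    case (3 \<sigma>')
    note fr = frame_regs[OF 3(1)]
    from 3 show ?case by (simp add: fr c offs_def draw_def)
  qed (simp add: algebra_simps)
  then show ?thesis by (simp add: colour_edges_def run_simps c)
qed

text \<open>Before position \<open>d\<close> is treated, \<open>x3\<close> holds
  \<open>n * (S mod 2 ^ (d + 1))\<close>. As \<open>n\<close> is positive, comparison with
  \<open>n * 2 ^ d\<close> reads off bit \<open>d\<close> of \<open>S\<close>, and the subtraction
  leaves the lower bits.\<close>

lemma run_unpack:
  assumes "layout_regs \<sigma>" and off: "\<And>c. c < k \<Longrightarrow> mem \<sigma> (offs + c) = n * 2 ^ c"
    and x0: "regs \<sigma> x0 = n * S" and S: "S < 2 ^ (k - 1)"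
  shows "run \<sigma> unpack (8 * (k - 1) + 3)
    (\<lambda>\<tau>. (\<forall>c<k - 1. mem \<tau> (bits + c) = of_bool (c \<in> set_decode S)) \<and>
      (\<forall>a. a < bits \<or> tab \<le> a \<longrightarrow> mem \<tau> a = mem \<sigma> a))"
proof -
  note c = assms(1)[unfolded layout_regs_def]
  define K where "K = k - 1"
  let ?\<sigma> = "\<sigma>\<lparr>regs := (regs \<sigma>)(x2 := K, x3 := n * S)\<rparr>"
  let ?body = "Sub x2 x2 one ;; Add x4 rOff x2 ;; Load x4 x4 ;; Add x5 rBit x2 ;;
        If_Less x3 x4 (Store x5 zero) (Store x5 one ;; Sub x3 x3 x4)"
  let ?Inv = "\<lambda>i \<tau>. regs \<tau> x2 = K - i \<and> regs \<tau> x3 = n * (S mod 2 ^ (K - i)) \<and>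
      (\<forall>c<K. K - i \<le> c \<longrightarrow> mem \<tau> (bits + c) = of_bool (c \<in> set_decode S)) \<and>
      (\<forall>a. a < bits \<or> tab \<le> a \<longrightarrow> mem \<tau> a = mem \<sigma> a)"
  have "run ?\<sigma> (While_Less zero x2 ?body) (8 * K + 1)
    (\<lambda>\<tau>. (\<forall>c<K. mem \<tau> (bits + c) = of_bool (c \<in> set_decode S)) \<and>
      (\<forall>a. a < bits \<or> tab \<le> a \<longrightarrow> mem \<tau> a = mem \<sigma> a))"
  proof (rule run_While[where N = K and t = 7 and Inv = ?Inv], goal_cases)
    case 1
    then show ?case using S by (simp add: K_def)
  next
    case (2 i \<sigma>')
    note fr = frame_regs[OF 2(2)]
    obtain d where d: "K - i = Suc d" "K - Suc i = d" using 2(1) by (metis Suc_diff_Suc)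
    have dk: "d < k" "d < K" using d by (simp_all add: K_def)
    have mo: "mem \<sigma>' (offs + d) = n * 2 ^ d"
      using 2(3) off[of d] dk by (simp add: bits_def)
    define r where "r = S mod 2 ^ Suc d"
    have x: "regs \<sigma>' x2 = Suc d" "regs \<sigma>' x3 = n * r"
      using 2(3) d by (simp_all add: r_def del: power_Suc)
    have r: "r = of_bool (d \<in> set_decode S) * 2 ^ d + S mod 2 ^ d"
      unfolding r_def power_Suc2 mod_mult2_eq by (simp add: set_decode_def mod_2_eq_odd)
    have lt: "S mod 2 ^ d < 2 ^ d" by simp
    have Inv: "mem \<sigma>' (bits + c) = of_bool (c \<in> set_decode S)" if "c < K" "d < c" for c
      using 2(3) that d by simp
    have rest: "mem \<sigma>' a = mem \<sigma> a" if "a < bits \<or> tab \<le> a" for a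
      using 2(3) that by blast
    show ?case
    proof (cases "d \<in> set_decode S")
      case True
      then have "\<not> n * r < n * 2 ^ d" "n * r - n * 2 ^ d = n * (S mod 2 ^ d)"
        by (simp_all add: r algebra_simps)
      with True Inv rest dk x show ?thesis
        by (auto simp: run_simps fr c mo d tab_def le_less n_pos)
    next
      case False
      then have "n * r < n * 2 ^ d" "r = S mod 2 ^ d"
        using lt n_pos by (simp_all add: r)
      with False Inv rest dk x show ?thesis
        by (auto simp: run_simps fr c mo d tab_def le_less n_pos)
    qed
  next
    case (3 \<sigma>')
    note fr = frame_regs[OF 3(1)]
    from 3 show ?case by (simp add: fr c)
  qed simp
  then show ?thesis by (simp add: unpack_def run_simps c x0 K_def)
qed

lemma run_clear_row:
  assumes "layout_regs \<sigma>" "regs \<sigma> x1 = base"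
  shows "run \<sigma> clear_row (3 * n + 3)
    (\<lambda>\<tau>. (\<forall>v<n. mem \<tau> (base + v) = 0) \<and>
      (\<forall>a. a < base \<or> base + n \<le> a \<longrightarrow> mem \<tau> a = mem \<sigma> a))"
proof -
  note c = assms(1)[unfolded layout_regs_def] assms(2)
  let ?\<sigma> = "\<sigma>\<lparr>regs := (regs \<sigma>)(x2 := base, x3 := base + n)\<rparr>"
  have "run ?\<sigma> (While_Less x2 x3 (Store x2 zero ;; Add x2 x2 one)) (3 * n + 1)
    (\<lambda>\<tau>. (\<forall>v<n. mem \<tau> (base + v) = 0) \<and>
      (\<forall>a. a < base \<or> base + n \<le> a \<longrightarrow> mem \<tau> a = mem \<sigma> a))"
  proof (rule run_While[where N = n and t = 2 and Inv = "\<lambda>i \<tau>. regs \<tau> x2 = base + i \<and>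
      (\<forall>v<i. mem \<tau> (base + v) = 0) \<and>
      (\<forall>a. a < base \<or> base + n \<le> a \<longrightarrow> mem \<tau> a = mem \<sigma> a)"], goal_cases)
    case (2 i \<sigma>')
    note fr = frame_regs[OF 2(2)]
    from 2 show ?case by (auto simp: run_simps fr c)
  next
    case (3 \<sigma>')
    note fr = frame_regs[OF 3(1)]
    from 3 show ?case by (simp add: fr c)
  qed simp_all
  then show ?thesis by (simp add: clear_row_def run_simps c)
qed

end

text \<open>Deleting a colour subtracts a power of two from the code of the set. In particular the
  code drops, so rows can be filled in increasing order of codes.\<close>

lemma set_decode_diff:
  assumes "c \<in> set_decode S"
  shows "2 ^ c \<le> S" "set_decode (S - 2 ^ c) = set_decode S - {c}"
proof -
  have "set_encode (insert c (set_decode S - {c})) = 2 ^ c + set_encode (set_decode S - {c})"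
    by (rule set_encode_insert) auto
  moreover have "insert c (set_decode S - {c}) = set_decode S" using assms by blast
  ultimately have "S = 2 ^ c + set_encode (set_decode S - {c})" by simp
  then show "2 ^ c \<le> S" "set_decode (S - 2 ^ c) = set_decode S - {c}"
    by (metis le_add1, metis add_diff_cancel_left' finite_Diff finite_set_decode set_encode_inverse)
qed

lemma set_encode_less: "A \<subseteq> {..<K} \<Longrightarrow> set_encode A < 2 ^ K"
proof -
  assume "A \<subseteq> {..<K}"
  then have "set_encode A \<le> (\<Sum>i<K. 2 ^ i)"
    unfolding set_encode_def by (intro sum_mono2) auto
  also have "\<dots> < 2 ^ K" by (induction K) auto
  finally show ?thesis .
qed

section \<open>Filling one row of the table\<close>

context search_layout
begin

lemma run_seed:
  assumes "layout_regs \<sigma>" "regs \<sigma> x1 = base" "regs \<sigma> x0 = n * S"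
  shows "run \<sigma> seed 3 (\<lambda>\<tau>. mem \<tau> = (if S = 0 then (mem \<sigma>)(base + src := 1) else mem \<sigma>))"
  using assms n_pos by (simp add: seed_def run_simps layout_regs_def)

lemma table_less: "S' < S \<Longrightarrow> v < n \<Longrightarrow> n * S' + v < n * S"
proof -
  assume "S' < S" "v < n"
  then have "n * S' + v < n * Suc S'" by simp
  also have "\<dots> \<le> n * S" using \<open>S' < S\<close> by (intro mult_le_mono2) simp
  finally show ?thesis .
qed

text \<open>The part of the memory that survives all trials. Colours, characteristic vector and
  table are rewritten in each of them.\<close>

definition static :: "(nat \<Rightarrow> nat) \<Rightarrow> bool" where
  "static M \<longleftrightarrow> input_ok M \<and> (\<forall>c<k. M (offs + c) = n * 2 ^ c)"

lemma static_cong: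
  assumes "\<And>a. a < cols \<or> offs \<le> a \<and> a < bits \<Longrightarrow> M' a = M a" "static M"
  shows "static M'"
  using assms input_ok_cong[of M' M] by (auto simp: static_def bits_def)

definition row_ok :: "(nat \<Rightarrow> nat) \<Rightarrow> (nat \<Rightarrow> nat) \<Rightarrow> nat \<Rightarrow> bool" where
  "row_ok col M S \<longleftrightarrow>
     (\<forall>v<n. M (tab + n * S + v) = of_bool (coloured_search.reach ends fs src (k - 1) col (set_decode S) v))"

text \<open>The alternative of \<open>reach_iff\<close> in which \<open>e\<close> is the last edge,
  without the test whether \<open>v\<close> is allowed.\<close>

definition edge_into :: "(nat \<Rightarrow> nat) \<Rightarrow> nat \<Rightarrow> nat \<Rightarrow> nat \<Rightarrow> bool" where
  "edge_into col S e v \<longleftrightarrow> (\<exists>x. (ends ! e = (x, v) \<or> ends ! e = (v, x)) \<and> col e < k - 1 \<and>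
     col e \<in> set_decode S \<and>
     coloured_search.reach ends fs src (k - 1) col (set_decode S - {col e}) x)"

text \<open>For the set \<open>S\<close>, the table is read only in rows of smaller codes and
  written only in the row of \<open>S\<close>. Marks set for one edge therefore do not influence
  what is read for another.\<close>

lemma run_relax:
  assumes "layout_regs \<sigma>" and x1: "regs \<sigma> x1 = tab + n * S" and st: "static (mem \<sigma>)"
    and col: "\<And>e. e < m \<Longrightarrow> mem \<sigma> (cols + e) = col e"
    and bit: "\<And>c. c < k - 1 \<Longrightarrow> mem \<sigma> (bits + c) = of_bool (c \<in> set_decode S)"
    and rows: "\<And>S'. S' < S \<Longrightarrow> row_ok col (mem \<sigma>) S'"
    and row: "\<And>v. v < n \<Longrightarrow> mem \<sigma> (tab + n * S + v) = of_bool (S = 0 \<and> v = src)"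
  shows "run \<sigma> relax (25 * m + 3)
    (\<lambda>\<tau>. (\<forall>v<n. mem \<tau> (tab + n * S + v) = of_bool (S = 0 \<and> v = src \<or> (\<exists>e<m. edge_into col S e v))) \<and>
      (\<forall>a. a < tab + n * S \<or> tab + n * S + n \<le> a \<longrightarrow> mem \<tau> a = mem \<sigma> a))"
proof -
  note c = assms(1)[unfolded layout_regs_def] x1
  let ?base = "tab + n * S"
  let ?\<sigma> = "\<sigma>\<lparr>regs := (regs \<sigma>)(x2 := cols, x3 := 7)\<rparr>"
  let ?Inv = "\<lambda>i \<tau>. regs \<tau> x2 = cols + i \<and> regs \<tau> x3 = 7 + 2 * i \<and>
      (\<forall>v<n. mem \<tau> (?base + v) = of_bool (S = 0 \<and> v = src \<or> (\<exists>e<i. edge_into col S e v))) \<and>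
      (\<forall>a. a < ?base \<or> ?base + n \<le> a \<longrightarrow> mem \<tau> a = mem \<sigma> a)"
  have "run ?\<sigma> (While_Less x2 rOff relax_edge) (25 * m + 1)
    (\<lambda>\<tau>. (\<forall>v<n. mem \<tau> (?base + v) = of_bool (S = 0 \<and> v = src \<or> (\<exists>e<m. edge_into col S e v))) \<and>
      (\<forall>a. a < ?base \<or> ?base + n \<le> a \<longrightarrow> mem \<tau> a = mem \<sigma> a))"
  proof (rule run_While[where N = m and t = 24 and Inv = ?Inv], goal_cases)
    case 1
    then show ?case using row by simp
  next
    case (2 i \<sigma>')
    note fr = frame_regs[OF 2(2)]
    have keep: "mem \<sigma>' a = mem \<sigma> a" if "a < ?base" for a using 2(3) that by blast
    have cur: "mem \<sigma>' (?base + v) = of_bool (S = 0 \<and> v = src \<or> (\<exists>e<i. edge_into col S e v))"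
      if "v < n" for v using 2(3) that by blast
    have out: "mem \<sigma>' a = mem \<sigma> a" if "a < ?base \<or> ?base + n \<le> a" for a using 2(3) that by blast
    obtain x y where xy: "ends ! i = (x, y)" by fastforce
    have "(x, y) \<in> set ends" using 2(1) xy nth_mem[of i ends] by (simp add: m_def)
    then have xyn: "x < n" "y < n" using ends_less by simp_all
    have rc: "mem \<sigma>' (cols + i) = col i"
      using keep[of "cols + i"] col[OF 2(1)] 2(1) by (simp add: offs_def bits_def tab_def)
    have rx: "mem \<sigma>' (7 + 2 * i) = x" "mem \<sigma>' (Suc (7 + 2 * i)) = y"
      using keep[of "7 + 2 * i"] keep[of "Suc (7 + 2 * i)"] ends_addr[OF 2(1)] st 2(1) xy
      by (simp_all add: offs_def bits_def tab_def static_def input_ok_def)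
    have lt: "cols + i < offs" using 2(1) by (simp add: offs_def)
    have ex_Suc: "(\<exists>e<Suc i. edge_into col S e v) \<longleftrightarrow> edge_into col S i v \<or> (\<exists>e<i. edge_into col S e v)" for v
      by (auto simp: less_Suc_eq)
    show ?case
    proof (cases "col i < k - 1")
      case red: True
      have rb: "mem \<sigma>' (bits + col i) = of_bool (col i \<in> set_decode S)"
        using keep[of "bits + col i"] bit[OF red] red by (simp add: tab_def)
      have ro: "mem \<sigma>' (offs + col i) = n * 2 ^ col i"
        using keep[of "offs + col i"] red st by (simp add: tab_def bits_def static_def)
      show ?thesis
      proof (cases "col i \<in> set_decode S")
        case True
        define S' where "S' = S - 2 ^ col i"
        have le: "2 ^ col i \<le> S" and S': "set_decode S' = set_decode S - {col i}"
          unfolding S'_def by (rule set_decode_diff[OF True])+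
        have "0 < (2 :: nat) ^ col i" by simp
        then have S'_less: "S' < S" using le unfolding S'_def by linarith
        have "n * 2 ^ col i \<le> n * S" using le by simp
        then have pred: "?base - n * 2 ^ col i = tab + n * S'"
          by (simp add: S'_def diff_mult_distrib2)
        have rp: "mem \<sigma>' (tab + n * S' + v) =
            of_bool (coloured_search.reach ends fs src (k - 1) col (set_decode S') v)" if "v < n" for v
          using rows[OF S'_less] keep[of "tab + n * S' + v"] table_less[OF S'_less that] that
          by (simp add: row_ok_def)
        have into: "edge_into col S i v \<longleftrightarrow>
            v = y \<and> coloured_search.reach ends fs src (k - 1) col (set_decode S') x \<or>
            v = x \<and> coloured_search.reach ends fs src (k - 1) col (set_decode S') y" for v
          using red True unfolding edge_into_def xy S' by auto
        have ne: "tab + n * S' + v \<noteq> ?base + w" if "v < n" for v w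
          using table_less[OF S'_less that] by simp
        define px py where "px = coloured_search.reach ends fs src (k - 1) col (set_decode S') x"
          and "py = coloured_search.reach ends fs src (k - 1) col (set_decode S') y"
        \<comment> \<open>\<open>M\<close> and \<open>M'\<close> are the memories after the first
          and the second possible write. The second read comes after the first write and uses the
          same column \<open>y\<close>, but in another row, as \<open>S'_ne\<close>
          guarantees.\<close>
        define M where "M = (if px then (mem \<sigma>')(?base + y := 1) else mem \<sigma>')"
        define M' where "M' = (if py then M(?base + x := 1) else M)"
        have rpx: "mem \<sigma>' (tab + n * S' + x) = of_bool px" and rpy: "mem \<sigma>' (tab + n * S' + y) = of_bool py"
          using rp xyn by (simp_all add: px_def py_def)
        have S'_ne: "S' \<noteq> S" "n \<noteq> 0" using S'_less n_pos by simp_all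
        have "run \<sigma>' relax_edge 24 (\<lambda>\<tau>. regs \<tau> x2 = cols + Suc i \<and> regs \<tau> x3 = 7 + 2 * Suc i \<and> mem \<tau> = M')"
          using 2(3) rpx rpy rx S'_ne red
          by (cases px; cases py)
            (simp_all add: run_simps relax_edge_def fr c rc red rb ro True pred M_def M'_def)
        then have "run \<sigma>' relax_edge 24 (?Inv (Suc i))"
        proof (rule run_mono)
          fix \<tau> assume \<tau>: "regs \<tau> x2 = cols + Suc i \<and> regs \<tau> x3 = 7 + 2 * Suc i \<and> mem \<tau> = M'"
          have "M' (?base + v) = of_bool (S = 0 \<and> v = src \<or> (\<exists>e<Suc i. edge_into col S e v))" if "v < n" for v
          proof -
            have into_v: "edge_into col S i v \<longleftrightarrow> v = x \<and> py \<or> v = y \<and> px"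
              unfolding into px_def py_def by blast
            have "M' (?base + v) = (if edge_into col S i v then 1 else mem \<sigma>' (?base + v))"
              unfolding into_v by (simp add: M'_def M_def)
            then show ?thesis unfolding ex_Suc cur[OF that] by (cases "edge_into col S i v") simp_all
          qed
          moreover have "M' a = mem \<sigma> a" if "a < ?base \<or> ?base + n \<le> a" for a
            using out[OF that] that xyn by (auto simp: M'_def M_def)
          ultimately show "?Inv (Suc i) \<tau>" using \<tau> by simp
        qed simp
        then show ?thesis using 2(3) lt by (simp add: fr c relax_edge_def)
      next
        case False
        then have "\<not> edge_into col S i v" for v by (simp add: edge_into_def)
        with 2(3) lt rx show ?thesis
          by (simp add: run_simps relax_edge_def fr c rc red rb False ex_Suc)
      qed
    next
      case False
      then have "\<not> edge_into col S i v" for v by (simp add: edge_into_def)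
      with 2(3) lt rx False show ?thesis
        by (simp add: run_simps relax_edge_def fr c rc ex_Suc)
    qed
  next
    case (3 \<sigma>')
    note fr = frame_regs[OF 3(1)]
    from 3 show ?case by (simp add: fr c offs_def relax_edge_def)
  qed simp
  then show ?thesis by (simp add: relax_def run_simps c)
qed

text \<open>The scan continues after an offending edge, since the pointer has to reach the end of
  the list anyway; clearing the cell twice is harmless. By \<open>tab \<le> base\<close>, no word
  that is still to be read is overwritten.\<close>

lemma run_prune_vertex:
  assumes "layout_regs \<sigma>" and x2: "regs \<sigma> x2 = fpos v" and x3: "regs \<sigma> x3 = base + v"
    and v: "v < n" and base: "tab \<le> base" and inp: "input_ok (mem \<sigma>)"
    and col: "\<And>e. e < m \<Longrightarrow> mem \<sigma> (cols + e) = col e"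
    and bit: "\<And>c. c < k - 1 \<Longrightarrow> mem \<sigma> (bits + c) = of_bool (c \<in> S)"
  shows "run \<sigma> prune_vertex (10 * mu + 5)
    (\<lambda>\<tau>. regs \<tau> x2 = fpos (Suc v) \<and> regs \<tau> x3 = base + Suc v \<and>
      mem \<tau> = (if coloured_search.allowed fs (k - 1) col S v then mem \<sigma> else (mem \<sigma>)(base + v := 0)))"
proof -
  interpret coloured_search ends fs src "k - 1" col .
  note c = assms(1)[unfolded layout_regs_def]
  let ?l = "length (fs ! v)"
  let ?\<sigma> = "\<sigma>\<lparr>regs := (regs \<sigma>)(x2 := Suc (fpos v), x5 := Suc (fpos v + ?l))\<rparr>"
  let ?body = "Load x6 x2 ;; Add x2 x2 one ;; Add x6 x6 rCol ;; Load x6 x6 ;;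
        If_Less x6 rRed (Add x7 rBit x6 ;; Load x7 x7 ;; If_Less zero x7 Skip (Store x3 zero)) Skip"
  let ?ok = "\<lambda>e. col e < k - 1 \<longrightarrow> col e \<in> S"
  let ?Inv = "\<lambda>i \<tau>. regs \<tau> x2 = Suc (fpos v + i) \<and>
      mem \<tau> = (if \<forall>j<i. ?ok (fs ! v ! j) then mem \<sigma> else (mem \<sigma>)(base + v := 0))"
  have len: "mem \<sigma> (fpos v) = ?l" using inp v by (simp add: input_ok_def)
  have "run ?\<sigma> (While_Less x2 x5 ?body) (10 * ?l + 1)
    (\<lambda>\<tau>. regs \<tau> x2 = fpos (Suc v) \<and> mem \<tau> = (if allowed S v then mem \<sigma> else (mem \<sigma>)(base + v := 0)))"
  proof (rule run_While[where N = ?l and t = 9 and Inv = ?Inv], goal_cases)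
    case (2 i \<sigma>')
    note fr = frame_regs[OF 2(2)]
    let ?e = "fs ! v ! i"
    have keep: "mem \<sigma>' a = mem \<sigma> a" if "a < tab" for a
      using 2(3) that base by simp
    have e: "?e < m" using fs_less[OF v] nth_mem[OF 2(1)] by (auto simp: m_def)
    have re: "mem \<sigma>' (Suc (fpos v + i)) = ?e"
      using keep[of "Suc (fpos v + i)"] fpos_less[OF v, of "Suc i"] 2(1) inp v
      by (simp add: input_ok_def tab_def bits_def offs_def)
    have rc: "mem \<sigma>' (cols + ?e) = col ?e"
      using keep[of "cols + ?e"] col[OF e] e by (simp add: tab_def bits_def offs_def)
    have all: "(\<forall>j<Suc i. ?ok (fs ! v ! j)) \<longleftrightarrow> (\<forall>j<i. ?ok (fs ! v ! j)) \<and> ?ok ?e"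
      by (auto simp: less_Suc_eq)
    have "run \<sigma>' ?body 9 (\<lambda>\<tau>. regs \<tau> x2 = Suc (fpos v + Suc i) \<and>
        mem \<tau> = (if ?ok ?e then mem \<sigma>' else (mem \<sigma>')(base + v := 0)))"
    proof (cases "col ?e < k - 1")
      case True
      then have "mem \<sigma>' (bits + col ?e) = of_bool (col ?e \<in> S)"
        using keep[of "bits + col ?e"] bit by (simp add: tab_def)
      with 2(3)[THEN conjunct1] re rc True show ?thesis
        by (simp add: run_simps fr c x3 add.commute[of _ cols])
    next
      case False
      with 2(3)[THEN conjunct1] re rc show ?thesis
        by (simp add: run_simps fr c add.commute[of _ cols])
    qed
    then have "run \<sigma>' ?body 9 (?Inv (Suc i))"
      by (rule run_mono) (simp_all only: 2(3)[THEN conjunct2] all split: if_split, auto)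
    then show ?case using 2(1,3) by (simp add: fr)
  next
    case (3 \<sigma>')
    note fr = frame_regs[OF 3(1)]
    from 3 show ?case by (simp add: fr fpos_Suc coloured_search.allowed_def all_set_conv_all_nth)
  qed simp_all
  then have loop: "run ?\<sigma> (While_Less x2 x5 ?body) (10 * mu + 1)
    (\<lambda>\<tau>. regs \<tau> x2 = fpos (Suc v) \<and> mem \<tau> = (if allowed S v then mem \<sigma> else (mem \<sigma>)(base + v := 0)))"
    by (rule run_mono) (use fs_length[OF v] in auto)
  have "run ?\<sigma> (While_Less x2 x5 ?body ;; Add x3 x3 one) (10 * mu + 2)
    (\<lambda>\<tau>. regs \<tau> x2 = fpos (Suc v) \<and> regs \<tau> x3 = base + Suc v \<and>
      mem \<tau> = (if allowed S v then mem \<sigma> else (mem \<sigma>)(base + v := 0)))"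
  proof (rule run_Seq[OF loop, where ?T2.0 = 1], goal_cases)
    case (1 \<sigma>')
    note fr = frame_regs[OF 1(1)]
    from 1 show ?case by (simp add: run_simps fr c x3)
  qed simp
  then show ?thesis by (simp add: prune_vertex_def run_simps c x2 len)
qed

lemma run_prune:
  assumes "layout_regs \<sigma>" and x1: "regs \<sigma> x1 = base"
    and base: "tab \<le> base" and inp: "input_ok (mem \<sigma>)"
    and col: "\<And>e. e < m \<Longrightarrow> mem \<sigma> (cols + e) = col e"
    and bit: "\<And>c. c < k - 1 \<Longrightarrow> mem \<sigma> (bits + c) = of_bool (c \<in> S)"
  shows "run \<sigma> prune (n * (10 * mu + 6) + 6)
    (\<lambda>\<tau>. (\<forall>v<n. mem \<tau> (base + v) =
        (if coloured_search.allowed fs (k - 1) col S v then mem \<sigma> (base + v) else 0)) \<and>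
      (\<forall>a. a < base \<or> base + n \<le> a \<longrightarrow> mem \<tau> a = mem \<sigma> a))"
proof -
  interpret coloured_search ends fs src "k - 1" col .
  note c = assms(1)[unfolded layout_regs_def]
  let ?\<sigma> = "\<sigma>\<lparr>regs := (regs \<sigma>)(x2 := fpos 0, x3 := base, x4 := base + n)\<rparr>"
  let ?Inv = "\<lambda>i \<tau>. regs \<tau> x2 = fpos i \<and> regs \<tau> x3 = base + i \<and>
      (\<forall>v<n. mem \<tau> (base + v) = (if v < i \<and> \<not> allowed S v then 0 else mem \<sigma> (base + v))) \<and>
      (\<forall>a. a < base \<or> base + n \<le> a \<longrightarrow> mem \<tau> a = mem \<sigma> a)"
  have "run ?\<sigma> (While_Less x3 x4 prune_vertex) (n * (10 * mu + 6) + 1)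
    (\<lambda>\<tau>. (\<forall>v<n. mem \<tau> (base + v) = (if allowed S v then mem \<sigma> (base + v) else 0)) \<and>
      (\<forall>a. a < base \<or> base + n \<le> a \<longrightarrow> mem \<tau> a = mem \<sigma> a))"
  proof (rule run_While[where N = n and t = "10 * mu + 5" and Inv = ?Inv], goal_cases)
    case (2 i \<sigma>')
    note fr = frame_regs[OF 2(2)]
    have keep: "mem \<sigma>' a = mem \<sigma> a" if "a < tab" for a
      using 2(3) that base by simp
    have lr: "layout_regs \<sigma>'"
      by (rule layout_regs_frame[OF _ 2(2)]) (use assms(1) in \<open>simp_all add: layout_regs_def prune_vertex_def\<close>)
    have "run \<sigma>' prune_vertex (10 * mu + 5) (?Inv (Suc i))"
    proof (rule run_mono[OF run_prune_vertex[OF lr, where v = i and base = base and col = col and S = S]])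
      show "input_ok (mem \<sigma>')"
        by (rule input_ok_cong[OF _ inp], rule keep) (simp add: tab_def bits_def offs_def)
      show "mem \<sigma>' (cols + e) = col e" if "e < m" for e
        using keep[of "cols + e"] col[OF that] that by (simp add: tab_def bits_def offs_def)
      show "mem \<sigma>' (bits + c) = of_bool (c \<in> S)" if "c < k - 1" for c
        using keep[of "bits + c"] bit[OF that] that by (simp add: tab_def)
      fix \<tau>
      assume "regs \<tau> x2 = fpos (Suc i) \<and> regs \<tau> x3 = base + Suc i \<and>
        mem \<tau> = (if allowed S i then mem \<sigma>' else (mem \<sigma>')(base + i := 0))"
      then show "?Inv (Suc i) \<tau>" using 2(1,3) by (auto simp: less_Suc_eq)
    qed (use 2 base in simp_all)
    moreover have "regs \<sigma>' x3 < regs \<sigma>' x4" using 2 by (simp add: fr prune_vertex_def)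
    ultimately show ?case by blast
  next
    case (3 \<sigma>')
    note fr = frame_regs[OF 3(1)]
    from 3 show ?case by (simp add: fr prune_vertex_def)
  qed (simp_all add: algebra_simps)
  moreover have "m + m + 7 = fpos 0" by (simp add: fpos_def)
  ultimately show ?thesis by (simp add: prune_def run_simps c x1)
qed

section \<open>The whole table and the repetition of trials\<close>

definition "success_with col \<longleftrightarrow> (\<exists>S. coloured_search.reach ends fs src (k - 1) col S dst)"

text \<open>The set belonging to a walk consists of red colours only, so its code is below
  \<open>2 ^ (k - 1)\<close> and the loop over the codes meets it.\<close>

lemma success_with_iff:
  "success_with col \<longleftrightarrow>
     (\<exists>S<2 ^ (k - 1). coloured_search.reach ends fs src (k - 1) col (set_decode S) dst)"
proof
  assume "success_with col"
  then obtain A where A: "coloured_search.reach ends fs src (k - 1) col A dst"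
    by (auto simp: success_with_def)
  from coloured_search.reach_bounded[OF A] have "finite A" "set_encode A < 2 ^ (k - 1)"
    using set_encode_less by auto
  then show "\<exists>S<2 ^ (k - 1). coloured_search.reach ends fs src (k - 1) col (set_decode S) dst"
    using A by (intro exI[of _ "set_encode A"]) simp
qed (auto simp: success_with_def)

text \<open>The sum of the budgets of the seven parts of \<open>explore_set\<close>, with
  \<open>8 * k\<close> in place of \<open>8 * (k - 1)\<close>.\<close>

definition "set_cost = 8 * k + 3 * n + 25 * m + n * (10 * mu + 6) + 24"

text \<open>The phases follow \<open>reach_iff\<close>: \<open>seed\<close> and \<open>relax\<close>
  establish the disjunction, \<open>prune\<close> the conjunct \<open>allowed\<close>. Correct rows
  for smaller codes are assumed and returned together with the row of \<open>S\<close>, which makes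
  this one step of an induction over the codes.\<close>

lemma run_explore_set:
  assumes lr: "layout_regs \<sigma>" and x0: "regs \<sigma> x0 = n * S" and S: "S < 2 ^ (k - 1)"
    and st: "static (mem \<sigma>)" and col: "\<And>e. e < m \<Longrightarrow> mem \<sigma> (cols + e) = col e"
    and rows: "\<And>S'. S' < S \<Longrightarrow> row_ok col (mem \<sigma>) S'"
  shows "run \<sigma> explore_set set_cost
    (\<lambda>\<tau>. regs \<tau> x0 = n * Suc S \<and> (\<forall>a<bits. mem \<tau> a = mem \<sigma> a) \<and>
      (\<forall>S'<Suc S. row_ok col (mem \<tau>) S') \<and>
      (regs \<tau> 0 \<noteq> 0 \<longleftrightarrow> regs \<sigma> 0 \<noteq> 0 \<or>
        coloured_search.reach ends fs src (k - 1) col (set_decode S) dst))"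
    (is "run _ _ _ ?Q")
proof -
  interpret coloured_search ends fs src "k - 1" col .
  let ?base = "tab + n * S"
  let ?D = "set_decode S"
  define \<sigma>0 where "\<sigma>0 = \<sigma>\<lparr>regs := (regs \<sigma>)(x1 := ?base)\<rparr>"
  have lr0: "layout_regs \<sigma>0" and x10: "regs \<sigma>0 x1 = ?base" and x00: "regs \<sigma>0 x0 = n * S"
    and mem0: "mem \<sigma>0 = mem \<sigma>" and r00: "regs \<sigma>0 0 = regs \<sigma> 0"
    using lr x0 by (simp_all add: \<sigma>0_def layout_regs_def)
  \<comment> \<open>The budgets are hidden behind \<open>T\<close> so that each
    \<open>run_Seq\<close> splits the sum by matching; they are evaluated only at the end.\<close>
  define T where "T i = [8 * (k - 1) + 3, 3 * n + 3, 3, 25 * m + 3, n * (10 * mu + 6) + 6, 5] ! i" for i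
  have "run \<sigma>0 (unpack ;; clear_row ;; seed ;; relax ;; prune ;; test_row)
      (T 0 + (T 1 + (T 2 + (T 3 + (T 4 + T 5))))) ?Q"
  proof (rule run_Seq[OF _ _ order.refl])
    show "run \<sigma>0 unpack (T 0)
        (\<lambda>\<tau>. (\<forall>c<k - 1. mem \<tau> (bits + c) = of_bool (c \<in> ?D)) \<and>
          (\<forall>a. a < bits \<or> tab \<le> a \<longrightarrow> mem \<tau> a = mem \<sigma> a))"
      using run_unpack[OF lr0 _ x00 S] st by (simp add: mem0 static_def T_def)
  next
    fix \<sigma>1
    assume f1: "frame unpack \<sigma>0 \<sigma>1" and "(\<forall>c<k - 1. mem \<sigma>1 (bits + c) = of_bool (c \<in> ?D)) \<and>
          (\<forall>a. a < bits \<or> tab \<le> a \<longrightarrow> mem \<sigma>1 a = mem \<sigma> a)"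
    then have bit1: "\<And>c. c < k - 1 \<Longrightarrow> mem \<sigma>1 (bits + c) = of_bool (c \<in> ?D)"
      and keep1: "\<And>a. a < bits \<or> tab \<le> a \<Longrightarrow> mem \<sigma>1 a = mem \<sigma> a" by blast+
    have lr1: "layout_regs \<sigma>1" by (rule layout_regs_frame[OF lr0 f1]) (simp add: unpack_def)
    have r1: "regs \<sigma>1 x1 = ?base" "regs \<sigma>1 x0 = n * S" "regs \<sigma>1 0 = regs \<sigma> 0"
      using frame_regs[OF f1] x10 x00 r00 by (simp_all add: unpack_def)
    show "run \<sigma>1 (clear_row ;; seed ;; relax ;; prune ;; test_row)
        (T 1 + (T 2 + (T 3 + (T 4 + T 5)))) ?Q"
    proof (rule run_Seq[OF _ _ order.refl])
      show "run \<sigma>1 clear_row (T 1) (\<lambda>\<tau>. (\<forall>v<n. mem \<tau> (?base + v) = 0) \<and>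
          (\<forall>a. a < ?base \<or> ?base + n \<le> a \<longrightarrow> mem \<tau> a = mem \<sigma>1 a))"
        using run_clear_row[OF lr1 r1(1)] by (simp add: T_def)
    next
      fix \<sigma>2
      assume f2: "frame clear_row \<sigma>1 \<sigma>2" and q2: "(\<forall>v<n. mem \<sigma>2 (?base + v) = 0) \<and>
          (\<forall>a. a < ?base \<or> ?base + n \<le> a \<longrightarrow> mem \<sigma>2 a = mem \<sigma>1 a)"
      have lr2: "layout_regs \<sigma>2" by (rule layout_regs_frame[OF lr1 f2]) (simp add: clear_row_def)
      have r2: "regs \<sigma>2 x1 = ?base" "regs \<sigma>2 x0 = n * S" "regs \<sigma>2 0 = regs \<sigma> 0"
        using frame_regs[OF f2] r1 by (simp_all add: clear_row_def)
      show "run \<sigma>2 (seed ;; relax ;; prune ;; test_row) (T 2 + (T 3 + (T 4 + T 5))) ?Q"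
      proof (rule run_Seq[OF _ _ order.refl])
        show "run \<sigma>2 seed (T 2)
            (\<lambda>\<tau>. mem \<tau> = (if S = 0 then (mem \<sigma>2)(?base + src := 1) else mem \<sigma>2))"
          using run_seed[OF lr2 r2(1,2)] by (simp add: T_def)
      next
        fix \<sigma>3
        assume f3: "frame seed \<sigma>2 \<sigma>3"
          and q3: "mem \<sigma>3 = (if S = 0 then (mem \<sigma>2)(?base + src := 1) else mem \<sigma>2)"
        have lr3: "layout_regs \<sigma>3" by (rule layout_regs_frame[OF lr2 f3]) (simp add: seed_def)
        have r3: "regs \<sigma>3 x1 = ?base" "regs \<sigma>3 x0 = n * S" "regs \<sigma>3 0 = regs \<sigma> 0"
          using frame_regs[OF f3] r2 by (simp_all add: seed_def)
        have keep31: "mem \<sigma>3 a = mem \<sigma>1 a" if "a < ?base" for a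
        proof -
          have "mem \<sigma>3 a = mem \<sigma>2 a" using q3 that by auto
          also have "\<dots> = mem \<sigma>1 a" using q2 that by blast
          finally show ?thesis .
        qed
        have keep3: "mem \<sigma>3 a = mem \<sigma> a" if "a < bits \<or> tab \<le> a \<and> a < ?base" for a
        proof -
          have "a < ?base" using that by (auto simp: tab_def)
          then show ?thesis using keep31 keep1 that by auto
        qed
        have row3: "mem \<sigma>3 (?base + v) = of_bool (S = 0 \<and> v = src)" if "v < n" for v
        proof -
          have "mem \<sigma>2 (?base + v) = 0" using q2 that by blast
          then show ?thesis using q3 by (cases "S = 0") simp_all
        qed
        have bit3: "mem \<sigma>3 (bits + c) = of_bool (c \<in> ?D)" if "c < k - 1" for c
          using keep31[of "bits + c"] bit1[OF that] that by (simp add: tab_def)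
        have col3: "mem \<sigma>3 (cols + e) = col e" if "e < m" for e
          using keep3[of "cols + e"] col[OF that] that by (simp add: bits_def offs_def)
        have st3: "static (mem \<sigma>3)"
          by (rule static_cong[OF keep3 st]) (auto simp: bits_def offs_def)
        have rows3: "row_ok col (mem \<sigma>3) S'" if "S' < S" for S'
          using rows[OF that] keep3 table_less[OF that] by (simp add: row_ok_def)
        show "run \<sigma>3 (relax ;; prune ;; test_row) (T 3 + (T 4 + T 5)) ?Q"
        proof (rule run_Seq[OF _ _ order.refl])
          show "run \<sigma>3 relax (T 3) (\<lambda>\<tau>. (\<forall>v<n. mem \<tau> (?base + v) =
                of_bool (S = 0 \<and> v = src \<or> (\<exists>e<m. edge_into col S e v))) \<and>
              (\<forall>a. a < ?base \<or> ?base + n \<le> a \<longrightarrow> mem \<tau> a = mem \<sigma>3 a))"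
            using run_relax[OF lr3 r3(1) st3 col3 bit3 rows3 row3] by (simp add: T_def)
        next
          fix \<sigma>4
          assume f4: "frame relax \<sigma>3 \<sigma>4" and q4: "(\<forall>v<n. mem \<sigma>4 (?base + v) =
                of_bool (S = 0 \<and> v = src \<or> (\<exists>e<m. edge_into col S e v))) \<and>
              (\<forall>a. a < ?base \<or> ?base + n \<le> a \<longrightarrow> mem \<sigma>4 a = mem \<sigma>3 a)"
          have lr4: "layout_regs \<sigma>4"
            by (rule layout_regs_frame[OF lr3 f4]) (simp add: relax_def relax_edge_def)
          have r4: "regs \<sigma>4 x1 = ?base" "regs \<sigma>4 x0 = n * S" "regs \<sigma>4 0 = regs \<sigma> 0"
            using frame_regs[OF f4] r3 by (simp_all add: relax_def relax_edge_def)
          have keep4: "mem \<sigma>4 a = mem \<sigma>3 a" if "a < ?base" for a using q4 that by blast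
          have bit4: "mem \<sigma>4 (bits + c) = of_bool (c \<in> ?D)" if "c < k - 1" for c
            using keep4[of "bits + c"] bit3[OF that] that by (simp add: tab_def)
          have col4: "mem \<sigma>4 (cols + e) = col e" if "e < m" for e
            using keep4[of "cols + e"] col3[OF that] that by (simp add: tab_def bits_def offs_def)
          have inp4: "input_ok (mem \<sigma>4)"
          proof (rule input_ok_cong)
            show "input_ok (mem \<sigma>3)" using st3 by (simp add: static_def)
          qed (rule keep4, simp add: tab_def bits_def offs_def)
          show "run \<sigma>4 (prune ;; test_row) (T 4 + T 5) ?Q"
          proof (rule run_Seq[OF _ _ order.refl])
            show "run \<sigma>4 prune (T 4) (\<lambda>\<tau>. (\<forall>v<n. mem \<tau> (?base + v) =
                  (if allowed ?D v then mem \<sigma>4 (?base + v) else 0)) \<and>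
                (\<forall>a. a < ?base \<or> ?base + n \<le> a \<longrightarrow> mem \<tau> a = mem \<sigma>4 a))"
              using run_prune[OF lr4 r4(1) _ inp4 col4 bit4] by (simp add: T_def)
          next
            fix \<sigma>5
            assume f5: "frame prune \<sigma>4 \<sigma>5" and q5: "(\<forall>v<n. mem \<sigma>5 (?base + v) =
                  (if allowed ?D v then mem \<sigma>4 (?base + v) else 0)) \<and>
                (\<forall>a. a < ?base \<or> ?base + n \<le> a \<longrightarrow> mem \<sigma>5 a = mem \<sigma>4 a)"
            have lr5: "layout_regs \<sigma>5"
              by (rule layout_regs_frame[OF lr4 f5]) (simp add: prune_def prune_vertex_def)
            have r5: "regs \<sigma>5 x1 = ?base" "regs \<sigma>5 x0 = n * S" "regs \<sigma>5 0 = regs \<sigma> 0"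
              using frame_regs[OF f5] r4 by (simp_all add: prune_def prune_vertex_def)
            have keep5: "mem \<sigma>5 a = mem \<sigma> a" if "a < bits \<or> tab \<le> a \<and> a < ?base" for a
            proof -
              have "a < ?base" using that by (auto simp: tab_def)
              then show ?thesis using q5 keep4 keep3[OF that] by auto
            qed
            have "(\<exists>e<m. edge_into col S e v) \<longleftrightarrow>
                (\<exists>e<length ends. \<exists>x. (ends ! e = (x, v) \<or> ends ! e = (v, x)) \<and> col e < k - 1 \<and>
                  col e \<in> ?D \<and> reach (?D - {col e}) x)" for v
              by (auto simp: edge_into_def m_def)
            moreover have "S = 0 \<longleftrightarrow> ?D = {}"
              by (metis set_decode_inverse set_decode_zero set_encode_empty)
            ultimately have iff: "reach ?D v \<longleftrightarrow>
                allowed ?D v \<and> (S = 0 \<and> v = src \<or> (\<exists>e<m. edge_into col S e v))" for v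
              by (subst reach_iff) simp
            have row5: "row_ok col (mem \<sigma>5) S"
              unfolding row_ok_def iff using q4 q5 by simp
            have "row_ok col (mem \<sigma>5) S'" if "S' < Suc S" for S'
            proof (cases "S' = S")
              case False
              then have "S' < S" using that by simp
              then show ?thesis using rows keep5 table_less[of S' S] by (simp add: row_ok_def)
            qed (use row5 in simp)
            moreover have "mem \<sigma>5 (?base + dst) = of_bool (reach ?D dst)"
              using row5 dst_less by (simp add: row_ok_def)
            ultimately show "run \<sigma>5 test_row (T 5) ?Q"
              using lr5 r5 keep5
              by (cases "reach ?D dst") (simp_all add: T_def test_row_def run_simps layout_regs_def)
          qed
        qed
      qed
    qed
  qed
  then have "run \<sigma>0 (unpack ;; clear_row ;; seed ;; relax ;; prune ;; test_row) (set_cost - 1) ?Q"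
    by (rule run_mono) (simp_all add: T_def set_cost_def)
  then show ?thesis
    using lr x0 by (simp add: explore_set_def run_simps layout_regs_def set_cost_def \<sigma>0_def)
qed

text \<open>Exploring a set changes memory only from address \<open>bits\<close> on, so the input,
  the colours and the offsets stay in place during the whole search.\<close>

lemma run_search:
  assumes lr: "layout_regs \<sigma>" and st: "static (mem \<sigma>)"
    and col: "\<And>e. e < m \<Longrightarrow> mem \<sigma> (cols + e) = col e"
  shows "run \<sigma> search (2 ^ (k - 1) * (set_cost + 1) + 2)
    (\<lambda>\<tau>. static (mem \<tau>) \<and> (regs \<tau> 0 \<noteq> 0 \<longleftrightarrow> regs \<sigma> 0 \<noteq> 0 \<or> success_with col))"
proof -
  define N :: nat where "N = 2 ^ (k - 1)"
  let ?\<sigma> = "\<sigma>\<lparr>regs := (regs \<sigma>)(x0 := 0)\<rparr>"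
  let ?Inv = "\<lambda>S \<tau>. regs \<tau> x0 = n * S \<and> (\<forall>a<bits. mem \<tau> a = mem \<sigma> a) \<and>
      (\<forall>S'<S. row_ok col (mem \<tau>) S') \<and>
      (regs \<tau> 0 \<noteq> 0 \<longleftrightarrow> regs \<sigma> 0 \<noteq> 0 \<or>
        (\<exists>S'<S. coloured_search.reach ends fs src (k - 1) col (set_decode S') dst))"
  have st': "static M" if "\<forall>a<bits. M a = mem \<sigma> a" for M
    by (rule static_cong[OF _ st]) (use that in \<open>auto simp: bits_def offs_def\<close>)
  have w: "writes explore_set \<inter> {2, 3, 4, 5, 9, 10, 11, 13, 15, 16, 17, 18, 19} = {}"
    by (simp add: program_defs)
  have "run ?\<sigma> (While_Less x0 rSize explore_set) (N * (set_cost + 1) + 1)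
    (\<lambda>\<tau>. static (mem \<tau>) \<and> (regs \<tau> 0 \<noteq> 0 \<longleftrightarrow> regs \<sigma> 0 \<noteq> 0 \<or> success_with col))"
  proof (rule run_While[where N = N and t = set_cost and Inv = ?Inv], goal_cases)
    case (2 S \<sigma>')
    have lr': "layout_regs \<sigma>'"
      by (rule layout_regs_frame[OF _ 2(2) w]) (use lr in \<open>simp add: layout_regs_def\<close>)
    have S: "S < 2 ^ (k - 1)" using 2(1) by (simp add: N_def)
    have "mem \<sigma>' (cols + e) = col e" if "e < m" for e
      using 2(3) col[OF that] that by (simp add: bits_def offs_def)
    with 2(3) st'[of "mem \<sigma>'"] have "run \<sigma>' explore_set set_cost
      (\<lambda>\<tau>. regs \<tau> x0 = n * Suc S \<and> (\<forall>a<bits. mem \<tau> a = mem \<sigma>' a) \<and>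
      (\<forall>S'<Suc S. row_ok col (mem \<tau>) S') \<and>
      (regs \<tau> 0 \<noteq> 0 \<longleftrightarrow> regs \<sigma>' 0 \<noteq> 0 \<or>
        coloured_search.reach ends fs src (k - 1) col (set_decode S) dst))"
      by (intro run_explore_set[OF lr' _ S]) auto
    then have "run \<sigma>' explore_set set_cost (?Inv (Suc S))"
    proof (rule run_mono)
      fix \<tau>
      assume "regs \<tau> x0 = n * Suc S \<and> (\<forall>a<bits. mem \<tau> a = mem \<sigma>' a) \<and>
      (\<forall>S'<Suc S. row_ok col (mem \<tau>) S') \<and>
      (regs \<tau> 0 \<noteq> 0 \<longleftrightarrow> regs \<sigma>' 0 \<noteq> 0 \<or>
        coloured_search.reach ends fs src (k - 1) col (set_decode S) dst)"
      moreover have "(\<exists>S'<Suc S. coloured_search.reach ends fs src (k - 1) col (set_decode S') dst) \<longleftrightarrow>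
        coloured_search.reach ends fs src (k - 1) col (set_decode S) dst \<or>
        (\<exists>S'<S. coloured_search.reach ends fs src (k - 1) col (set_decode S') dst)"
        by (auto simp: less_Suc_eq)
      ultimately show "?Inv (Suc S) \<tau>" using 2(3) by (simp add: disj_ac)
    qed simp
    moreover have "regs \<sigma>' x0 < regs \<sigma>' rSize"
      using 2(3) lr' S n_pos by (simp add: layout_regs_def)
    ultimately show ?case by blast
  next
    case (3 \<sigma>')
    have "layout_regs \<sigma>'"
      by (rule layout_regs_frame[OF _ 3(1) w]) (use lr in \<open>simp add: layout_regs_def\<close>)
    then show ?case using 3(2) st'[of "mem \<sigma>'"]
      by (simp add: success_with_iff N_def layout_regs_def)
  qed simp_all
  then show ?thesis by (simp add: search_def run_simps N_def)
qed

definition "trial_cost = m * (5 * B + 6) + 2 ^ (k - 1) * (set_cost + 1) + 5"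

text \<open>Only \<open>colour_edges\<close> flips coins, and always \<open>m * B\<close> of them,
  so the next trial starts exactly at the next block.\<close>

lemma run_trial:
  assumes lr: "layout_regs \<sigma>" and st: "static (mem \<sigma>)"
  shows "run \<sigma> trial trial_cost
    (\<lambda>\<tau>. static (mem \<tau>) \<and> regs \<tau> rTrials = regs \<sigma> rTrials - 1 \<and>
      coins \<tau> = sdrop (m * B) (coins \<sigma>) \<and>
      (regs \<tau> 0 \<noteq> 0 \<longleftrightarrow> regs \<sigma> 0 \<noteq> 0 \<or> success_with (colour B (coins \<sigma>))))"
    (is "run _ _ _ ?Q")
proof -
  let ?col = "colour B (coins \<sigma>)"
  have "run \<sigma> trial ((m * (5 * B + 6) + 2) + ((2 ^ (k - 1) * (set_cost + 1) + 2) + 1)) ?Q"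
    unfolding trial_def
  proof (rule run_Seq[OF run_colour_edges[OF lr] _ order.refl])
    fix \<sigma>1
    assume f1: "frame colour_edges \<sigma> \<sigma>1" and q1: "(\<forall>e<m. mem \<sigma>1 (cols + e) = ?col e) \<and>
      (\<forall>a. a < cols \<or> offs \<le> a \<longrightarrow> mem \<sigma>1 a = mem \<sigma> a) \<and> coins \<sigma>1 = sdrop (m * B) (coins \<sigma>)"
    have lr1: "layout_regs \<sigma>1"
      by (rule layout_regs_frame[OF lr f1]) (simp add: colour_edges_def draw_def)
    have st1: "static (mem \<sigma>1)"
      by (rule static_cong[OF _ st]) (use q1 in auto)
    have col1: "mem \<sigma>1 (cols + e) = ?col e" if "e < m" for e using q1 that by blast
    show "run \<sigma>1 (search ;; Sub rTrials rTrials one) ((2 ^ (k - 1) * (set_cost + 1) + 2) + 1) ?Q"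
    proof (rule run_Seq[OF run_search[OF lr1 st1 col1] _ order.refl])
      fix \<sigma>2
      assume f2: "frame search \<sigma>1 \<sigma>2"
        and "static (mem \<sigma>2) \<and> (regs \<sigma>2 0 \<noteq> 0 \<longleftrightarrow> regs \<sigma>1 0 \<noteq> 0 \<or> success_with ?col)"
      moreover have "layout_regs \<sigma>2"
        by (rule layout_regs_frame[OF lr1 f2]) (simp add: program_defs)
      moreover have "regs \<sigma>1 0 = regs \<sigma> 0" "regs \<sigma>1 rTrials = regs \<sigma> rTrials"
        using frame_regs[OF f1] by (simp_all add: colour_edges_def draw_def)
      moreover have "regs \<sigma>2 rTrials = regs \<sigma>1 rTrials" "coins \<sigma>2 = coins \<sigma>1"
        using frame_regs[OF f2] frame_coins[OF f2] by (simp_all add: program_defs)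
      ultimately show "run \<sigma>2 (Sub rTrials rTrials one) 1 ?Q"
        using q1 by (simp add: run_simps layout_regs_def)
    qed
  qed
  then show ?thesis by (rule run_mono) (simp_all add: trial_cost_def)
qed

text \<open>Round \<open>r\<close> meets the stream shifted by \<open>r * (m * B)\<close>, the shape
  for which \<open>measure_rounds\<close> gives the probability.\<close>

lemma run_trials:
  assumes lr: "layout_regs \<sigma>" and st: "static (mem \<sigma>)" and R: "regs \<sigma> rTrials = R"
    and ans: "regs \<sigma> 0 = 0"
  shows "run \<sigma> (While_Less zero rTrials trial) (R * (trial_cost + 1) + 1)
    (\<lambda>\<tau>. regs \<tau> 0 \<noteq> 0 \<longleftrightarrow> (\<exists>r<R. success_with (colour B (sdrop (r * (m * B)) (coins \<sigma>)))))"
proof (rule run_While[where N = R and t = trial_cost and Inv = "\<lambda>r \<tau>. static (mem \<tau>) \<and>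
      regs \<tau> rTrials = R - r \<and> coins \<tau> = sdrop (r * (m * B)) (coins \<sigma>) \<and>
      (regs \<tau> 0 \<noteq> 0 \<longleftrightarrow> (\<exists>r'<r. success_with (colour B (sdrop (r' * (m * B)) (coins \<sigma>)))))"],
    goal_cases)
  case 1
  then show ?case using st R ans by simp
next
  case (2 r \<sigma>')
  have lr': "layout_regs \<sigma>'"
    by (rule layout_regs_frame[OF lr 2(2)]) (simp add: program_defs)
  have "run \<sigma>' trial trial_cost (\<lambda>\<tau>. static (mem \<tau>) \<and>
      regs \<tau> rTrials = R - Suc r \<and> coins \<tau> = sdrop (Suc r * (m * B)) (coins \<sigma>) \<and>
      (regs \<tau> 0 \<noteq> 0 \<longleftrightarrow> (\<exists>r'<Suc r. success_with (colour B (sdrop (r' * (m * B)) (coins \<sigma>))))))"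
  proof (rule run_mono[OF run_trial[OF lr']], goal_cases)
    case (3 \<tau>)
    have "coins \<tau> = sdrop (Suc r * (m * B)) (coins \<sigma>)"
      using 3(2) 2(3) by (simp add: sdrop_add add.commute)
    moreover have "(\<exists>r'<Suc r. success_with (colour B (sdrop (r' * (m * B)) (coins \<sigma>)))) \<longleftrightarrow>
        (\<exists>r'<r. success_with (colour B (sdrop (r' * (m * B)) (coins \<sigma>)))) \<or>
        success_with (colour B (sdrop (r * (m * B)) (coins \<sigma>)))"
      by (auto simp: less_Suc_eq)
    ultimately show ?case using 3(2) 2(3) by simp
  qed (use 2 in simp_all)
  moreover have "regs \<sigma>' zero < regs \<sigma>' rTrials"
    using lr' 2 by (simp add: layout_regs_def)
  ultimately show ?case by blast
next
  case (3 \<sigma>')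
  have "layout_regs \<sigma>'"
    by (rule layout_regs_frame[OF lr 3(1)]) (simp add: program_defs)
  then show ?case using 3(2) by (simp add: layout_regs_def)
qed simp

end

section \<open>Setting up the trials\<close>

text \<open>The binary logarithm rounded up, with value \<open>0\<close> at \<open>0\<close>: the
  number of doublings that take \<open>1\<close> to at least \<open>x\<close>.\<close>

definition clog :: "nat \<Rightarrow> nat" where
  "clog x = (LEAST i. x \<le> 2 ^ i)"

lemma clog_ge: "x \<le> 2 ^ clog x"
  unfolding clog_def by (rule LeastI[of _ x]) (simp add: less_imp_le)

lemma clog_less: "i < clog x \<Longrightarrow> 2 ^ i < x"
  unfolding clog_def using not_less_Least not_le by blast

lemma clog_le: "clog x \<le> x"
  unfolding clog_def by (rule Least_le) (simp add: less_imp_le)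

lemma clog_upper: "0 < x \<Longrightarrow> 2 ^ clog x \<le> 2 * x"
  using clog_less[of "clog x - 1" x] by (cases "clog x") auto

definition fetch :: "nat \<Rightarrow> nat \<Rightarrow> program" where
  "fetch r a = Const r a ;; Load r r"

definition header :: program where
  "header = fetch rN 0 ;; fetch rM 1 ;; fetch rSrc 2 ;; fetch rDst 3 ;; fetch rK 4 ;; fetch rP 5 ;;
     fetch rQ 6 ;; Const zero 0 ;; Const one 1"

text \<open>\<open>rMu\<close> starts at \<open>2\<close>, which realizes the convention
  \<open>max {\<mu>, 2}\<close>; \<open>rCol\<close> skips the lists and ends behind the
  input.\<close>

definition scan :: program where
  "scan = Const rCol 7 ;; Add rCol rCol rM ;; Add rCol rCol rM ;; Const rMu 2 ;; Const x0 0 ;;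
     While_Less x0 rN
       (Load x1 rCol ;; If_Less rMu x1 (Add rMu x1 zero) Skip ;; Add rCol rCol x1 ;;
        Add rCol rCol one ;; Add x0 x0 one)"

definition doublings :: "nat \<Rightarrow> nat \<Rightarrow> nat \<Rightarrow> program" where
  "doublings r b c = While_Less r b (Add r r r ;; Add c c one)"

text \<open>The initial value \<open>1\<close> of \<open>rB\<close> supplies the factor
  \<open>2\<close> in \<open>2 * k * mu \<le> 2 ^ B\<close>.\<close>

definition count_bits :: program where
  "count_bits = Const rB 1 ;; Const x0 1 ;; doublings x0 rK rB ;; Const x0 1 ;; doublings x0 rMu rB"

text \<open>A trial succeeds with probability at least \<open>1 / (64 * 2 ^ clog mu) ^ k\<close>; this is one factor of it.\<close>

definition boost :: program where
  "boost = Add rTrials rTrials rTrials ;; Add rTrials rTrials rTrials ;; Add rTrials rTrials rTrials ;;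
     Add rTrials rTrials rTrials ;; Add rTrials rTrials rTrials ;; Add rTrials rTrials rTrials ;;
     Const x0 1 ;; While_Less x0 rMu (Add x0 x0 x0 ;; Add rTrials rTrials rTrials)"

text \<open>Doubling \<open>p\<close> up to \<open>q\<close> counts the binary logarithm of
  \<open>q / p\<close>, rounded up, in \<open>rTrials\<close>; each pass of the loop then multiplies
  it by \<open>64 * 2 ^ clog mu\<close>.\<close>

definition count_trials :: program where
  "count_trials = Const rTrials 0 ;; Add x0 rP zero ;; doublings x0 rQ rTrials ;; Const x1 0 ;;
     While_Less x1 rK (boost ;; Add x1 x1 one)"

text \<open>The last two instructions load the final offset \<open>n * 2 ^ (k - 1)\<close>, which
  saves computing the size of the table separately.\<close>

definition lay_out :: program where
  "lay_out = Sub rRed rK one ;; Add rOff rCol rM ;; Add rBit rOff rK ;; Add rTab rBit rK ;;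
     Add x0 rOff zero ;; Add x1 rN zero ;;
     While_Less x0 rBit (Store x0 x1 ;; Add x1 x1 x1 ;; Add x0 x0 one) ;;
     Sub rSize rBit one ;; Load rSize rSize"

lemma run_doublings:
  assumes "r \<noteq> c" "r \<noteq> one" "c \<noteq> one" "b \<noteq> r" "b \<noteq> c" "regs \<sigma> one = 1"
    and lt: "\<And>i. i < N \<Longrightarrow> regs \<sigma> r * 2 ^ i < regs \<sigma> b" and ge: "regs \<sigma> b \<le> regs \<sigma> r * 2 ^ N"
  shows "run \<sigma> (doublings r b c) (3 * N + 1) (\<lambda>\<tau>. regs \<tau> c = regs \<sigma> c + N)"
  unfolding doublings_def
proof (rule run_While[where N = N and t = 2 and Inv = "\<lambda>i \<tau>. regs \<tau> r = regs \<sigma> r * 2 ^ i \<and>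
    regs \<tau> c = regs \<sigma> c + i"], goal_cases)
  case (2 i \<sigma>')
  have "regs \<sigma>' one = 1" "regs \<sigma>' b = regs \<sigma> b"
    using frame_regs[OF 2(2)] assms(1-6) by simp_all
  with 2 lt[OF 2(1)] assms(1-5) show ?case by (simp add: run_simps)
next
  case (3 \<sigma>')
  have "regs \<sigma>' b = regs \<sigma> b" using frame_regs[OF 3(1)] assms(4,5) by simp
  with 3 ge show ?case by simp
qed simp_all

lemma run_boost:
  assumes "regs \<sigma> rMu = mu"
  shows "run \<sigma> boost (3 * clog mu + 8) (\<lambda>\<tau>. regs \<tau> rTrials = regs \<sigma> rTrials * (64 * 2 ^ clog mu))"
proof -
  define \<sigma>0 where "\<sigma>0 = \<sigma>\<lparr>regs := (regs \<sigma>)(rTrials := 64 * regs \<sigma> rTrials, x0 := 1)\<rparr>"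
  have "run \<sigma>0 (While_Less x0 rMu (Add x0 x0 x0 ;; Add rTrials rTrials rTrials)) (3 * clog mu + 1)
      (\<lambda>\<tau>. regs \<tau> rTrials = 64 * regs \<sigma> rTrials * 2 ^ clog mu)"
  proof (rule run_While[where N = "clog mu" and t = 2 and Inv = "\<lambda>i \<tau>. regs \<tau> x0 = 2 ^ i \<and>
      regs \<tau> rTrials = 64 * regs \<sigma> rTrials * 2 ^ i"], goal_cases)
    case 1
    then show ?case by (simp add: \<sigma>0_def)
  next
    case (2 i \<sigma>')
    have "regs \<sigma>' rMu = mu" using frame_regs[OF 2(2)] assms by (simp add: \<sigma>0_def)
    with 2 clog_less[of i mu] show ?case by (simp add: run_simps)
  next
    case (3 \<sigma>')
    have "regs \<sigma>' rMu = mu" using frame_regs[OF 3(1)] assms by (simp add: \<sigma>0_def)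
    with 3 clog_ge[of mu] show ?case by simp
  qed simp
  then have *: "run \<sigma>0 (While_Less x0 rMu (Add x0 x0 x0 ;; Add rTrials rTrials rTrials)) (3 * clog mu + 1)
      (\<lambda>\<tau>. regs \<tau> rTrials = regs \<sigma> rTrials * (64 * 2 ^ clog mu))"
    by (simp add: mult_ac)
  have "step (Const x0 1) (step (Add rTrials rTrials rTrials) (step (Add rTrials rTrials rTrials)
    (step (Add rTrials rTrials rTrials) (step (Add rTrials rTrials rTrials)
    (step (Add rTrials rTrials rTrials) (step (Add rTrials rTrials rTrials) \<sigma>)))))) = \<sigma>0"
    by (simp add: \<sigma>0_def flip: mult_2)
  with * show ?thesis unfolding boost_def by (simp add: run_Seq_elementary del: step.simps)
qed

lemma run_count_trials:
  assumes "regs \<sigma> zero = 0" "regs \<sigma> one = 1" "regs \<sigma> rK = k" "regs \<sigma> rMu = mu" "regs \<sigma> rP = p"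
    "regs \<sigma> rQ = q" and lt: "\<And>i. i < L \<Longrightarrow> p * 2 ^ i < q" and ge: "q \<le> p * 2 ^ L"
  shows "run \<sigma> count_trials (3 * L + k * (3 * clog mu + 10) + 5)
    (\<lambda>\<tau>. regs \<tau> rTrials = L * (64 * 2 ^ clog mu) ^ k)"
proof -
  define \<sigma>0 where "\<sigma>0 = \<sigma>\<lparr>regs := (regs \<sigma>)(rTrials := 0, x0 := p)\<rparr>"
  let ?Q = "\<lambda>\<tau>. regs \<tau> rTrials = L * (64 * 2 ^ clog mu) ^ k"
  have "run \<sigma>0 (doublings x0 rQ rTrials ;; Const x1 0 ;; While_Less x1 rK (boost ;; Add x1 x1 one))
     ((3 * L + 1) + (1 + (k * (3 * clog mu + 10) + 1))) ?Q"
  proof (rule run_Seq[OF _ _ order.refl])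
    show "run \<sigma>0 (doublings x0 rQ rTrials) (3 * L + 1) (\<lambda>\<tau>. regs \<tau> rTrials = L)"
      by (rule run_mono[OF run_doublings[where N = L]]) (use assms in \<open>simp_all add: \<sigma>0_def\<close>)
    fix \<sigma>1 assume f1: "frame (doublings x0 rQ rTrials) \<sigma>0 \<sigma>1" and L1: "regs \<sigma>1 rTrials = L"
    have r1: "regs \<sigma>1 one = 1" "regs \<sigma>1 rK = k" "regs \<sigma>1 rMu = mu"
      using frame_regs[OF f1] assms(1-6) by (simp_all add: \<sigma>0_def doublings_def)
    define \<sigma>2 where "\<sigma>2 = \<sigma>1\<lparr>regs := (regs \<sigma>1)(x1 := 0)\<rparr>"
    have "run \<sigma>2 (While_Less x1 rK (boost ;; Add x1 x1 one)) (k * (3 * clog mu + 10) + 1) ?Q"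
    proof (rule run_While[where N = k and t = "3 * clog mu + 9" and Inv = "\<lambda>i \<tau>. regs \<tau> x1 = i \<and>
        regs \<tau> rTrials = L * (64 * 2 ^ clog mu) ^ i"], goal_cases)
      case 1
      then show ?case by (simp add: \<sigma>2_def L1)
    next
      case (2 i \<sigma>')
      have r: "regs \<sigma>' one = 1" "regs \<sigma>' rK = k" "regs \<sigma>' rMu = mu"
        using frame_regs[OF 2(2)] r1 by (simp_all add: \<sigma>2_def boost_def)
      have "run \<sigma>' (boost ;; Add x1 x1 one) (3 * clog mu + 9)
          (\<lambda>\<tau>. regs \<tau> x1 = Suc i \<and> regs \<tau> rTrials = L * (64 * 2 ^ clog mu) ^ Suc i)"
      proof (rule run_Seq[OF run_boost[OF r(3)], where ?T2.0 = 1], goal_cases)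
        case (1 \<tau>)
        have "regs \<tau> x1 = i" "regs \<tau> one = 1"
          using frame_regs[OF 1(1)] 2(3) r(1) by (simp_all add: boost_def)
        then show ?case using 1(2) 2(3) by (simp add: run_simps mult_ac)
      qed simp
      then show ?case using 2 r by simp
    next
      case (3 \<sigma>')
      have "regs \<sigma>' rK = k"
        using frame_regs[OF 3(1)] r1 by (simp add: \<sigma>2_def boost_def)
      then show ?case using 3 by simp
    qed (simp add: algebra_simps)
    then show "run \<sigma>1 (Const x1 0 ;; While_Less x1 rK (boost ;; Add x1 x1 one))
        (1 + (k * (3 * clog mu + 10) + 1)) ?Q"
      by (simp add: run_Seq_elementary \<sigma>2_def)
  qed
  then have "run \<sigma>0 (doublings x0 rQ rTrials ;; Const x1 0 ;; While_Less x1 rK (boost ;; Add x1 x1 one))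
      (3 + (3 * L + k * (3 * clog mu + 10))) ?Q"
    by (rule run_mono) simp_all
  moreover have "step (Add x0 rP zero) (step (Const rTrials 0) \<sigma>) = \<sigma>0"
    using assms(1,5) by (simp add: \<sigma>0_def)
  ultimately show ?thesis unfolding count_trials_def by (simp add: run_Seq_elementary del: step.simps)
qed

lemma run_count_bits:
  assumes "regs \<sigma> one = 1" "regs \<sigma> rK = k" "regs \<sigma> rMu = mu"
  shows "run \<sigma> count_bits (3 * clog k + 3 * clog mu + 5)
    (\<lambda>\<tau>. regs \<tau> rB = 1 + clog k + clog mu)"
proof -
  define \<sigma>0 where "\<sigma>0 = \<sigma>\<lparr>regs := (regs \<sigma>)(rB := 1, x0 := 1)\<rparr>"
  let ?Q = "\<lambda>\<tau>. regs \<tau> rB = 1 + clog k + clog mu"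
  have "run \<sigma>0 (doublings x0 rK rB ;; Const x0 1 ;; doublings x0 rMu rB)
      ((3 * clog k + 1) + (1 + (3 * clog mu + 1))) ?Q"
  proof (rule run_Seq[OF _ _ order.refl])
    show "run \<sigma>0 (doublings x0 rK rB) (3 * clog k + 1) (\<lambda>\<tau>. regs \<tau> rB = 1 + clog k)"
      by (rule run_mono[OF run_doublings[where N = "clog k"]])
        (use assms clog_less[of _ k] clog_ge[of k] in \<open>simp_all add: \<sigma>0_def\<close>)
    fix \<sigma>1 assume f1: "frame (doublings x0 rK rB) \<sigma>0 \<sigma>1" and B1: "regs \<sigma>1 rB = 1 + clog k"
    have r1: "regs \<sigma>1 one = 1" "regs \<sigma>1 rMu = mu"
      using frame_regs[OF f1] assms by (simp_all add: \<sigma>0_def doublings_def)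
    define \<sigma>2 where "\<sigma>2 = \<sigma>1\<lparr>regs := (regs \<sigma>1)(x0 := 1)\<rparr>"
    have "run \<sigma>2 (doublings x0 rMu rB) (3 * clog mu + 1) ?Q"
      by (rule run_mono[OF run_doublings[where N = "clog mu"]])
        (use r1 B1 clog_less[of _ mu] clog_ge[of mu] in \<open>simp_all add: \<sigma>2_def\<close>)
    then show "run \<sigma>1 (Const x0 1 ;; doublings x0 rMu rB) (1 + (3 * clog mu + 1)) ?Q"
      by (simp add: run_Seq_elementary \<sigma>2_def)
  qed
  then have "run \<sigma>0 (doublings x0 rK rB ;; Const x0 1 ;; doublings x0 rMu rB)
      (3 + (3 * clog k + 3 * clog mu)) ?Q"
    by (rule run_mono) simp_all
  then show ?thesis unfolding count_bits_def by (simp add: run_Seq_elementary \<sigma>0_def)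
qed

text \<open>The inserted \<open>2\<close> gives a value for \<open>i = 0\<close> and agrees with the
  initial value of \<open>rMu\<close>.\<close>

definition longest :: "nat list list \<Rightarrow> nat \<Rightarrow> nat" where
  "longest fs i = Max (insert 2 ((\<lambda>v. length (fs ! v)) ` {..<i}))"

lemma longest_Suc: "longest fs (Suc i) = max (longest fs i) (length (fs ! i))"
  unfolding longest_def lessThan_Suc by (simp add: insert_commute[of 2] max.commute)

context search_layout
begin

lemma run_scan:
  assumes "regs \<sigma> rN = n" "regs \<sigma> rM = m" "regs \<sigma> zero = 0" "regs \<sigma> one = 1"
    and inp: "input_ok (mem \<sigma>)"
  shows "run \<sigma> scan (7 * n + 6) (\<lambda>\<tau>. regs \<tau> rCol = cols \<and> regs \<tau> rMu = longest fs n)"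
proof -
  define \<sigma>0 where "\<sigma>0 = \<sigma>\<lparr>regs := (regs \<sigma>)(rCol := 7 + m + m, rMu := 2, x0 := 0)\<rparr>"
  have "run \<sigma>0 (While_Less x0 rN
       (Load x1 rCol ;; If_Less rMu x1 (Add rMu x1 zero) Skip ;; Add rCol rCol x1 ;;
        Add rCol rCol one ;; Add x0 x0 one)) (7 * n + 1) (\<lambda>\<tau>. regs \<tau> rCol = cols \<and> regs \<tau> rMu = longest fs n)"
  proof (rule run_While[where N = n and t = 6 and Inv = "\<lambda>i \<tau>. regs \<tau> x0 = i \<and>
      regs \<tau> rCol = fpos i \<and> regs \<tau> rMu = longest fs i"], goal_cases)
    case 1
    then show ?case by (simp add: \<sigma>0_def fpos_def longest_def)
  next
    case (2 i \<sigma>')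
    have r: "regs \<sigma>' rN = n" "regs \<sigma>' zero = 0" "regs \<sigma>' one = 1" and "mem \<sigma>' = mem \<sigma>"
      using frame_regs[OF 2(2)] frame_mem[OF 2(2)] assms by (simp_all add: \<sigma>0_def)
    then have "mem \<sigma>' (fpos i) = length (fs ! i)" using inp 2(1) by (simp add: input_ok_def)
    with 2 r show ?case by (simp add: run_simps longest_Suc fpos_Suc)
  next
    case (3 \<sigma>')
    have "regs \<sigma>' rN = n" using frame_regs[OF 3(1)] assms by (simp add: \<sigma>0_def)
    with 3 show ?case by (simp add: cols_def)
  qed simp
  then show ?thesis unfolding scan_def using assms by (simp add: run_Seq_elementary \<sigma>0_def)
qed

lemma run_lay_out:
  assumes r: "regs \<sigma> rN = n" "regs \<sigma> rM = m" "regs \<sigma> rSrc = src" "regs \<sigma> rDst = dst"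
    "regs \<sigma> zero = 0" "regs \<sigma> one = 1" "regs \<sigma> rK = k" "regs \<sigma> rCol = cols" "regs \<sigma> rB = B"
    and inp: "input_ok (mem \<sigma>)"
  shows "run \<sigma> lay_out (4 * k + 9) (\<lambda>\<tau>. layout_regs \<tau> \<and> static (mem \<tau>))"
proof -
  define \<sigma>0 where "\<sigma>0 = \<sigma>\<lparr>regs := (regs \<sigma>)
    (rRed := k - 1, rOff := offs, rBit := bits, rTab := tab, x0 := offs, x1 := n)\<rparr>"
  let ?body = "Store x0 x1 ;; Add x1 x1 x1 ;; Add x0 x0 one"
  have "run \<sigma>0 (While_Less x0 rBit ?body ;; Sub rSize rBit one ;; Load rSize rSize)
      ((4 * k + 1) + 2) (\<lambda>\<tau>. layout_regs \<tau> \<and> static (mem \<tau>))"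
  proof (rule run_Seq[OF _ _ order.refl])
    show "run \<sigma>0 (While_Less x0 rBit ?body) (4 * k + 1)
        (\<lambda>\<tau>. (\<forall>c<k. mem \<tau> (offs + c) = n * 2 ^ c) \<and> (\<forall>a<offs. mem \<tau> a = mem \<sigma> a))"
    proof (rule run_While[where N = k and t = 3 and Inv = "\<lambda>i \<tau>. regs \<tau> x0 = offs + i \<and>
        regs \<tau> x1 = n * 2 ^ i \<and> (\<forall>c<i. mem \<tau> (offs + c) = n * 2 ^ c) \<and>
        (\<forall>a<offs. mem \<tau> a = mem \<sigma> a)"], goal_cases)
      case 1
      then show ?case by (simp add: \<sigma>0_def)
    next
      case (2 i \<sigma>')
      have "regs \<sigma>' rBit = bits" "regs \<sigma>' one = 1"
        using frame_regs[OF 2(2)] r by (simp_all add: \<sigma>0_def)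
      with 2 show ?case by (auto simp: run_simps bits_def less_Suc_eq)
    next
      case (3 \<sigma>')
      have "regs \<sigma>' rBit = bits" using frame_regs[OF 3(1)] r by (simp add: \<sigma>0_def)
      with 3 show ?case by (simp add: bits_def)
    qed simp
    fix \<sigma>1
    assume f1: "frame (While_Less x0 rBit ?body) \<sigma>0 \<sigma>1"
      and q1: "(\<forall>c<k. mem \<sigma>1 (offs + c) = n * 2 ^ c) \<and> (\<forall>a<offs. mem \<sigma>1 a = mem \<sigma> a)"
    note fr = frame_regs[OF f1]
    have r1: "regs \<sigma>1 rN = n" "regs \<sigma>1 rM = m" "regs \<sigma>1 rSrc = src" "regs \<sigma>1 rDst = dst"
      "regs \<sigma>1 zero = 0" "regs \<sigma>1 one = 1" "regs \<sigma>1 rCol = cols" "regs \<sigma>1 rB = B"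
      "regs \<sigma>1 rRed = k - 1" "regs \<sigma>1 rOff = offs" "regs \<sigma>1 rBit = bits" "regs \<sigma>1 rTab = tab"
      using fr r by (simp_all add: \<sigma>0_def)
    have "bits - Suc 0 = offs + (k - 1)" using k_pos by (simp add: bits_def)
    moreover have "mem \<sigma>1 (offs + (k - 1)) = n * 2 ^ (k - 1)" using q1 k_pos by (metis diff_less zero_less_one)
    moreover have "input_ok (mem \<sigma>1)"
      by (rule input_ok_cong[OF _ inp]) (use q1 in \<open>simp add: offs_def\<close>)
    ultimately show "run \<sigma>1 (Sub rSize rBit one ;; Load rSize rSize) 2
        (\<lambda>\<tau>. layout_regs \<tau> \<and> static (mem \<tau>))"
      using r1 q1 by (simp add: run_simps layout_regs_def static_def)
  qed
  then have "run \<sigma>0 (While_Less x0 rBit ?body ;; Sub rSize rBit one ;; Load rSize rSize)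
      (3 + 4 * k) (\<lambda>\<tau>. layout_regs \<tau> \<and> static (mem \<tau>))"
    by (rule run_mono) simp_all
  then show ?thesis
    unfolding lay_out_def using r
    by (simp add: run_Seq_elementary \<sigma>0_def offs_def bits_def tab_def)
qed

end

section \<open>The complete solver and its cost\<close>

definition solver :: program where
  "solver = header ;; scan ;; count_bits ;; count_trials ;; lay_out ;; While_Less zero rTrials trial"

context search_layout
begin

definition "total_cost L = 55 + 7 * n + 3 * clog k + 3 * clog mu + 3 * L + k * (3 * clog mu + 10) + 4 * k +
  L * (64 * 2 ^ clog mu) ^ k * (trial_cost + 1)"

lemma run_solver:
  assumes mu: "mu = longest fs n" and B: "B = 1 + clog k + clog mu"
    and head: "mem \<sigma> 0 = n" "mem \<sigma> 1 = m" "mem \<sigma> 2 = src" "mem \<sigma> 3 = dst" "mem \<sigma> 4 = k"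
      "mem \<sigma> 5 = p" "mem \<sigma> 6 = q"
    and inp: "input_ok (mem \<sigma>)" and ans: "regs \<sigma> 0 = 0"
    and L: "\<And>i. i < L \<Longrightarrow> p * 2 ^ i < q" "q \<le> p * 2 ^ L"
  shows "run \<sigma> solver (total_cost L) (\<lambda>\<tau>. regs \<tau> 0 \<noteq> 0 \<longleftrightarrow>
    (\<exists>r<L * (64 * 2 ^ clog mu) ^ k. success_with (colour B (sdrop (r * (m * B)) (coins \<sigma>)))))"
    (is "run _ _ _ ?Q")
proof -
  define T where "T i = [16, 7 * n + 6, 3 * clog k + 3 * clog mu + 5, 3 * L + k * (3 * clog mu + 10) + 5,
    4 * k + 9, L * (64 * 2 ^ clog mu) ^ k * (trial_cost + 1) + 1] ! i" for i
  have "run \<sigma> solver (T 0 + (T 1 + (T 2 + (T 3 + (T 4 + T 5))))) ?Q"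
    unfolding solver_def
  proof (rule run_Seq[OF _ _ order.refl])
    show "run \<sigma> header (T 0) (\<lambda>\<tau>. regs \<tau> rN = n \<and> regs \<tau> rM = m \<and> regs \<tau> rSrc = src \<and>
        regs \<tau> rDst = dst \<and> regs \<tau> rK = k \<and> regs \<tau> rP = p \<and> regs \<tau> rQ = q \<and> regs \<tau> zero = 0 \<and>
        regs \<tau> one = 1)"
      using head by (simp add: header_def fetch_def run_simps T_def)
    fix \<sigma>1
    assume f1: "frame header \<sigma> \<sigma>1" and q1: "regs \<sigma>1 rN = n \<and> regs \<sigma>1 rM = m \<and> regs \<sigma>1 rSrc = src \<and>
        regs \<sigma>1 rDst = dst \<and> regs \<sigma>1 rK = k \<and> regs \<sigma>1 rP = p \<and> regs \<sigma>1 rQ = q \<and> regs \<sigma>1 zero = 0 \<and>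
        regs \<sigma>1 one = 1"
    have e1: "mem \<sigma>1 = mem \<sigma>" "coins \<sigma>1 = coins \<sigma>" "regs \<sigma>1 0 = 0"
      using frame_mem[OF f1] frame_coins[OF f1] frame_regs[OF f1, of 0] ans
      by (simp_all add: header_def fetch_def)
    show "run \<sigma>1 (scan ;; count_bits ;; count_trials ;; lay_out ;; While_Less zero rTrials trial)
        (T 1 + (T 2 + (T 3 + (T 4 + T 5)))) ?Q"
    proof (rule run_Seq[OF _ _ order.refl])
      show "run \<sigma>1 scan (T 1) (\<lambda>\<tau>. regs \<tau> rCol = cols \<and> regs \<tau> rMu = mu)"
        unfolding mu using run_scan[of \<sigma>1] q1 inp e1 by (simp add: T_def)
      fix \<sigma>2
      assume f2: "frame scan \<sigma>1 \<sigma>2" and q2: "regs \<sigma>2 rCol = cols \<and> regs \<sigma>2 rMu = mu"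
      have r2: "regs \<sigma>2 rN = n" "regs \<sigma>2 rM = m" "regs \<sigma>2 rSrc = src"
        "regs \<sigma>2 rDst = dst" "regs \<sigma>2 rK = k" "regs \<sigma>2 rP = p" "regs \<sigma>2 rQ = q" "regs \<sigma>2 zero = 0"
        "regs \<sigma>2 one = 1" "regs \<sigma>2 0 = 0"
        using frame_regs[OF f2] q1 e1 by (simp_all add: scan_def)
      have e2: "mem \<sigma>2 = mem \<sigma>" "coins \<sigma>2 = coins \<sigma>"
        using frame_mem[OF f2] frame_coins[OF f2] e1 by (simp_all add: scan_def)
      show "run \<sigma>2 (count_bits ;; count_trials ;; lay_out ;; While_Less zero rTrials trial)
          (T 2 + (T 3 + (T 4 + T 5))) ?Q"
      proof (rule run_Seq[OF _ _ order.refl])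
        show "run \<sigma>2 count_bits (T 2) (\<lambda>\<tau>. regs \<tau> rB = B)"
          unfolding B using run_count_bits[of \<sigma>2 k mu] q2 r2 by (simp add: T_def)
        fix \<sigma>3
        assume f3: "frame count_bits \<sigma>2 \<sigma>3" and q3: "regs \<sigma>3 rB = B"
        have r3: "regs \<sigma>3 rN = n" "regs \<sigma>3 rM = m" "regs \<sigma>3 rSrc = src"
          "regs \<sigma>3 rDst = dst" "regs \<sigma>3 rK = k" "regs \<sigma>3 rP = p" "regs \<sigma>3 rQ = q" "regs \<sigma>3 zero = 0"
          "regs \<sigma>3 one = 1" "regs \<sigma>3 0 = 0" "regs \<sigma>3 rCol = cols" "regs \<sigma>3 rMu = mu"
          using frame_regs[OF f3] r2 q2 by (simp_all add: count_bits_def doublings_def)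
        have e3: "mem \<sigma>3 = mem \<sigma>" "coins \<sigma>3 = coins \<sigma>"
          using frame_mem[OF f3] frame_coins[OF f3] e2 by (simp_all add: count_bits_def doublings_def)
        show "run \<sigma>3 (count_trials ;; lay_out ;; While_Less zero rTrials trial)
            (T 3 + (T 4 + T 5)) ?Q"
        proof (rule run_Seq[OF _ _ order.refl])
          show "run \<sigma>3 count_trials (T 3) (\<lambda>\<tau>. regs \<tau> rTrials = L * (64 * 2 ^ clog mu) ^ k)"
            using run_count_trials[of \<sigma>3 k mu p q L] r3 L by (simp add: T_def)
          fix \<sigma>4
          assume f4: "frame count_trials \<sigma>3 \<sigma>4" and q4: "regs \<sigma>4 rTrials = L * (64 * 2 ^ clog mu) ^ k"
          have r4: "regs \<sigma>4 rN = n" "regs \<sigma>4 rM = m" "regs \<sigma>4 rSrc = src"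
            "regs \<sigma>4 rDst = dst" "regs \<sigma>4 zero = 0" "regs \<sigma>4 one = 1" "regs \<sigma>4 rK = k"
            "regs \<sigma>4 rCol = cols" "regs \<sigma>4 rB = B" "regs \<sigma>4 0 = 0"
            using frame_regs[OF f4] r3 q3 by (simp_all add: count_trials_def doublings_def boost_def)
          have e4: "mem \<sigma>4 = mem \<sigma>" "coins \<sigma>4 = coins \<sigma>"
            using frame_mem[OF f4] frame_coins[OF f4] e3
            by (simp_all add: count_trials_def doublings_def boost_def)
          show "run \<sigma>4 (lay_out ;; While_Less zero rTrials trial) (T 4 + T 5) ?Q"
          proof (rule run_Seq[OF _ _ order.refl])
            show "run \<sigma>4 lay_out (T 4) (\<lambda>\<tau>. layout_regs \<tau> \<and> static (mem \<tau>))"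
              using run_lay_out[OF r4(1-9)] inp e4 by (simp add: T_def)
            fix \<sigma>5
            assume f5: "frame lay_out \<sigma>4 \<sigma>5" and q5: "layout_regs \<sigma>5 \<and> static (mem \<sigma>5)"
            have "regs \<sigma>5 rTrials = L * (64 * 2 ^ clog mu) ^ k" "regs \<sigma>5 0 = 0" "coins \<sigma>5 = coins \<sigma>"
              using frame_regs[OF f5] frame_coins[OF f5] q4 r4 e4 by (simp_all add: lay_out_def)
            then show "run \<sigma>5 (While_Less zero rTrials trial) (T 5) ?Q"
              using run_trials[of \<sigma>5 "L * (64 * 2 ^ clog mu) ^ k"] q5 by (simp add: T_def)
          qed
        qed
      qed
    qed
  qed
  then show ?thesis by (rule run_mono) (simp_all add: T_def total_cost_def)
qed

text \<open>Because of \<open>2 \<le> mu\<close> and \<open>0 < k\<close>, the number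
  \<open>X = mu ^ k\<close> dominates \<open>k\<close>, \<open>mu\<close>,
  \<open>2 ^ (k - 1)\<close> and the logarithms. One trial costs a constant times
  \<open>N * X ^ 2\<close>, there are at most \<open>L * X ^ 8\<close> trials, and the remaining
  constant \<open>192\<close> is below \<open>2 ^ 8 \<le> X ^ 8\<close>; this gives
  \<open>X ^ 18\<close>.\<close>

lemma total_cost_le:
  assumes "2 \<le> mu" "0 < L" "B = 1 + clog k + clog mu"
  shows "total_cost L \<le> L * (n + m) * mu ^ (18 * k)"
proof -
  define X where "X = mu ^ k"
  define N where "N = n + m"
  define U where "U = L * N * X ^ 2"
  have N: "n \<le> N" "m \<le> N" "1 \<le> N" using n_pos by (auto simp: N_def)
  have "2 ^ k \<le> X" unfolding X_def using assms(1) by (rule power_mono) simp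
  moreover have "(2 :: nat) ^ (k - 1) \<le> 2 ^ k" by (rule power_increasing) simp_all
  moreover have "k < 2 ^ k" by (rule less_exp)
  ultimately have k: "2 ^ (k - 1) \<le> X" "k \<le> X" by linarith+
  have mu: "mu \<le> X" unfolding X_def using assms(1) k_pos by (intro self_le_power) auto
  have X: "1 \<le> X" using mu assms(1) by simp
  have NX: "N \<le> N * X" "X \<le> N * X" "1 \<le> N * X" using X N by simp_all
  have cl: "clog k \<le> X" "clog mu \<le> X" using clog_le[of k] clog_le[of mu] k mu by simp_all
  have "m * (5 * B + 6) \<le> N * (21 * X)"
    using N cl X by (intro mult_mono) (simp_all add: assms(3))
  then have c1: "m * (5 * B + 6) \<le> 21 * (N * X)" by simp
  have "n * (10 * mu + 6) \<le> N * (16 * X)" using N mu X by (intro mult_mono) simp_all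
  then have "n * (10 * mu + 6) \<le> 16 * (N * X)" by (simp add: mult_ac)
  then have c2: "set_cost + 1 \<le> 77 * (N * X)"
    unfolding set_cost_def using k N NX by linarith
  have "2 ^ (k - 1) * (set_cost + 1) \<le> X * (77 * (N * X))"
    using k(1) c2 by (intro mult_mono) simp_all
  then have c3: "2 ^ (k - 1) * (set_cost + 1) \<le> 77 * (N * X ^ 2)"
    by (simp add: power2_eq_square mult_ac)
  have NX2: "N * X \<le> N * X ^ 2" "1 \<le> N * X ^ 2" using X N by (simp_all add: power2_eq_square)
  have c4: "trial_cost + 1 \<le> 104 * (N * X ^ 2)"
    unfolding trial_cost_def using c1 c3 NX2 by linarith
  \<comment> \<open>Rounding in \<open>clog\<close> costs a factor \<open>2\<close>, and
    \<open>128 = 2 ^ 7\<close> is at most \<open>mu ^ 7\<close>.\<close>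
  have "64 * 2 ^ clog mu \<le> 128 * mu" using clog_upper[of mu] assms(1) by simp
  also have "\<dots> \<le> mu ^ 7 * mu" using power_mono[OF assms(1), of 7] by (intro mult_right_mono) simp_all
  finally have "64 * 2 ^ clog mu \<le> mu ^ 8" by (simp add: power_Suc2[symmetric] del: power_Suc2)
  then have "(64 * 2 ^ clog mu) ^ k \<le> (mu ^ 8) ^ k" by (rule power_mono) simp
  then have c5: "(64 * 2 ^ clog mu) ^ k \<le> X ^ 8" by (simp add: X_def power_mult[symmetric] mult.commute)
  have "L * (64 * 2 ^ clog mu) ^ k * (trial_cost + 1) \<le> L * X ^ 8 * (104 * (N * X ^ 2))"
    using c4 c5 by (intro mult_mono) simp_all
  also have "\<dots> = 104 * (U * X ^ 8)" by (simp add: U_def mult_ac)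
  finally have c6: "L * (64 * 2 ^ clog mu) ^ k * (trial_cost + 1) \<le> 104 * (U * X ^ 8)" .
  have U: "L \<le> U" "N \<le> U" "X \<le> U" "X * X \<le> U" "1 \<le> U"
  proof -
    have L: "1 \<le> L" using assms(2) by simp
    have "1 * (1 * X ^ 2) \<le> L * (N * X ^ 2)" using L N by (intro mult_mono) simp_all
    then show XX: "X * X \<le> U" by (simp add: U_def power2_eq_square mult_ac)
    show "X \<le> U" using XX X by (meson le_trans le_square)
    then show "1 \<le> U" using X by simp
    show "L \<le> U" "N \<le> U" using L N X by (simp_all add: U_def)
  qed
  have "k * (3 * clog mu + 10) \<le> X * (13 * X)" using k cl X by (intro mult_mono) simp_all
  also have "\<dots> \<le> 13 * U" using U(4) by simp
  finally have "total_cost L \<le> 55 * U + 7 * U + 3 * U + 3 * U + 3 * U + 13 * U + 4 * U + 104 * (U * X ^ 8)"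
    unfolding total_cost_def using c6 N k cl U by linarith
  also have "\<dots> \<le> 192 * (U * X ^ 8)" using X U(5) by simp
  also have "\<dots> \<le> X ^ 8 * (U * X ^ 8)"
  proof (rule mult_right_mono)
    have "2 ^ 8 \<le> X ^ 8" using assms(1) mu by (intro power_mono) simp_all
    then show "192 \<le> X ^ 8" by simp
  qed simp
  also have "\<dots> = L * N * X ^ 18" by (simp add: U_def mult_ac flip: power_add)
  also have "X ^ 18 = mu ^ (18 * k)" by (simp add: X_def power_mult[symmetric] mult.commute)
  finally show ?thesis by (simp add: N_def)
qed

text \<open>The claim \<open>v < n\<close> is proved along with the transfer, since
  \<open>fs_less\<close> confines the forbidden edge numbers to those below \<open>m\<close> only
  for actual vertices.\<close>

lemma reach_cong:
  assumes eq: "\<And>e. e < m \<Longrightarrow> col e = col' e"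
    and "coloured_search.reach ends fs src K col S v"
  shows "v < n \<and> coloured_search.reach ends fs src K col' S v"
proof -
  have al: "coloured_search.allowed fs K col S v \<Longrightarrow> coloured_search.allowed fs K col' S v"
    if "v < n" for S v
    using eq fs_less[OF that] by (fastforce simp: coloured_search.allowed_def m_def)
  interpret coloured_search ends fs src K col .
  from assms(2) show ?thesis
  proof (induction rule: reach.induct)
    case start
    then show ?case using al src_less coloured_search.reach.start by simp
  next
    case (extend S x e y)
    have "(x, y) \<in> set ends \<or> (y, x) \<in> set ends"
      using extend.hyps(3) nth_mem[OF extend.hyps(2)] by (elim disjE) simp_all
    then have "y < n" using ends_less by blast
    moreover have "col e = col' e" using eq extend.hyps(2) by (simp add: m_def)
    ultimately show ?case
      using extend al coloured_search.reach.extend[of ends fs src K col' S x e y] by simp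
  qed
qed

lemma success_with_cong:
  assumes "\<And>e. e < m \<Longrightarrow> col e = col' e"
  shows "success_with col \<longleftrightarrow> success_with col'"
  using reach_cong[of col col'] reach_cong[of col' col] assms unfolding success_with_def by metis

end

section \<open>Reading the encoded instance\<close>

lemma concat_nth:
  "v < length xss \<Longrightarrow> i < length (xss ! v) \<Longrightarrow>
   concat xss ! (length (concat (take v xss)) + i) = xss ! v ! i \<and>
   length (concat (take v xss)) + i < length (concat xss)"
proof -
  assume v: "v < length xss" and i: "i < length (xss ! v)"
  have "concat xss = concat (take v xss) @ xss ! v @ concat (drop (Suc v) xss)"
    by (subst id_take_nth_drop[OF v]) simp
  then show ?thesis using i by (simp add: nth_append)
qed

lemma length_concat_pairs: "length (concat (map (\<lambda>(a, b). [a, b]) xs)) = 2 * length xs"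
  by (induction xs) auto

lemma length_concat_lists:
  "v \<le> length fs \<Longrightarrow> length (concat (take v (map (\<lambda>ls. length ls # ls) fs))) = (\<Sum>u<v. Suc (length (fs ! u)))"
  by (induction v) (simp_all add: take_Suc_conv_app_nth)

lemma (in search_layout) input_ok_initial:
  assumes ws: "ws = [h0, h1, h2, h3, h4, h5, h6] @ concat (map (\<lambda>(a, b). [a, b]) ends) @
      concat (map (\<lambda>ls. length ls # ls) fs)"
  shows "input_ok (mem (initial_state ws \<omega>))"
proof -
  let ?M = "mem (initial_state ws \<omega>)"
  let ?ps = "map (\<lambda>(a, b). [a, b]) ends" and ?ls = "map (\<lambda>ls. length ls # ls) fs"
  have M: "?M a = ws ! a" if "a < length ws" for a using that by (simp add: initial_state_def)
  have len: "length ws = 7 + 2 * m + length (concat ?ls)"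
    by (simp add: ws length_concat_pairs m_def)
  have shift: "ws ! (7 + a) = (concat ?ps @ concat ?ls) ! a" for a
    unfolding ws by (simp add: nth_append)
  show ?thesis
    unfolding input_ok_def
  proof (intro conjI allI impI)
    fix e assume e: "e < m"
    obtain x y where xy: "ends ! e = (x, y)" by fastforce
    have t: "length (concat (take e ?ps)) = 2 * e"
      using e length_concat_pairs[of "take e ends"] by (simp add: take_map m_def)
    have c: "concat ?ps ! (2 * e + i) = [x, y] ! i \<and> 2 * e + i < 2 * m" if "i < 2" for i
      using concat_nth[of e ?ps i] e that xy unfolding t by (simp add: m_def length_concat_pairs)
    have w: "?M (7 + (2 * e + i)) = [x, y] ! i" if "i < 2" for i
      using c[OF that] M[of "7 + (2 * e + i)"] len shift[of "2 * e + i"]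
      by (simp add: nth_append length_concat_pairs m_def)
    show "?M (7 + 2 * e) = fst (ends ! e)" "?M (Suc (7 + 2 * e)) = snd (ends ! e)"
      using w[of 0] w[of 1] xy by simp_all
  next
    fix v assume v: "v < n"
    have t: "length (concat (take v ?ls)) = (\<Sum>u<v. Suc (length (fs ! u)))"
      using length_concat_lists[of v fs] v length_fs by simp
    have w: "?M (fpos v + i) = (length (fs ! v) # fs ! v) ! i" if "i < Suc (length (fs ! v))" for i
    proof -
      have c: "concat ?ls ! ((\<Sum>u<v. Suc (length (fs ! u))) + i) = (length (fs ! v) # fs ! v) ! i \<and>
          (\<Sum>u<v. Suc (length (fs ! u))) + i < length (concat ?ls)"
        using concat_nth[of v ?ls i] v that length_fs unfolding t by simp
      have eq: "fpos v + i = 7 + (2 * m + ((\<Sum>u<v. Suc (length (fs ! u))) + i))"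
        by (simp add: fpos_def)
      show ?thesis
        unfolding eq using c M[of "7 + (2 * m + ((\<Sum>u<v. Suc (length (fs ! u))) + i))"] len shift[of "2 * m + ((\<Sum>u<v. Suc (length (fs ! u))) + i)"]
        by (simp add: nth_append length_concat_pairs m_def)
    qed
    show "?M (fpos v) = length (fs ! v)" using w[of 0] by simp
    fix i assume "i < length (fs ! v)"
    then show "?M (Suc (fpos v + i)) = fs ! v ! i" using w[of "Suc i"] by simp
  qed
qed

text \<open>The hypothesis at \<open>L - 1\<close> gives \<open>2 ^ (L - 1) < q / p\<close>, and
  \<open>ln 2\<close> is at least \<open>1 / 2\<close>. The number \<open>L\<close> can be
  \<open>1\<close> while the logarithm is close to \<open>0\<close>, which is why
  \<open>max 1\<close> occurs.\<close>

lemma log_trials: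
  assumes "0 < p" "p < q" and L: "\<And>i. i < L \<Longrightarrow> p * 2 ^ i < q"
  shows "real L \<le> 4 * max 1 (ln (1 / (real p / real q)))"
proof (cases "L = 0")
  case False
  then have "p * 2 ^ (L - 1) < q" by (intro L) simp
  then have "real (p * 2 ^ (L - 1)) < real q" by (simp only: of_nat_less_iff)
  then have lt: "2 ^ (L - 1) < real q / real p" using assms(1) by (simp add: field_simps)
  have "real (L - 1) * ln 2 = ln (2 ^ (L - 1))" by (simp add: ln_realpow)
  also have "\<dots> \<le> ln (real q / real p)" using lt assms(1,2) by (subst ln_le_cancel_iff) auto
  finally have "real (L - 1) * ln 2 \<le> ln (real q / real p)" .
  moreover have "real (L - 1) * (1 / 2) \<le> real (L - 1) * ln 2"
    using ln2_ge_two_thirds by (intro mult_left_mono) auto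
  ultimately have "real L \<le> 1 + 2 * ln (real q / real p)" using False by (simp add: of_nat_diff)
  then show ?thesis by simp
qed simp

text \<open>The lists have distinct entries and the numbering of edges is injective, so the lengths
  of the lists are the cardinalities of the sets \<open>f v\<close>.\<close>

lemma (in encoded_instance) max_deletion_eq:
  "max (max_deletion V f) 2 = longest fs (length vs)"
proof -
  have "card (f (vs ! l)) = length (fs ! l)" if "l < length vs" for l
  proof -
    have "card ((!) es ` set (fs ! l)) = card (set (fs ! l))"
      using es_inj fs[OF that] by (intro card_image) (auto simp: inj_on_def subset_iff)
    then show ?thesis using fs[OF that] distinct_card[of "fs ! l"] by simp
  qed
  then have "(\<lambda>v. card (f v)) ` V = (\<lambda>l. length (fs ! l)) ` {..<length vs}"
    unfolding vs(2)[symmetric] set_conv_nth by (force simp: image_iff)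
  moreover have "(\<lambda>l. length (fs ! l)) ` {..<length vs} \<noteq> {}" using src(1) by auto
  ultimately show ?thesis
    by (simp add: max_deletion_def longest_def Max_insert max.commute)
qed

lemma length_le_longest: "v < n \<Longrightarrow> length (fs ! v) \<le> longest fs n"
  unfolding longest_def by (intro Max_ge) auto

lemma two_le_longest: "2 \<le> longest fs n"
  unfolding longest_def by (intro Max_ge) auto

text \<open>Halting, running time and soundness are established for each coin sequence separately;
  probability enters only for yes-instances. The constant \<open>20\<close> combines the
  \<open>18\<close> of \<open>total_cost_le\<close> with \<open>2\<close> that absorb the factor
  \<open>4\<close> of \<open>log_trials\<close> into \<open>mu ^ (2 * k)\<close>.\<close>

theorem theorem23:
  shows "\<exists>(P :: program) (C :: real).
    \<forall>(V :: nat set) E f s t (k :: nat) (p :: nat) (q :: nat) ws.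
      self_deleting_graph V E f \<longrightarrow> s \<in> V \<longrightarrow> t \<in> V \<longrightarrow> 0 < k \<longrightarrow>
      0 < p \<longrightarrow> p < q \<longrightarrow> encodes V E f s t k p q ws \<longrightarrow>
      (let \<epsilon> = real p / real q;
           \<mu> = real (max (max_deletion V f) 2)
       in (\<forall>\<omega>. \<exists>T ans. halts_with P ws \<omega> T ans \<and>
               real T \<le> 2 powr (C * real k * log 2 \<mu>) * real (card V + card E)
                          * max 1 (ln (1 / \<epsilon>))) \<and>
          (\<not> short_conforming_path_exists V E f s t k \<longrightarrow> (\<forall>\<omega>. outputs P ws \<omega> False)) \<and>
          (short_conforming_path_exists V E f s t k \<longrightarrow>
             1 - \<epsilon> \<le> measure coin_space {\<omega> \<in> space coin_space. outputs P ws \<omega> True}))"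
proof (intro exI[of _ solver] exI[of _ 20] allI impI, goal_cases)
  case (1 V E f s t k p q ws)
  then obtain vs es ends fs i j where enc:
    "distinct vs" "set vs = V" "distinct es" "set es = E"
    "\<forall>(a, b)\<in>set ends. a < length vs \<and> b < length vs"
    "es = map (\<lambda>(a, b). {vs ! a, vs ! b}) ends"
    "length fs = length vs"
    "\<forall>l<length vs. distinct (fs ! l) \<and> set (fs ! l) \<subseteq> {..<length es} \<and>
                        (\<lambda>e. es ! e) ` set (fs ! l) = f (vs ! l)"
    "i < length vs" "vs ! i = s" "j < length vs" "vs ! j = t"
    "ws = [length vs, length es, i, j, k, p, q] @
             concat (map (\<lambda>(a, b). [a, b]) ends) @
             concat (map (\<lambda>ls. length ls # ls) fs)"
    unfolding encodes_def by (elim exE conjE)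
  define n where "n = length vs"
  define mu where "mu = longest fs n"
  define B where "B = 1 + clog k + clog mu"
  interpret encoded_instance V E f s t vs es ends fs i j
    by unfold_locales (use enc in auto)
  interpret search_layout n k B mu i j ends fs
  proof unfold_locales
    show "0 < n" "i < n" "j < n" "length fs = n" using enc by (auto simp: n_def)
    show "0 < k" by fact
    show "a < n \<and> b < n" if "(a, b) \<in> set ends" for a b using enc(5) that by (auto simp: n_def)
    show "set (fs ! v) \<subseteq> {..<length ends}" if "v < n" for v
      using enc(8) that by (simp add: n_def length_ends)
    show "length (fs ! v) \<le> mu" if "v < n" for v
      unfolding mu_def using that by (rule length_le_longest)
  qed
  have mn: "m = length es" by (simp add: m_def length_ends)
  have mu: "max (max_deletion V f) 2 = mu" by (simp add: max_deletion_eq mu_def n_def)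
  have mu2: "2 \<le> mu" unfolding mu_def by (rule two_le_longest)
  define L where "L = (LEAST i. q \<le> p * 2 ^ i)"
  have L_ge: "q \<le> p * 2 ^ L"
    unfolding L_def
  proof (rule LeastI[of _ q])
    have "q \<le> 1 * 2 ^ q" by (simp add: less_imp_le)
    also have "\<dots> \<le> p * 2 ^ q" using \<open>0 < p\<close> by (intro mult_right_mono) auto
    finally show "q \<le> p * 2 ^ q" .
  qed
  have L_less: "p * 2 ^ i < q" if "i < L" for i
    using not_less_Least[OF that[unfolded L_def]] by simp
  have L_pos: "0 < L" using L_ge \<open>p < q\<close> by (cases L) auto
  define y where "y = (2 :: nat) ^ clog mu"
  define R where "R = L * (64 * y) ^ k"
  let ?hit = "\<lambda>\<omega>. \<exists>r<R. success_with (colour B (sdrop (r * (m * B)) \<omega>))"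
  have exec: "run (initial_state ws \<omega>) solver (total_cost L) (\<lambda>\<tau>. regs \<tau> 0 \<noteq> 0 \<longleftrightarrow> ?hit \<omega>)" for \<omega>
    unfolding R_def y_def
  proof (rule run_mono[OF run_solver[OF mu_def B_def, where p = p and q = q and L = L]])
    show "input_ok (mem (initial_state ws \<omega>))" using enc(13) by (rule input_ok_initial)
  qed (use enc(13) L_less L_ge in \<open>simp_all add: initial_state_def n_def mn\<close>)
  \<comment> \<open>Determinism of \<open>exec\<close> turns the one execution found into a
    characterization of both possible answers.\<close>
  have outputs: "outputs solver ws \<omega> ans \<longleftrightarrow> ans = ?hit \<omega>" for \<omega> ans
    using exec[of \<omega>] unfolding run_def outputs_def halts_with_def by (metis exec_deterministic)
  have halts: "\<exists>T ans. halts_with solver ws \<omega> T ans \<and> real T \<le> real (total_cost L)" for \<omega>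
    using exec[of \<omega>] unfolding run_def halts_with_def of_nat_le_iff by blast
  have "real (total_cost L) \<le> 2 powr (20 * real k * log 2 (real mu)) * real (card V + card E)
      * max 1 (ln (1 / (real p / real q)))"
  proof -
    have "card V + card E = n + m" using enc(1-4) distinct_card by (metis n_def mn)
    have pow: "2 powr (20 * real k * log 2 (real mu)) = real mu ^ (20 * k)"
    proof -
      have "2 powr (20 * real k * log 2 (real mu)) = (2 powr log 2 (real mu)) powr (20 * real k)"
        by (simp add: powr_powr mult_ac)
      also have "\<dots> = real mu powr real (20 * k)" using mu2 by simp
      also have "\<dots> = real mu ^ (20 * k)" using mu2 by (subst powr_realpow) auto
      finally show ?thesis .
    qed
    have "real (total_cost L) \<le> real (L * (n + m) * mu ^ (18 * k))"
      using total_cost_le[OF mu2 L_pos B_def] by (simp only: of_nat_le_iff)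
    also have "\<dots> = real L * (real (n + m) * real mu ^ (18 * k))" by (simp add: mult_ac)
    also have "\<dots> \<le> (4 * max 1 (ln (1 / (real p / real q)))) * (real (n + m) * real mu ^ (18 * k))"
      using log_trials[OF \<open>0 < p\<close> \<open>p < q\<close> L_less] by (intro mult_right_mono) auto
    also have "\<dots> = 4 * (real mu ^ (18 * k) * real (n + m) * max 1 (ln (1 / (real p / real q))))"
      by (simp add: mult_ac)
    also have "\<dots> \<le> real mu ^ (2 * k) * (real mu ^ (18 * k) * real (n + m) * max 1 (ln (1 / (real p / real q))))"
    proof (rule mult_right_mono)
      have "(2 :: real) ^ 2 \<le> 2 ^ (2 * k)" using \<open>0 < k\<close> by (intro power_increasing) auto
      also have "\<dots> \<le> real mu ^ (2 * k)" using mu2 by (intro power_mono) auto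
      finally show "4 \<le> real mu ^ (2 * k)" by simp
    qed simp
    also have "\<dots> = real mu ^ (20 * k) * real (n + m) * max 1 (ln (1 / (real p / real q)))"
      by (simp flip: power_add mult.assoc)
    finally show ?thesis using pow \<open>card V + card E = n + m\<close> by simp
  qed
  note time = order.trans[OF _ this]
  have in_time: "\<exists>T ans. halts_with solver ws \<omega> T ans \<and> real T \<le> 2 powr (20 * real k * log 2 (real mu)) *
      real (card V + card E) * max 1 (ln (1 / (real p / real q)))" for \<omega>
    using halts[of \<omega>] time by (elim exE conjE) (intro exI conjI)
  have no: "outputs solver ws \<omega> False" if "\<not> short_conforming_path_exists V E f s t k" for \<omega>
    unfolding outputs success_with_def using that reach_sound \<open>0 < k\<close> by blast
  have yes: "1 - real p / real q \<le> measure coin_space {\<omega> \<in> space coin_space. outputs solver ws \<omega> True}"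
    if yes: "short_conforming_path_exists V E f s t k"
  proof -
    have cong: "success_with (colour B \<omega>) \<longleftrightarrow> success_with (colour B \<omega>')"
      if "stake (m * B) \<omega> = stake (m * B) \<omega>'" for \<omega> \<omega>'
      by (rule success_with_cong) (rule stake_colour_cong[OF that])
    define \<delta> where "\<delta> = measure coin_space {\<omega>. success_with (colour B \<omega>)}"
    have len: "length (fs ! l) \<le> mu" if "l < length vs" for l
      using fs_length that by (simp add: n_def)
    obtain P F where PF: "P \<subseteq> {..<length es}"
      "F \<subseteq> {..<length es}" "P \<inter> F = {}" "card P \<le> k - 1" "card F \<le> k * mu"
      and succ: "\<And>col K. inj_on col P \<Longrightarrow> col ` P \<subseteq> {..<K} \<Longrightarrow> (\<forall>e\<in>F. K \<le> col e) \<Longrightarrow>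
        \<exists>S. coloured_search.reach ends fs i K col S j"
      by (rule reach_complete[OF yes \<open>0 < k\<close> len]) (assumption, (rule that; assumption))
    \<comment> \<open>Of the two roundings inside \<open>B\<close>, only that of \<open>k\<close> is
      estimated here; that of \<open>mu\<close> stays inside \<open>y\<close>, just as in the number
      of trials.\<close>
    have B2: "2 ^ B = 2 * 2 ^ clog k * y" by (simp add: B_def y_def power_add)
    have "k * mu \<le> 2 ^ clog k * y" unfolding y_def by (intro mult_mono clog_ge) auto
    then have M1: "2 * k * mu \<le> 2 ^ B" by (simp add: B2)
    have "2 ^ clog k * y \<le> 2 * k * y" using clog_upper[OF \<open>0 < k\<close>] by (rule mult_right_mono) simp
    then have M2: "2 ^ B \<le> 4 * k * y" by (simp add: B2)
    have "k * 1 \<le> k * (2 * mu)" using mu2 by (intro mult_left_mono) auto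
    also have "\<dots> = 2 * k * mu" by simp
    also note M1
    finally have KM: "k - 1 \<le> 2 ^ B" by simp
    have "1 / (64 * real y) ^ k \<le>
        (\<Prod>i<card P. real (k - 1 - i)) / real (2 ^ B) ^ card P * (1 - real (k - 1) / real (2 ^ B)) ^ card F"
      using mu2 by (intro good_colouring_bound[OF \<open>0 < k\<close> refl PF(4,5) _ M1 M2]) simp
    also have "\<dots> = measure coin_space {\<omega>. inj_on (colour B \<omega>) P \<and> colour B \<omega> ` P \<subseteq> {..<k - 1} \<and>
           (\<forall>e\<in>F. k - 1 \<le> colour B \<omega> e)}"
      using measure_good_colouring[OF PF(1-3) KM] by simp
    also have "\<dots> \<le> \<delta>"
      unfolding \<delta>_def
    proof (rule coin.finite_measure_mono)
      show "{\<omega>. inj_on (colour B \<omega>) P \<and> colour B \<omega> ` P \<subseteq> {..<k - 1} \<and>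
           (\<forall>e\<in>F. k - 1 \<le> colour B \<omega> e)} \<subseteq> {\<omega>. success_with (colour B \<omega>)}"
        using succ by (auto simp: success_with_def)
      \<comment> \<open>A single round depends on finitely many coins; the case \<open>R = 1\<close>
        of \<open>measure_rounds\<close> yields its measurability.\<close>
      show "{\<omega>. success_with (colour B \<omega>)} \<in> sets coin_space"
        using measure_rounds(1)[where G = "\<lambda>\<omega>. success_with (colour B \<omega>)" and R = 1, OF cong] by simp
    qed
    finally have "1 / (64 * real y) ^ k \<le> \<delta>" .
    then have "1 - real p / real q \<le> 1 - (1 - \<delta>) ^ R"
      using \<open>0 < p\<close> \<open>p < q\<close> L_ge
      by (intro rounds_suffice[where D = "(64 * real y) ^ k" and L = L])
        (auto simp: \<delta>_def R_def y_def)
    also have "\<dots> = measure coin_space {\<omega>. ?hit \<omega>}"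
      unfolding \<delta>_def
      by (rule measure_rounds(2)[where G = "\<lambda>\<omega>. success_with (colour B \<omega>)", OF cong, symmetric])
    finally show ?thesis by (simp add: outputs)
  qed
  show ?case
    unfolding Let_def mu
  proof (intro conjI allI impI, goal_cases)
    case (1 \<omega>)
    show ?case by (rule in_time)
  next
    case (2 \<omega>)
    then show ?case by (rule no)
  next
    case 3
    then show ?case by (rule yes)
  qed
qed

end
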